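(* Let $\mathbb D$ be a small (unsorted) LNL doctrine such that $|\mathbb D|$ is subterminal and all $\mathbb D$-cones are discrete and finite, and let $\mathcal S$ be an LNL polycategory with a functor $\pi:\mathcal S\to|\mathbb D|$, regarded as a $\mathbb D$-sketch with no proto-extremal cones. Let $\widehat{\mathcal S}_{\mathbb D}$ be the free $\mathbb D$-category generated by $\mathcal S$, constructed as described in the context. For each class $\tau\in\{\mathrm L,\mathrm{NL}\}$ (linear, nonlinear), there is a bijection between the valid judgments $R\;\mathsf{type}^{\tau}$ and the objects of $\widehat{\mathcal S}_{\mathbb D}$ of class $\tau$.
   Context: **Signed objects.** Given objects partitioned into linear and nonlinear ones, a signed object is an object $R$ with a sign, written $R^+$ or $R^-$; $K^\bullet$ is $K$ with its sign flipped. A finite list of signed objects is admissible if it contains at most one positive nonlinear object, and if it contains one then it contains no linear objects. A structural map $(K_1,\dots,K_m)\to(K_{\sigma 1},\dots,K_{\sigma n})$ is given by a function $\sigma:\{1,\dots,n\}\to\{1,\dots,m\}$ such that whenever $|\sigma^{-1}(j)|\ne 1$, $K_j$ is negative and nonlinear. **LNL polycategory** $\mathcal P$ (entries-only form): a set of objects partitioned into linear and nonlinear ones; for each admissible list $\Phi$ a set $\mathcal P(\Phi)$ of morphisms, with functorial actions $\mathcal P(\Psi)\to\mathcal P(\Phi)$ of structural maps $\Phi\to\Psi$; identities $1_R\in\mathcal P(R^-,R^+)$; and whenever $(\Phi,K)$ and $(K^\bullet,\Psi)$ are admissible, a composition $\circ_K:\mathcal P(K^\bullet,\Psi)\times\mathcal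 P(\Phi,K)\to\mathcal P(\Phi,\Psi)$, which is associative, unital, and equivariant for structural actions and for permutations swapping the two inputs. A functor consists of functions on linear objects, nonlinear objects and morphisms preserving all this structure. An LNL polycategory is subterminal if it has at most one linear and at most one nonlinear object and each hom-set has at most one element. **Cones.** An abstract cone is a small LNL polycategory $\mathcal C$ with a specified signed object $K$ (the vertex) such that $\mathcal C(\Phi)=\emptyset$ if $\Phi$ contains a copy of $K^\bullet$ or more than one copy of $K$, except that $\mathcal C(K^\bullet,K)=\{1_K\}$. Nonidentity morphisms containing $K$ are abstract projections; morphisms not containing $K$ are abstract transitions. The cone is discrete if it has no nonidentity abstract transitions. The reduct $\partial\mathcal C$ is obtained by removing the underlying object of $K$, its identity, and all abstract projections. For a finite signed list $\Psi$ of new (linear or nonlinear) objects with $(K^\bullet,\Psi)$ admissible, the expansion $\mathcal C_{/\Psi}$ is obtained from $\mathcal C$ by adding the new objects, a new morphism $\tilde f\in\mathcal C_{/\Psi}(\Phi,\Psi)$ for each abstract projection $f\in\mathcal C(\Phi,K)$, and a new morphism $\chi\in\mathcal C_{/\Psi}(K^\bullet,\Psi)$, with $\chi\circ_K f=\tilde f$ and $\tilde f\circ g=\widetilde{f\circ g}$ for abstract transitions $g$. The pre-expansion $\partial(\mathcal C_{/\Psi})$ omits $\chi$. **Doctrines and sketches.** An LNL doctrine $\mathbb D$ is an LNL polycategory $|\mathbb D|$ with a family of functors $G:\mathcal C\to|\mathbb D|$ whose domains are abstract cones, the $\mathbb D$-cones. It is small if $|\mathbb D|$ and the family are small. A $\mathbb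 D$-sketch is an LNL polycategory $\mathcal P$ over $|\mathbb D|$ with, for each $\mathbb D$-cone $G$, a set of lifts of $G$ to $\mathcal P$ called proto-extremal; morphisms are functors over $|\mathbb D|$ preserving proto-extremal lifts. Each $\mathcal C$, $\mathcal C_{/\Psi}$ and $\partial(\mathcal C_{/\Psi})$ (given an extension of $G$ to $\mathcal C_{/\Psi}\to|\mathbb D|$) is a sketch with $G$ (i.e. the inclusion of $\mathcal C$) as only proto-extremal cone, and $\partial\mathcal C$ is a sketch with none. For a cone $\mathcal C$ with vertex $K$, $\mathcal C_{\cong}$ is $\mathcal C$ with an added signed object $K'$ isomorphic to $K$ (mapped to $|\mathbb D|$ by collapsing $K'$ to $K$), with the two sections $\mathcal C\to\mathcal C_\cong$ (sending $K$ to $K$, resp. to $K'$) proto-extremal; $\mathcal C_{\cong}'$ has only the first section proto-extremal. **Construction of $\widehat{\mathcal S}_{\mathbb D}$.** (1) Put $\mathcal S_0=\mathcal S$. Given $\mathcal S_n$, let $\mathcal S_{n+1}$ be the pushout in $\mathbb D$-sketches of $\coprod\partial\mathcal C\to\coprod\mathcal C$ along $\coprod\partial\mathcal C\to\mathcal S_n$, the coproducts over all $\mathbb D$-cones $\mathcal C$ and all sketch morphisms $u:\partial\mathcal C\to\mathcal S_n$ that, when $n>0$, do not factor through $\mathcal S_{n-1}$. Let $\mathcal S_\omega=\operatorname{colim}_n\mathcal S_n$. (2) From $\mathcal S_\omega$, iterate countably many times the pushout along all inclusions $\partial(\mathcal C_{/\Psi})\to\mathcal C_{/\Psi}$ and their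 codiagonals $\mathcal C_{/\Psi}+_{\partial(\mathcal C_{/\Psi})}\mathcal C_{/\Psi}\to\mathcal C_{/\Psi}$, over all maps from their domains into the current stage, and take the colimit $\mathcal S_{\omega+\omega}$. (3) Push out once along all maps $\mathcal C_\cong'\to\mathcal C_\cong$, giving $\widehat{\mathcal S}_{\mathbb D}=\mathcal S_{\omega+\omega+1}$. **Type judgments.** For each $\mathbb D$-cone $\mathcal C$, fix an ordering $\{r_1^{\tau_1},\dots,r_n^{\tau_n}\}$ of the (finitely many) objects of $\partial\mathcal C$, where $r_i$ has class $\tau_i\in\{\mathrm L,\mathrm{NL}\}$; let $\tau_{\mathcal C}$ be the class of its vertex. The valid judgments $R\;\mathsf{type}^\tau$ are inductively generated by: (a) every object $A$ of $\mathcal S$ of class $\tau$ gives $A\;\mathsf{type}^\tau$; (b) if $\mathcal C$ is a $\mathbb D$-cone whose reduct $\partial\mathcal C$ has objects ordered as $\{r_1^{\tau_1},\dots,r_n^{\tau_n}\}$ and whose vertex has class $\tau_{\mathcal C}$, and $R_i\;\mathsf{type}^{\tau_i}$ for $i=1,\dots,n$, then $\bigodot_{\mathcal C}[R_1,\dots,R_n]\;\mathsf{type}^{\tau_{\mathcal C}}$, where $\bigodot_{\mathcal C}[\dots]$ is a formal expression. *)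

theory Defs
  imports "HOL-Library.FuncSet"
begin

section \<open>Signed objects, admissible lists, structural maps\<close>

datatype cls = Lin | NonLin

datatype sign = Pos | Neg

type_synonym 'o signed = "'o \<times> sign"

fun flip :: "'o signed \<Rightarrow> 'o signed" where
  "flip (R, Pos) = (R, Neg)"
| "flip (R, Neg) = (R, Pos)"

abbreviation smap :: "('a \<Rightarrow> 'b) \<Rightarrow> 'a signed list \<Rightarrow> 'b signed list" where
  "smap h \<equiv> map (apfst h)"

definition admissible :: "('o \<Rightarrow> cls) \<Rightarrow> 'o signed list \<Rightarrow> bool" where
  "admissible c \<Phi> \<longleftrightarrow>
     length (filter (\<lambda>(R, s). c R = NonLin \<and> s = Pos) \<Phi>) \<le> 1 \<and>
     ((\<exists>R. (R, Pos) \<in> set \<Phi> \<and> c R = NonLin) \<longrightarrow> (\<forall>(R, s) \<in> set \<Phi>. c R = NonLin))"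

text \<open>
  A structural map from \<open>\<Phi>\<close> to \<open>pull \<Phi> \<sigma>\<close> is given by the function \<open>\<sigma>\<close>, written as the list
  of its values (positions of \<open>\<Phi>\<close>, counted from 0); its codomain is determined by
  \<open>\<Phi>\<close> and \<open>\<sigma>\<close>.
\<close>

definition pull :: "'a list \<Rightarrow> nat list \<Rightarrow> 'a list" where
  "pull \<Phi> \<sigma> = map (\<lambda>k. \<Phi> ! k) \<sigma>"

definition structural :: "('o \<Rightarrow> cls) \<Rightarrow> 'o signed list \<Rightarrow> nat list \<Rightarrow> bool" where
  "structural c \<Phi> \<sigma> \<longleftrightarrow>
     (\<forall>j \<in> set \<sigma>. j < length \<Phi>) \<and>
     (\<forall>j < length \<Phi>. count_list \<sigma> j \<noteq> 1 \<longrightarrow> snd (\<Phi> ! j) = Neg \<and> c (fst (\<Phi> ! j)) = NonLin)"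


section \<open>LNL polycategories\<close>

text \<open>
  Hom-sets are a family, so hom-sets at different lists need not be disjoint; for this reason
  the operations carry the lists they act on. \<open>Act P \<Phi> \<sigma>\<close> is the action
  \<open>Hom P (pull \<Phi> \<sigma>) \<rightarrow> Hom P \<Phi>\<close>, and \<open>Cmp P \<Phi> K \<Psi> g f\<close> is \<open>g \<circ>\<^sub>K f\<close> for
  \<open>f \<in> Hom P (\<Phi>, K)\<close> and \<open>g \<in> Hom P (flip K, \<Psi>)\<close>.
\<close>

record ('o, 'm) lnl =
  Obj :: "'o set"
  cls_of :: "'o \<Rightarrow> cls"
  Hom :: "'o signed list \<Rightarrow> 'm set"
  Act :: "'o signed list \<Rightarrow> nat list \<Rightarrow> 'm \<Rightarrow> 'm"
  Idn :: "'o \<Rightarrow> 'm"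
  Cmp :: "'o signed list \<Rightarrow> 'o signed \<Rightarrow> 'o signed list \<Rightarrow> 'm \<Rightarrow> 'm \<Rightarrow> 'm"

definition adm_list :: "('o, 'm) lnl \<Rightarrow> 'o signed list \<Rightarrow> bool" where
  "adm_list P \<Phi> \<longleftrightarrow> fst ` set \<Phi> \<subseteq> Obj P \<and> admissible (cls_of P) \<Phi>"

text \<open>The identity of the object under \<open>K\<close>, placed in the hom-set of \<open>(flip K, K)\<close>.\<close>

definition unit_at :: "('o, 'm) lnl \<Rightarrow> 'o signed \<Rightarrow> 'm" where
  "unit_at P K =
     (if snd K = Pos then Idn P (fst K) else Act P [flip K, K] [1, 0] (Idn P (fst K)))"

text \<open>
  One associativity law suffices: three composable morphisms always form a path, and \<open>swap\<close>
  exchanges the two inputs of a composition. Equivariance for structural actions is split into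
  actions away from the object composed along (\<open>equivariant\<close>), and the weakening and
  contraction of that object itself, in which case the other morphism is discarded or duplicated.
\<close>

locale lnl_polycategory =
  fixes P :: "('o, 'm) lnl"
  assumes Hom_adm: "f \<in> Hom P \<Phi> \<Longrightarrow> adm_list P \<Phi>"
    and Act_in: "\<lbrakk>adm_list P \<Phi>; structural (cls_of P) \<Phi> \<sigma>; f \<in> Hom P (pull \<Phi> \<sigma>)\<rbrakk>
      \<Longrightarrow> Act P \<Phi> \<sigma> f \<in> Hom P \<Phi>"
    and Act_id: "f \<in> Hom P \<Phi> \<Longrightarrow> Act P \<Phi> [0..<length \<Phi>] f = f"
    and Act_comp: "\<lbrakk>adm_list P \<Phi>; structural (cls_of P) \<Phi> \<sigma>;
        structural (cls_of P) (pull \<Phi> \<sigma>) \<tau>; f \<in> Hom P (pull (pull \<Phi> \<sigma>) \<tau>)\<rbrakk>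
      \<Longrightarrow> Act P \<Phi> \<sigma> (Act P (pull \<Phi> \<sigma>) \<tau> f) = Act P \<Phi> (pull \<sigma> \<tau>) f"
    and Idn_in: "R \<in> Obj P \<Longrightarrow> Idn P R \<in> Hom P [(R, Neg), (R, Pos)]"
    and Cmp_in: "\<lbrakk>f \<in> Hom P (\<Phi> @ [K]); g \<in> Hom P (flip K # \<Psi>)\<rbrakk>
      \<Longrightarrow> Cmp P \<Phi> K \<Psi> g f \<in> Hom P (\<Phi> @ \<Psi>)"
    and unit_left: "f \<in> Hom P (\<Phi> @ [K]) \<Longrightarrow> Cmp P \<Phi> K [K] (unit_at P K) f = f"
    and unit_right: "g \<in> Hom P (flip K # \<Psi>) \<Longrightarrow> Cmp P [flip K] K \<Psi> g (unit_at P K) = g"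
    and assoc: "\<lbrakk>f \<in> Hom P (\<Phi> @ [K]); g \<in> Hom P (flip K # \<Psi> @ [M]); h \<in> Hom P (flip M # \<Xi>)\<rbrakk>
      \<Longrightarrow> Cmp P (\<Phi> @ \<Psi>) M \<Xi> h (Cmp P \<Phi> K (\<Psi> @ [M]) g f)
        = Cmp P \<Phi> K (\<Psi> @ \<Xi>) (Cmp P (flip K # \<Psi>) M \<Xi> h g) f"
    and swap: "\<lbrakk>f \<in> Hom P (\<Phi> @ [K]); g \<in> Hom P (flip K # \<Psi>); n = length \<Phi>; m = length \<Psi>\<rbrakk>
      \<Longrightarrow> Cmp P \<Phi> K \<Psi> g f
        = Act P (\<Phi> @ \<Psi>) ([n..<n + m] @ [0..<n])
            (Cmp P \<Psi> (flip K) \<Phi>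
              (Act P (K # \<Phi>) ([1..<Suc n] @ [0]) f)
              (Act P (\<Psi> @ [flip K]) (m # [0..<m]) g))"
    and equivariant: "\<lbrakk>adm_list P (\<Phi> @ [K]); adm_list P (flip K # \<Psi>);
        structural (cls_of P) \<Phi> \<sigma>; structural (cls_of P) \<Psi> \<tau>;
        f \<in> Hom P (pull \<Phi> \<sigma> @ [K]); g \<in> Hom P (flip K # pull \<Psi> \<tau>)\<rbrakk>
      \<Longrightarrow> Cmp P \<Phi> K \<Psi>
            (Act P (flip K # \<Psi>) (0 # map Suc \<tau>) g)
            (Act P (\<Phi> @ [K]) (\<sigma> @ [length \<Phi>]) f)
        = Act P (\<Phi> @ \<Psi>) (\<sigma> @ map (\<lambda>k. length \<Phi> + k) \<tau>)
            (Cmp P (pull \<Phi> \<sigma>) K (pull \<Psi> \<tau>) g f)"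
    and weakening: "\<lbrakk>K = (R, Pos); cls_of P R = NonLin; f \<in> Hom P (\<Phi> @ [K]); g \<in> Hom P \<Psi>;
        n = length \<Phi>; m = length \<Psi>\<rbrakk>
      \<Longrightarrow> Cmp P \<Phi> K \<Psi> (Act P (flip K # \<Psi>) [1..<Suc m] g) f
        = Act P (\<Phi> @ \<Psi>) [n..<n + m] g"
    and contraction: "\<lbrakk>K = (R, Pos); cls_of P R = NonLin; f \<in> Hom P (\<Phi> @ [K]);
        g \<in> Hom P (flip K # flip K # \<Psi>); n = length \<Phi>; m = length \<Psi>\<rbrakk>
      \<Longrightarrow> Cmp P \<Phi> K \<Psi> (Act P (flip K # \<Psi>) (0 # [0..<Suc m]) g) f
        = Act P (\<Phi> @ \<Psi>) ([0..<n] @ [0..<n + m])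
            (Cmp P \<Phi> K (\<Phi> @ \<Psi>)
              (Act P (flip K # \<Phi> @ \<Psi>) ([1..<Suc n] @ 0 # [Suc n..<Suc (n + m)])
                (Cmp P \<Phi> K (flip K # \<Psi>) g f))
              f)"

definition subterminal :: "('o, 'm) lnl \<Rightarrow> bool" where
  "subterminal P \<longleftrightarrow>
     (\<forall>A \<in> Obj P. \<forall>B \<in> Obj P. cls_of P A = cls_of P B \<longrightarrow> A = B) \<and>
     (\<forall>\<Phi>. \<forall>f \<in> Hom P \<Phi>. \<forall>g \<in> Hom P \<Phi>. f = g)"

text \<open>
  Functors are taken extensional, i.e. undefined outside their domain, so that equality of
  functors is equality in the logic. This matters because sets of functors index the
  pushouts below.
\<close>

record ('a, 'm, 'b, 'n) lnl_fun =
  on_obj :: "'a \<Rightarrow> 'b"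
  on_hom :: "'a signed list \<Rightarrow> 'm \<Rightarrow> 'n"

definition is_functor :: "('a, 'm) lnl \<Rightarrow> ('b, 'n) lnl \<Rightarrow> ('a, 'm, 'b, 'n) lnl_fun \<Rightarrow> bool" where
  "is_functor P Q F \<longleftrightarrow>
     on_obj F \<in> Obj P \<rightarrow>\<^sub>E Obj Q \<and>
     (\<forall>A \<in> Obj P. cls_of Q (on_obj F A) = cls_of P A) \<and>
     (\<forall>\<Phi>. on_hom F \<Phi> \<in> Hom P \<Phi> \<rightarrow>\<^sub>E Hom Q (smap (on_obj F) \<Phi>)) \<and>
     (\<forall>\<Phi> \<sigma>. \<forall>f \<in> Hom P (pull \<Phi> \<sigma>). adm_list P \<Phi> \<longrightarrow> structural (cls_of P) \<Phi> \<sigma> \<longrightarrow>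
        on_hom F \<Phi> (Act P \<Phi> \<sigma> f)
          = Act Q (smap (on_obj F) \<Phi>) \<sigma> (on_hom F (pull \<Phi> \<sigma>) f)) \<and>
     (\<forall>A \<in> Obj P. on_hom F [(A, Neg), (A, Pos)] (Idn P A) = Idn Q (on_obj F A)) \<and>
     (\<forall>\<Phi> K \<Psi>. \<forall>f \<in> Hom P (\<Phi> @ [K]). \<forall>g \<in> Hom P (flip K # \<Psi>).
        on_hom F (\<Phi> @ \<Psi>) (Cmp P \<Phi> K \<Psi> g f)
          = Cmp Q (smap (on_obj F) \<Phi>) (apfst (on_obj F) K) (smap (on_obj F) \<Psi>)
              (on_hom F (flip K # \<Psi>) g) (on_hom F (\<Phi> @ [K]) f))"

definition comp_fun ::
  "('a, 'm) lnl \<Rightarrow> ('b, 'n, 'c, 'k) lnl_fun \<Rightarrow> ('a, 'm, 'b, 'n) lnl_fun \<Rightarrow> ('a, 'm, 'c, 'k) lnl_fun"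
  where
  "comp_fun P G F = \<lparr>
     on_obj = (\<lambda>A \<in> Obj P. on_obj G (on_obj F A)),
     on_hom = (\<lambda>\<Phi>. \<lambda>f \<in> Hom P \<Phi>. on_hom G (smap (on_obj F) \<Phi>) (on_hom F \<Phi> f)) \<rparr>"

text \<open>The identity functor of \<open>P\<close>; also the inclusion of \<open>P\<close> into anything containing it.\<close>

definition id_fun :: "('a, 'm) lnl \<Rightarrow> ('a, 'm, 'a, 'm) lnl_fun" where
  "id_fun P = \<lparr> on_obj = (\<lambda>A \<in> Obj P. A), on_hom = (\<lambda>\<Phi>. \<lambda>f \<in> Hom P \<Phi>. f) \<rparr>"


section \<open>Abstract cones\<close>

text \<open>
  The image of an identity under a structural map. Such morphisms exist in every LNL
  polycategory: besides the transposed identity they are the weakenings of an identity by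
  nonlinear objects. They are counted as identity morphisms below.
\<close>

definition identity_image :: "('o, 'm) lnl \<Rightarrow> 'o \<Rightarrow> 'o signed list \<Rightarrow> nat list \<Rightarrow> 'm \<Rightarrow> bool" where
  "identity_image P R \<Phi> \<sigma> f \<longleftrightarrow>
     R \<in> Obj P \<and> adm_list P \<Phi> \<and> structural (cls_of P) \<Phi> \<sigma> \<and>
     pull \<Phi> \<sigma> = [(R, Neg), (R, Pos)] \<and> f = Act P \<Phi> \<sigma> (Idn P R)"

text \<open>
  The emptiness condition on the hom-sets of a cone has to be read up to structural actions: if
  \<open>C(\<Phi>)\<close> is inhabited then so is every weakening of it, including weakenings by the vertex
  \<open>K\<close> or by \<open>flip K\<close> when that is negative and nonlinear, and \<open>C(flip K, K)\<close> is
  in bijection with \<open>C(K, flip K)\<close>. So every morphism is required to be a structural image of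
  the identity of \<open>K\<close> or of a morphism in whose list \<open>flip K\<close> does not occur and
  \<open>K\<close> occurs at most once.
\<close>

definition abstract_cone :: "('o, 'm) lnl \<Rightarrow> 'o signed \<Rightarrow> bool" where
  "abstract_cone C K \<longleftrightarrow>
     lnl_polycategory C \<and> fst K \<in> Obj C \<and>
     (\<forall>\<Phi>. \<forall>f \<in> Hom C \<Phi>.
        (\<exists>\<sigma>. identity_image C (fst K) \<Phi> \<sigma> f) \<or>
        (\<exists>\<sigma>. structural (cls_of C) \<Phi> \<sigma> \<and> f \<in> Act C \<Phi> \<sigma> ` Hom C (pull \<Phi> \<sigma>) \<and>
              flip K \<notin> set (pull \<Phi> \<sigma>) \<and> count_list (pull \<Phi> \<sigma>) K \<le> 1))"

definition abstract_projection ::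
  "('o, 'm) lnl \<Rightarrow> 'o signed \<Rightarrow> 'o signed list \<Rightarrow> 'm \<Rightarrow> bool" where
  "abstract_projection C K \<Phi> f \<longleftrightarrow>
     f \<in> Hom C \<Phi> \<and> K \<in> set \<Phi> \<and> (\<nexists>R \<sigma>. identity_image C R \<Phi> \<sigma> f)"

text \<open>The hom-sets of the reduct consist exactly of the abstract transitions.\<close>

definition reduct :: "('o, 'm) lnl \<Rightarrow> 'o signed \<Rightarrow> ('o, 'm) lnl" where
  "reduct C K = C\<lparr> Obj := Obj C - {fst K},
                   Hom := (\<lambda>\<Phi>. if fst K \<in> fst ` set \<Phi> then {} else Hom C \<Phi>) \<rparr>"

text \<open>
  No nonidentity abstract transitions: every transition is a structural image of an identity, and
  is so in only one way. Uniqueness says that the transitions satisfy no equations beyond those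
  of an LNL polycategory, such as equality of the two projections from \<open>(r, r)\<close> to a
  nonlinear \<open>r\<close>; so the reduct is no more than a set of objects.
\<close>

definition discrete_cone :: "('o, 'm) lnl \<Rightarrow> 'o signed \<Rightarrow> bool" where
  "discrete_cone C K \<longleftrightarrow>
     (\<forall>\<Phi>. \<forall>f \<in> Hom (reduct C K) \<Phi>. \<exists>!(R, \<sigma>). identity_image (reduct C K) R \<Phi> \<sigma> f)"

definition finite_cone :: "('o, 'm) lnl \<Rightarrow> bool" where
  "finite_cone C \<longleftrightarrow> finite (Obj C)"

text \<open>
  The isomorphic copy \<open>K'\<close> of the vertex has underlying object \<open>None\<close>. Since \<open>K'\<close>
  is isomorphic to \<open>K\<close>, hom-sets are those of \<open>C\<close> after collapsing \<open>K'\<close> to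
  \<open>K\<close>.
\<close>

definition collapse :: "'o signed \<Rightarrow> 'o option \<Rightarrow> 'o" where
  "collapse K x = (case x of None \<Rightarrow> fst K | Some A \<Rightarrow> A)"

definition iso_cone :: "('o, 'm) lnl \<Rightarrow> 'o signed \<Rightarrow> ('o option, 'm) lnl" where
  "iso_cone C K = (let c = collapse K; O' = insert None (Some ` Obj C) in \<lparr>
     Obj = O',
     cls_of = (\<lambda>x. cls_of C (c x)),
     Hom = (\<lambda>\<Phi>. if fst ` set \<Phi> \<subseteq> O' then Hom C (smap c \<Phi>) else {}),
     Act = (\<lambda>\<Phi>. Act C (smap c \<Phi>)),
     Idn = (\<lambda>x. Idn C (c x)),
     Cmp = (\<lambda>\<Phi> M \<Psi>. Cmp C (smap c \<Phi>) (apfst c M) (smap c \<Psi>)) \<rparr>)"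

definition collapse_fun :: "('o, 'm) lnl \<Rightarrow> 'o signed \<Rightarrow> ('o option, 'm, 'o, 'm) lnl_fun" where
  "collapse_fun C K = \<lparr>
     on_obj = (\<lambda>x \<in> Obj (iso_cone C K). collapse K x),
     on_hom = (\<lambda>\<Phi>. \<lambda>f \<in> Hom (iso_cone C K) \<Phi>. f) \<rparr>"

definition iso_section1 :: "('o, 'm) lnl \<Rightarrow> ('o, 'm, 'o option, 'm) lnl_fun" where
  "iso_section1 C = \<lparr>
     on_obj = (\<lambda>A \<in> Obj C. Some A),
     on_hom = (\<lambda>\<Phi>. \<lambda>f \<in> Hom C \<Phi>. f) \<rparr>"

definition iso_section2 :: "('o, 'm) lnl \<Rightarrow> 'o signed \<Rightarrow> ('o, 'm, 'o option, 'm) lnl_fun" where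
  "iso_section2 C K = \<lparr>
     on_obj = (\<lambda>A \<in> Obj C. if A = fst K then None else Some A),
     on_hom = (\<lambda>\<Phi>. \<lambda>f \<in> Hom C \<Phi>. f) \<rparr>"


section \<open>Expansions\<close>

text \<open>
  A list of new signed objects is given by the classes and signs of its entries; the \<open>j\<close>th
  entry has underlying object \<open>Inr j\<close>.
\<close>

type_synonym shape = "(cls \<times> sign) list"

definition new_list :: "shape \<Rightarrow> ('o + nat) signed list" where
  "new_list ps = map (\<lambda>j. (Inr j, snd (ps ! j))) [0..<length ps]"

fun exp_cls :: "('o, 'm) lnl \<Rightarrow> shape \<Rightarrow> 'o + nat \<Rightarrow> cls" where
  "exp_cls C ps (Inl A) = cls_of C A"
| "exp_cls C ps (Inr j) = fst (ps ! j)"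

definition shape_ok :: "('o, 'm) lnl \<Rightarrow> 'o signed \<Rightarrow> shape \<Rightarrow> bool" where
  "shape_ok C K ps \<longleftrightarrow> admissible (exp_cls C ps) (apfst Inl (flip K) # new_list ps)"

record ('o, 'm) expansion =
  ex_cat :: "('o + nat, 'm) lnl"
  ex_incl :: "('o, 'm, 'o + nat, 'm) lnl_fun"
  ex_chi :: 'm

text \<open>
  The expansion is the LNL polycategory presented by \<open>C\<close>, the new objects, and the new
  morphism \<open>\<chi>\<close>. The new morphism attached to an abstract projection \<open>f\<close> is named by its
  defining equation, as \<open>\<chi> \<circ>\<^sub>K f\<close> (see \<open>ex_tilde\<close>); its compatibility with composition
  by transitions is then associativity.
\<close>

definition is_expansion ::
  "('o, 'm) lnl \<Rightarrow> 'o signed \<Rightarrow> shape \<Rightarrow> ('o, 'm) expansion \<Rightarrow> bool" where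
  "is_expansion C K ps X \<longleftrightarrow>
     lnl_polycategory (ex_cat X) \<and>
     Obj (ex_cat X) = Inl ` Obj C \<union> Inr ` {..<length ps} \<and>
     (\<forall>x \<in> Obj (ex_cat X). cls_of (ex_cat X) x = exp_cls C ps x) \<and>
     is_functor C (ex_cat X) (ex_incl X) \<and>
     on_obj (ex_incl X) = (\<lambda>A \<in> Obj C. Inl A) \<and>
     ex_chi X \<in> Hom (ex_cat X) (apfst Inl (flip K) # new_list ps) \<and>
     (\<forall>(Q :: ('o + nat, 'm) lnl) F q y.
        lnl_polycategory Q \<longrightarrow> is_functor C Q F \<longrightarrow>
        (\<forall>j < length ps. q j \<in> Obj Q \<and> cls_of Q (q j) = fst (ps ! j)) \<longrightarrow>
        y \<in> Hom Q (apfst (on_obj F) (flip K) # map (\<lambda>j. (q j, snd (ps ! j))) [0..<length ps]) \<longrightarrow>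
        (\<exists>!H. is_functor (ex_cat X) Q H \<and> comp_fun C H (ex_incl X) = F \<and>
              (\<forall>j < length ps. on_obj H (Inr j) = q j) \<and>
              on_hom H (apfst Inl (flip K) # new_list ps) (ex_chi X) = y))"

definition ex_tilde ::
  "'o signed \<Rightarrow> shape \<Rightarrow> ('o, 'm) expansion \<Rightarrow> 'o signed list \<Rightarrow> 'm \<Rightarrow> 'm" where
  "ex_tilde K ps X \<Phi> f =
     Cmp (ex_cat X) (smap Inl \<Phi>) (apfst Inl K) (new_list ps) (ex_chi X)
       (on_hom (ex_incl X) (\<Phi> @ [K]) f)"

text \<open>
  The pre-expansion omits \<open>\<chi>\<close> together with its structural images: it contains what is
  generated by everything else.
\<close>

inductive pre_hom ::
  "('o, 'm) lnl \<Rightarrow> 'o signed \<Rightarrow> shape \<Rightarrow> ('o, 'm) expansion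
     \<Rightarrow> ('o + nat) signed list \<Rightarrow> 'm \<Rightarrow> bool"
  for C K ps X where
  old: "f \<in> Hom C \<Phi> \<Longrightarrow> pre_hom C K ps X (smap Inl \<Phi>) (on_hom (ex_incl X) \<Phi> f)"
| tilde: "abstract_projection C K (\<Phi> @ [K]) f
    \<Longrightarrow> pre_hom C K ps X (smap Inl \<Phi> @ new_list ps) (ex_tilde K ps X \<Phi> f)"
| idn: "R \<in> Obj (ex_cat X) \<Longrightarrow> pre_hom C K ps X [(R, Neg), (R, Pos)] (Idn (ex_cat X) R)"
| act: "\<lbrakk>pre_hom C K ps X (pull \<Phi> \<sigma>) f; adm_list (ex_cat X) \<Phi>;
          structural (cls_of (ex_cat X)) \<Phi> \<sigma>\<rbrakk>
    \<Longrightarrow> pre_hom C K ps X \<Phi> (Act (ex_cat X) \<Phi> \<sigma> f)"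
| cmp: "\<lbrakk>pre_hom C K ps X (\<Phi> @ [M]) f; pre_hom C K ps X (flip M # \<Psi>) g\<rbrakk>
    \<Longrightarrow> pre_hom C K ps X (\<Phi> @ \<Psi>) (Cmp (ex_cat X) \<Phi> M \<Psi> g f)"

definition pre_expansion ::
  "('o, 'm) lnl \<Rightarrow> 'o signed \<Rightarrow> shape \<Rightarrow> ('o, 'm) expansion \<Rightarrow> ('o + nat, 'm) lnl" where
  "pre_expansion C K ps X = (ex_cat X)\<lparr> Hom := (\<lambda>\<Phi>. {f. pre_hom C K ps X \<Phi> f}) \<rparr>"


section \<open>Doctrines and sketches\<close>

record ('o, 'm, 'i) doctrine =
  base :: "('o, 'm) lnl"
  cones :: "'i set"
  cone :: "'i \<Rightarrow> ('o, 'm) lnl"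
  vertex :: "'i \<Rightarrow> 'o signed"
  cone_fun :: "'i \<Rightarrow> ('o, 'm, 'o, 'm) lnl_fun"

definition lnl_doctrine :: "('o, 'm, 'i) doctrine \<Rightarrow> bool" where
  "lnl_doctrine D \<longleftrightarrow>
     lnl_polycategory (base D) \<and>
     (\<forall>i \<in> cones D. abstract_cone (cone D i) (vertex D i) \<and>
        is_functor (cone D i) (base D) (cone_fun D i))"

text \<open>
  A sketch with objects in \<open>'a\<close> and morphisms in \<open>'b\<close>, over a doctrine with data in
  \<open>'o\<close>, \<open>'m\<close>, \<open>'i\<close>.
\<close>

record ('a, 'b, 'o, 'm, 'i) sketch =
  sk_cat :: "('a, 'b) lnl"
  sk_proj :: "('a, 'b, 'o, 'm) lnl_fun"
  sk_ext :: "'i \<Rightarrow> ('o, 'm, 'a, 'b) lnl_fun set"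

definition is_sketch :: "('o, 'm, 'i) doctrine \<Rightarrow> ('a, 'b, 'o, 'm, 'i) sketch \<Rightarrow> bool" where
  "is_sketch D T \<longleftrightarrow>
     lnl_polycategory (sk_cat T) \<and> is_functor (sk_cat T) (base D) (sk_proj T) \<and>
     (\<forall>i \<in> cones D. \<forall>F \<in> sk_ext T i.
        is_functor (cone D i) (sk_cat T) F \<and> comp_fun (cone D i) (sk_proj T) F = cone_fun D i)"

definition sketch_mor ::
  "('o, 'm, 'i) doctrine \<Rightarrow> ('a, 'b, 'o, 'm, 'i) sketch \<Rightarrow> ('c, 'd, 'o, 'm, 'i) sketch
     \<Rightarrow> ('a, 'b, 'c, 'd) lnl_fun \<Rightarrow> bool" where
  "sketch_mor D T U H \<longleftrightarrow>
     is_functor (sk_cat T) (sk_cat U) H \<and>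
     comp_fun (sk_cat T) (sk_proj U) H = sk_proj T \<and>
     (\<forall>i \<in> cones D. \<forall>F \<in> sk_ext T i. comp_fun (cone D i) H F \<in> sk_ext U i)"

abbreviation sk_comp ::
  "('a, 'b, 'o, 'm, 'i) sketch \<Rightarrow> ('c, 'd, 'e, 'f) lnl_fun \<Rightarrow> ('a, 'b, 'c, 'd) lnl_fun
     \<Rightarrow> ('a, 'b, 'e, 'f) lnl_fun" where
  "sk_comp T \<equiv> comp_fun (sk_cat T)"

definition plain_sketch ::
  "('a, 'b) lnl \<Rightarrow> ('a, 'b, 'o, 'm) lnl_fun \<Rightarrow> ('a, 'b, 'o, 'm, 'i) sketch" where
  "plain_sketch P p = \<lparr> sk_cat = P, sk_proj = p, sk_ext = (\<lambda>_. {}) \<rparr>"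

definition cone_sketch :: "('o, 'm, 'i) doctrine \<Rightarrow> 'i \<Rightarrow> ('o, 'm, 'o, 'm, 'i) sketch" where
  "cone_sketch D i = \<lparr> sk_cat = cone D i, sk_proj = cone_fun D i,
     sk_ext = (\<lambda>_. {})(i := {id_fun (cone D i)}) \<rparr>"

definition reduct_sketch :: "('o, 'm, 'i) doctrine \<Rightarrow> 'i \<Rightarrow> ('o, 'm, 'o, 'm, 'i) sketch" where
  "reduct_sketch D i = (let R = reduct (cone D i) (vertex D i) in
     plain_sketch R (comp_fun R (cone_fun D i) (id_fun R)))"

definition exp_sketch ::
  "'i \<Rightarrow> ('o, 'm) expansion \<Rightarrow> ('o + nat, 'm, 'o, 'm) lnl_fun
     \<Rightarrow> ('o + nat, 'm, 'o, 'm, 'i) sketch" where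
  "exp_sketch i X G = \<lparr> sk_cat = ex_cat X, sk_proj = G,
     sk_ext = (\<lambda>_. {})(i := {ex_incl X}) \<rparr>"

definition pre_exp_sketch ::
  "('o, 'm, 'i) doctrine \<Rightarrow> 'i \<Rightarrow> shape \<Rightarrow> ('o, 'm) expansion \<Rightarrow> ('o + nat, 'm, 'o, 'm) lnl_fun
     \<Rightarrow> ('o + nat, 'm, 'o, 'm, 'i) sketch" where
  "pre_exp_sketch D i ps X G = (let R = pre_expansion (cone D i) (vertex D i) ps X in
     \<lparr> sk_cat = R, sk_proj = comp_fun R G (id_fun R), sk_ext = (\<lambda>_. {})(i := {ex_incl X}) \<rparr>)"

definition iso_sketch :: "('o, 'm, 'i) doctrine \<Rightarrow> 'i \<Rightarrow> ('o option, 'm, 'o, 'm, 'i) sketch" where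
  "iso_sketch D i = (let C = cone D i; K = vertex D i in
     \<lparr> sk_cat = iso_cone C K,
       sk_proj = comp_fun (iso_cone C K) (cone_fun D i) (collapse_fun C K),
       sk_ext = (\<lambda>_. {})(i := {iso_section1 C, iso_section2 C K}) \<rparr>)"

definition iso_sketch' :: "('o, 'm, 'i) doctrine \<Rightarrow> 'i \<Rightarrow> ('o option, 'm, 'o, 'm, 'i) sketch" where
  "iso_sketch' D i = (iso_sketch D i)\<lparr> sk_ext := (\<lambda>_. {})(i := {iso_section1 (cone D i)}) \<rparr>"


section \<open>Colimits of sketches\<close>

text \<open>
  \<open>T'\<close> is the pushout of \<open>\<Coprod>\<^sub>x A x \<rightarrow> \<Coprod>\<^sub>x B x\<close> along \<open>\<Coprod>\<^sub>x A x \<rightarrow> T\<close>, where \<open>x\<close>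
  ranges over \<open>X\<close>, with coprojections \<open>j\<close> and \<open>k\<close>; maps out of the coproducts are
  given by their components, so that the coproducts are not formed separately.
  As in all universal properties here, the test objects have their data in the same types as
  the colimit: these types play the role of the universe in which small sketches live. A colimit
  with respect to a larger universe is in particular a colimit in this sense.
\<close>

definition is_pushout ::
  "('o, 'm, 'i) doctrine \<Rightarrow> 'x set
     \<Rightarrow> ('x \<Rightarrow> ('a, 'b, 'o, 'm, 'i) sketch) \<Rightarrow> ('x \<Rightarrow> ('c, 'd, 'o, 'm, 'i) sketch)
     \<Rightarrow> ('x \<Rightarrow> ('a, 'b, 'c, 'd) lnl_fun) \<Rightarrow> ('x \<Rightarrow> ('a, 'b, 'e, 'f) lnl_fun)
     \<Rightarrow> ('e, 'f, 'o, 'm, 'i) sketch \<Rightarrow> ('e, 'f, 'o, 'm, 'i) sketch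
     \<Rightarrow> ('e, 'f, 'e, 'f) lnl_fun \<Rightarrow> ('x \<Rightarrow> ('c, 'd, 'e, 'f) lnl_fun) \<Rightarrow> bool" where
  "is_pushout D X A B a u T T' j k \<longleftrightarrow>
     is_sketch D T' \<and> sketch_mor D T T' j \<and>
     (\<forall>x \<in> X. sketch_mor D (B x) T' (k x) \<and>
        sk_comp (A x) (k x) (a x) = sk_comp (A x) j (u x)) \<and>
     (\<forall>(Q :: ('e, 'f, 'o, 'm, 'i) sketch) j' k'.
        is_sketch D Q \<longrightarrow> sketch_mor D T Q j' \<longrightarrow>
        (\<forall>x \<in> X. sketch_mor D (B x) Q (k' x) \<and>
           sk_comp (A x) (k' x) (a x) = sk_comp (A x) j' (u x)) \<longrightarrow>
        (\<exists>!h. sketch_mor D T' Q h \<and> sk_comp T h j = j' \<and>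
              (\<forall>x \<in> X. sk_comp (B x) h (k x) = k' x)))"

definition is_seq_colimit ::
  "('o, 'm, 'i) doctrine \<Rightarrow> (nat \<Rightarrow> ('e, 'f, 'o, 'm, 'i) sketch)
     \<Rightarrow> (nat \<Rightarrow> ('e, 'f, 'e, 'f) lnl_fun) \<Rightarrow> ('e, 'f, 'o, 'm, 'i) sketch
     \<Rightarrow> (nat \<Rightarrow> ('e, 'f, 'e, 'f) lnl_fun) \<Rightarrow> bool" where
  "is_seq_colimit D T t L l \<longleftrightarrow>
     is_sketch D L \<and>
     (\<forall>n. sketch_mor D (T n) L (l n) \<and> sk_comp (T n) (l (Suc n)) (t n) = l n) \<and>
     (\<forall>(Q :: ('e, 'f, 'o, 'm, 'i) sketch) l'.
        is_sketch D Q \<longrightarrow>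
        (\<forall>n. sketch_mor D (T n) Q (l' n) \<and> sk_comp (T n) (l' (Suc n)) (t n) = l' n) \<longrightarrow>
        (\<exists>!h. sketch_mor D L Q h \<and> (\<forall>n. sk_comp (T n) h (l n) = l' n)))"


section \<open>The construction of the free category over a doctrine\<close>

definition cone_maps ::
  "('o, 'm, 'i) doctrine \<Rightarrow> (nat \<Rightarrow> ('o, 'm, 'o, 'm, 'i) sketch)
     \<Rightarrow> (nat \<Rightarrow> ('o, 'm, 'o, 'm) lnl_fun) \<Rightarrow> nat \<Rightarrow> ('i \<times> ('o, 'm, 'o, 'm) lnl_fun) set" where
  "cone_maps D T t n = {(i, u). i \<in> cones D \<and> sketch_mor D (reduct_sketch D i) (T n) u \<and>
     (n > 0 \<longrightarrow> (\<nexists>v. sketch_mor D (reduct_sketch D i) (T (n - 1)) v \<and>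
                     u = sk_comp (reduct_sketch D i) (t (n - 1)) v))}"

definition phase1 ::
  "('o, 'm, 'i) doctrine \<Rightarrow> ('o, 'm, 'o, 'm, 'i) sketch \<Rightarrow> ('o, 'm, 'o, 'm, 'i) sketch \<Rightarrow> bool" where
  "phase1 D S L \<longleftrightarrow>
     (\<exists>T t l. T 0 = S \<and>
        (\<forall>n. \<exists>k. is_pushout D (cone_maps D T t n)
                   (\<lambda>(i, u). reduct_sketch D i) (\<lambda>(i, u). cone_sketch D i)
                   (\<lambda>(i, u). id_fun (reduct (cone D i) (vertex D i))) (\<lambda>(i, u). u)
                   (T n) (T (Suc n)) (t n) k) \<and>
        is_seq_colimit D T t L l)"

text \<open>
  A pushout \<open>W\<close> of the inclusion of the pre-expansion along itself, with its codiagonal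
  \<open>c\<close>.
\<close>

definition is_codiagonal ::
  "('o, 'm, 'i) doctrine \<Rightarrow> 'i \<Rightarrow> shape \<Rightarrow> ('o, 'm) expansion \<Rightarrow> ('o + nat, 'm, 'o, 'm) lnl_fun
     \<Rightarrow> ('o + nat, 'm, 'o, 'm, 'i) sketch \<Rightarrow> ('o + nat, 'm, 'o + nat, 'm) lnl_fun \<Rightarrow> bool" where
  "is_codiagonal D i ps X G W c \<longleftrightarrow>
     (let A = pre_exp_sketch D i ps X G; B = exp_sketch i X G; a = id_fun (sk_cat A) in
      \<exists>j k. is_pushout D {()} (\<lambda>_. A) (\<lambda>_. B) (\<lambda>_. a) (\<lambda>_. a) B W j (\<lambda>_. k) \<and>
        sketch_mor D W B c \<and>
        sk_comp B c j = id_fun (sk_cat B) \<and> sk_comp B c k = id_fun (sk_cat B))"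

text \<open>
  The pairs of an expansion \<open>ps\<close> of the cone \<open>i\<close> and an extension \<open>G\<close> of the functor
  of \<open>i\<close> to it.
\<close>

definition exp_indices ::
  "('o, 'm, 'i) doctrine \<Rightarrow> ('i \<Rightarrow> shape \<Rightarrow> ('o, 'm) expansion)
     \<Rightarrow> ('i \<times> shape \<times> ('o + nat, 'm, 'o, 'm) lnl_fun) set" where
  "exp_indices D X = {(i, ps, G). i \<in> cones D \<and> shape_ok (cone D i) (vertex D i) ps \<and>
     is_functor (ex_cat (X i ps)) (base D) G \<and>
     comp_fun (cone D i) G (ex_incl (X i ps)) = cone_fun D i}"

text \<open>
  The first component of an index of the pushouts of phase 2 distinguishes inclusions
  (\<open>True\<close>) from codiagonals (\<open>False\<close>).
\<close>

definition exp_maps ::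
  "('o, 'm, 'i) doctrine \<Rightarrow> ('i \<Rightarrow> shape \<Rightarrow> ('o, 'm) expansion)
     \<Rightarrow> ('i \<times> shape \<times> ('o + nat, 'm, 'o, 'm) lnl_fun \<Rightarrow> ('o + nat, 'm, 'o, 'm, 'i) sketch)
     \<Rightarrow> ('o, 'm, 'o, 'm, 'i) sketch
     \<Rightarrow> (bool \<times> ('i \<times> shape \<times> ('o + nat, 'm, 'o, 'm) lnl_fun)
          \<times> ('o + nat, 'm, 'o, 'm) lnl_fun) set" where
  "exp_maps D X W T =
     {(True, (i, ps, G), u) | i ps G u. (i, ps, G) \<in> exp_indices D X \<and>
        sketch_mor D (pre_exp_sketch D i ps (X i ps) G) T u} \<union>
     {(False, e, u) | e u. e \<in> exp_indices D X \<and> sketch_mor D (W e) T u}"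

definition phase2 ::
  "('o, 'm, 'i) doctrine \<Rightarrow> ('o, 'm, 'o, 'm, 'i) sketch \<Rightarrow> ('o, 'm, 'o, 'm, 'i) sketch \<Rightarrow> bool" where
  "phase2 D S L \<longleftrightarrow>
     (\<exists>X W c T t l.
        (\<forall>i \<in> cones D. \<forall>ps. shape_ok (cone D i) (vertex D i) ps \<longrightarrow>
           is_expansion (cone D i) (vertex D i) ps (X i ps)) \<and>
        (\<forall>(i, ps, G) \<in> exp_indices D X.
           is_codiagonal D i ps (X i ps) G (W (i, ps, G)) (c (i, ps, G))) \<and>
        T 0 = S \<and>
        (\<forall>n. \<exists>k. is_pushout D (exp_maps D X W (T n))
                   (\<lambda>(b, (i, ps, G), u).
                      if b then pre_exp_sketch D i ps (X i ps) G else W (i, ps, G))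
                   (\<lambda>(b, (i, ps, G), u). exp_sketch i (X i ps) G)
                   (\<lambda>(b, (i, ps, G), u).
                      if b then id_fun (pre_expansion (cone D i) (vertex D i) ps (X i ps))
                      else c (i, ps, G))
                   (\<lambda>(b, e, u). u)
                   (T n) (T (Suc n)) (t n) k) \<and>
        is_seq_colimit D T t L l)"

definition phase3 ::
  "('o, 'm, 'i) doctrine \<Rightarrow> ('o, 'm, 'o, 'm, 'i) sketch \<Rightarrow> ('o, 'm, 'o, 'm, 'i) sketch \<Rightarrow> bool" where
  "phase3 D S L \<longleftrightarrow>
     (\<exists>j k. is_pushout D {(i, u). i \<in> cones D \<and> sketch_mor D (iso_sketch' D i) S u}
              (\<lambda>(i, u). iso_sketch' D i) (\<lambda>(i, u). iso_sketch D i)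
              (\<lambda>(i, u). id_fun (iso_cone (cone D i) (vertex D i))) (\<lambda>(i, u). u)
              S L j k)"

text \<open>\<open>L\<close> is the result of the construction applied to \<open>S\<close> (unique up to isomorphism).\<close>

definition is_free_category ::
  "('o, 'm, 'i) doctrine \<Rightarrow> ('o, 'm, 'o, 'm, 'i) sketch \<Rightarrow> ('o, 'm, 'o, 'm, 'i) sketch \<Rightarrow> bool" where
  "is_free_category D S L \<longleftrightarrow> (\<exists>S1 S2. phase1 D S S1 \<and> phase2 D S1 S2 \<and> phase3 D S2 L)"


section \<open>Type judgments\<close>

datatype ('o, 'i) ty_expr = Base 'o | ConeOp 'i "('o, 'i) ty_expr list"

definition orders_reducts :: "('o, 'm, 'i) doctrine \<Rightarrow> ('i \<Rightarrow> 'o list) \<Rightarrow> bool" where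
  "orders_reducts D ord \<longleftrightarrow>
     (\<forall>i \<in> cones D. distinct (ord i) \<and> set (ord i) = Obj (reduct (cone D i) (vertex D i)))"

inductive is_type ::
  "('o, 'm, 'i) doctrine \<Rightarrow> ('i \<Rightarrow> 'o list) \<Rightarrow> ('o, 'm) lnl \<Rightarrow> ('o, 'i) ty_expr \<Rightarrow> cls \<Rightarrow> bool"
  for D ord S where
  base_type: "A \<in> Obj S \<Longrightarrow> is_type D ord S (Base A) (cls_of S A)"
| cone_type: "\<lbrakk>i \<in> cones D; length Rs = length (ord i);
    \<forall>j < length (ord i). is_type D ord S (Rs ! j) (cls_of (cone D i) (ord i ! j))\<rbrakk>
    \<Longrightarrow> is_type D ord S (ConeOp i Rs) (cls_of (cone D i) (fst (vertex D i)))"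

end

theory Submission
  imports Defs
begin

text \<open>
  Objects enter the free category only in the first phase of its construction. There, a vertex is
  added for every cone of the doctrine and every diagram of the shape of its reduct; since the cones are
  discrete and the base is subterminal, such a diagram is a list of objects of the right classes.
  So the objects form the free algebra on the objects of \<open>S\<close> with one operation for each
  cone, and the type judgments describe the same free algebra syntactically.

  All sketches in the construction are known only through universal properties. To see their objects,
  these properties are tested on a single sketch with two objects in each class of the base, whose hom-sets
  are those of the base and in which every lift of a cone is proto-extremal: a sketch morphism
  into it is just a predicate on objects. Consequently a pushout of sketches
  satisfies on objects what a pushout of sets would satisfy with respect to predicates, which is enough
  to determine it up to bijection (\<open>objects_pushout\<close>); the same holds for sequential colimits
  (\<open>objects_inj\<close>, \<open>objects_cover\<close>). As only two-valued test objects are needed, it does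
  not matter how large the set of cones is compared with the universe of objects.

  A pre-expansion has the objects of its expansion, a codiagonal of these is bijective on objects, and
  the two sketches on a cone with doubled vertex differ only in their proto-extremal lifts. Hence the second
  and third phases are bijective on objects (\<open>phase2_objects\<close>, \<open>phase3_objects\<close>).

  For the first phase the work is to show that a class-preserving function from the objects of the reduct
  of a discrete cone extends to exactly one functor (\<open>functor_discrete_eq\<close>,
  \<open>functor_discrete_exists\<close>). All morphisms of the reduct are structural images of identities in a
  unique way, so the extension is forced; that it preserves composition holds because the laws of an LNL
  polycategory compute a composite of structural images of identities by a formula in positions alone
  (\<open>Cmp_identity_images\<close>). The proviso that a diagram must not factor through the previous stage
  means that every instance of a cone is treated exactly once, at the first stage containing all its
  arguments (\<open>cone_maps_least\<close>, \<open>cone_maps_unique\<close>).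
\<close>

section \<open>Functors\<close>

lemma flip_flip [simp]: "flip (flip K) = K"
  by (cases K; cases "snd K") auto

lemma fst_flip [simp]: "fst (flip K) = fst K"
  by (cases K; cases "snd K") auto

lemma flip_apfst: "flip (apfst h K) = apfst h (flip K)"
  by (cases K; cases "snd K") auto

lemma fst_set_smap: "fst ` set (smap h \<Phi>) = h ` fst ` set \<Phi>"
  by (auto simp: image_image)

lemma length_pull [simp]: "length (pull \<Phi> \<sigma>) = length \<sigma>"
  by (simp add: pull_def)

lemma pull_map: "set \<sigma> \<subseteq> {..<length \<Phi>} \<Longrightarrow> pull (map h \<Phi>) \<sigma> = map h (pull \<Phi> \<sigma>)"
  by (auto simp: pull_def)

lemma set_pull: "set \<sigma> \<subseteq> {..<length \<Phi>} \<Longrightarrow> set (pull \<Phi> \<sigma>) \<subseteq> set \<Phi>"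
  by (auto simp: pull_def)

lemma structural_bounds: "structural c \<Phi> \<sigma> \<Longrightarrow> set \<sigma> \<subseteq> {..<length \<Phi>}"
  by (auto simp: structural_def)

lemma adm_list_objs: "adm_list P \<Phi> \<Longrightarrow> fst ` set \<Phi> \<subseteq> Obj P"
  by (simp add: adm_list_def)

lemma admissible_smap:
  assumes "\<And>A. A \<in> fst ` set \<Phi> \<Longrightarrow> c' (h A) = c A"
  shows "admissible c' (smap h \<Phi>) = admissible c \<Phi>"
proof -
  have "filter (\<lambda>(R, s). c' R = NonLin \<and> s = Pos) (smap h \<Phi>)
      = smap h (filter (\<lambda>(R, s). c R = NonLin \<and> s = Pos) \<Phi>)"
    using assms by (induction \<Phi>) auto
  moreover have "(\<exists>R. (R, Pos) \<in> set (smap h \<Phi>) \<and> c' R = NonLin)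
      \<longleftrightarrow> (\<exists>R. (R, Pos) \<in> set \<Phi> \<and> c R = NonLin)"
    using assms by (force simp: image_iff)
  moreover have "(\<forall>(R, s) \<in> set (smap h \<Phi>). c' R = NonLin)
      \<longleftrightarrow> (\<forall>(R, s) \<in> set \<Phi>. c R = NonLin)"
    using assms by force
  ultimately show ?thesis
    by (simp add: admissible_def)
qed

lemma structural_smap:
  assumes "\<And>A. A \<in> fst ` set \<Phi> \<Longrightarrow> c' (h A) = c A"
  shows "structural c' (smap h \<Phi>) \<sigma> = structural c \<Phi> \<sigma>"
proof -
  have "c' (h (fst (\<Phi> ! j))) = c (fst (\<Phi> ! j))" if "j < length \<Phi>" for j
    using assms that by auto
  then show ?thesis
    by (auto simp: structural_def)
qed

lemma functor_obj: "is_functor P Q F \<Longrightarrow> A \<in> Obj P \<Longrightarrow> on_obj F A \<in> Obj Q"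
  by (auto simp: is_functor_def)

lemma functor_obj_undef: "is_functor P Q F \<Longrightarrow> A \<notin> Obj P \<Longrightarrow> on_obj F A = undefined"
  by (auto simp: is_functor_def PiE_def extensional_def)

lemma functor_cls: "is_functor P Q F \<Longrightarrow> A \<in> Obj P \<Longrightarrow> cls_of Q (on_obj F A) = cls_of P A"
  by (auto simp: is_functor_def)

lemma functor_hom:
  "is_functor P Q F \<Longrightarrow> f \<in> Hom P \<Phi> \<Longrightarrow> on_hom F \<Phi> f \<in> Hom Q (smap (on_obj F) \<Phi>)"
  by (auto simp: is_functor_def)

lemma functor_hom_undef: "is_functor P Q F \<Longrightarrow> f \<notin> Hom P \<Phi> \<Longrightarrow> on_hom F \<Phi> f = undefined"
  unfolding is_functor_def PiE_def extensional_def by blast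

lemma functor_Act:
  "is_functor P Q F \<Longrightarrow> f \<in> Hom P (pull \<Phi> \<sigma>) \<Longrightarrow> adm_list P \<Phi> \<Longrightarrow> structural (cls_of P) \<Phi> \<sigma>
   \<Longrightarrow> on_hom F \<Phi> (Act P \<Phi> \<sigma> f) = Act Q (smap (on_obj F) \<Phi>) \<sigma> (on_hom F (pull \<Phi> \<sigma>) f)"
  unfolding is_functor_def by blast

lemma functor_Idn:
  "is_functor P Q F \<Longrightarrow> A \<in> Obj P
   \<Longrightarrow> on_hom F [(A, Neg), (A, Pos)] (Idn P A) = Idn Q (on_obj F A)"
  unfolding is_functor_def by blast

lemma functor_Cmp:
  "is_functor P Q F \<Longrightarrow> f \<in> Hom P (\<Phi> @ [K]) \<Longrightarrow> g \<in> Hom P (flip K # \<Psi>)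
   \<Longrightarrow> on_hom F (\<Phi> @ \<Psi>) (Cmp P \<Phi> K \<Psi> g f)
     = Cmp Q (smap (on_obj F) \<Phi>) (apfst (on_obj F) K) (smap (on_obj F) \<Psi>)
         (on_hom F (flip K # \<Psi>) g) (on_hom F (\<Phi> @ [K]) f)"
  unfolding is_functor_def by blast

lemma functor_adm_list:
  assumes "is_functor P Q F" "adm_list P \<Phi>"
  shows "adm_list Q (smap (on_obj F) \<Phi>)"
proof -
  have "admissible (cls_of Q) (smap (on_obj F) \<Phi>) = admissible (cls_of P) \<Phi>"
    using assms by (intro admissible_smap) (auto simp: adm_list_def functor_cls)
  then show ?thesis
    using assms unfolding adm_list_def fst_set_smap by (auto intro: functor_obj)
qed

lemma functor_structural:
  assumes "is_functor P Q F" "fst ` set \<Phi> \<subseteq> Obj P"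
  shows "structural (cls_of Q) (smap (on_obj F) \<Phi>) \<sigma> = structural (cls_of P) \<Phi> \<sigma>"
  using assms by (intro structural_smap) (auto simp: functor_cls)

lemma functor_eqI:
  assumes "is_functor P Q F" "is_functor P Q G"
    and "\<And>A. A \<in> Obj P \<Longrightarrow> on_obj F A = on_obj G A"
    and "\<And>\<Phi> f. f \<in> Hom P \<Phi> \<Longrightarrow> on_hom F \<Phi> f = on_hom G \<Phi> f"
  shows "F = G"
proof -
  have "on_obj F = on_obj G"
    using assms(3) functor_obj_undef[OF assms(1)] functor_obj_undef[OF assms(2)] by (intro ext) metis
  moreover have "on_hom F = on_hom G"
    using assms(4) functor_hom_undef[OF assms(1)] functor_hom_undef[OF assms(2)] by (intro ext) metis
  ultimately show ?thesis by simp
qed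

text \<open>
  When the hom-sets of the target have at most one element, the values of a functor on morphisms
  carry no information.
\<close>

lemma functor_eq_thin:
  assumes F: "is_functor P Q F" and G: "is_functor P Q G" and P: "lnl_polycategory P"
    and thin: "\<And>\<Phi> f g. f \<in> Hom Q \<Phi> \<Longrightarrow> g \<in> Hom Q \<Phi> \<Longrightarrow> f = g"
    and obj: "\<And>A. A \<in> Obj P \<Longrightarrow> on_obj F A = on_obj G A"
  shows "F = G"
proof (rule functor_eqI[OF F G obj])
  fix \<Phi> f assume f: "f \<in> Hom P \<Phi>"
  have "fst ` set \<Phi> \<subseteq> Obj P"
    using lnl_polycategory.Hom_adm[OF P f] by (rule adm_list_objs)
  then have "smap (on_obj F) \<Phi> = smap (on_obj G) \<Phi>"
    by (auto intro!: obj simp: apfst_def map_prod_def split: prod.splits)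
  then show "on_hom F \<Phi> f = on_hom G \<Phi> f"
    using thin functor_hom[OF F f] functor_hom[OF G f] by metis
qed auto

lemma functor_eq_subterminal:
  assumes "is_functor P B F" "is_functor P B G" "lnl_polycategory P" "subterminal B"
  shows "F = G"
  using assms(1-3)
proof (rule functor_eq_thin)
  show "on_obj F A = on_obj G A" if "A \<in> Obj P" for A
    using assms(4) that functor_obj[OF assms(1)] functor_obj[OF assms(2)]
      functor_cls[OF assms(1)] functor_cls[OF assms(2)] unfolding subterminal_def by metis
qed (use assms(4) in \<open>auto simp: subterminal_def\<close>)

lemma functor_comp:
  assumes F: "is_functor P Q F" and G: "is_functor Q R G" and P: "lnl_polycategory P"
  shows "is_functor P R (comp_fun P G F)"
proof -
  interpret P: lnl_polycategory P by (rule P)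
  let ?H = "comp_fun P G F"
  have objs: "fst ` set \<Phi> \<subseteq> Obj P" if "f \<in> Hom P \<Phi>" for f \<Phi>
    using P.Hom_adm[OF that] by (rule adm_list_objs)
  have smap: "smap (on_obj ?H) \<Phi> = smap (on_obj G) (smap (on_obj F) \<Phi>)"
    if "fst ` set \<Phi> \<subseteq> Obj P" for \<Phi>
    using that by (auto simp: comp_fun_def)
  have hom: "on_hom ?H \<Phi> f = on_hom G (smap (on_obj F) \<Phi>) (on_hom F \<Phi> f)" if "f \<in> Hom P \<Phi>" for \<Phi> f
    using that by (simp add: comp_fun_def)
  show ?thesis unfolding is_functor_def
  proof (intro conjI allI ballI impI)
    show "on_obj ?H \<in> Obj P \<rightarrow>\<^sub>E Obj R"
      using F G by (auto simp: comp_fun_def functor_obj)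
  next
    fix A assume "A \<in> Obj P"
    then show "cls_of R (on_obj ?H A) = cls_of P A"
      using F G by (simp add: comp_fun_def functor_obj functor_cls)
  next
    fix \<Phi>
    show "on_hom ?H \<Phi> \<in> Hom P \<Phi> \<rightarrow>\<^sub>E Hom R (smap (on_obj ?H) \<Phi>)"
    proof (rule PiE_I)
      fix f assume f: "f \<in> Hom P \<Phi>"
      show "on_hom ?H \<Phi> f \<in> Hom R (smap (on_obj ?H) \<Phi>)"
        unfolding smap[OF objs[OF f]] hom[OF f]
        by (intro functor_hom[OF G] functor_hom[OF F] f)
    qed (simp add: comp_fun_def)
  next
    fix \<Phi> \<sigma> f
    assume f: "f \<in> Hom P (pull \<Phi> \<sigma>)" and a: "adm_list P \<Phi>" and s: "structural (cls_of P) \<Phi> \<sigma>"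
    have pull: "pull (smap (on_obj F) \<Phi>) \<sigma> = smap (on_obj F) (pull \<Phi> \<sigma>)"
      using structural_bounds[OF s] by (rule pull_map)
    have "on_hom ?H \<Phi> (Act P \<Phi> \<sigma> f)
        = on_hom G (smap (on_obj F) \<Phi>) (Act Q (smap (on_obj F) \<Phi>) \<sigma> (on_hom F (pull \<Phi> \<sigma>) f))"
      using P.Act_in[OF a s f] functor_Act[OF F f a s] by (simp add: hom)
    also have "\<dots> = Act R (smap (on_obj G) (smap (on_obj F) \<Phi>)) \<sigma>
        (on_hom G (smap (on_obj F) (pull \<Phi> \<sigma>)) (on_hom F (pull \<Phi> \<sigma>) f))"
      using functor_hom[OF F f] functor_adm_list[OF F a] functor_structural[OF F adm_list_objs[OF a]] s
      by (subst functor_Act[OF G]) (simp_all only: pull)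
    finally show "on_hom ?H \<Phi> (Act P \<Phi> \<sigma> f)
        = Act R (smap (on_obj ?H) \<Phi>) \<sigma> (on_hom ?H (pull \<Phi> \<sigma>) f)"
      by (simp only: smap[OF adm_list_objs[OF a]] hom[OF f])
  next
    fix A assume A: "A \<in> Obj P"
    then show "on_hom ?H [(A, Neg), (A, Pos)] (Idn P A) = Idn R (on_obj ?H A)"
      using P.Idn_in[OF A] functor_Idn[OF F A] functor_Idn[OF G functor_obj[OF F A]]
      by (simp add: hom) (simp add: comp_fun_def)
  next
    fix \<Phi> K \<Psi> f g
    assume f: "f \<in> Hom P (\<Phi> @ [K])" and g: "g \<in> Hom P (flip K # \<Psi>)"
    have "on_hom ?H (\<Phi> @ \<Psi>) (Cmp P \<Phi> K \<Psi> g f)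
      = on_hom G (smap (on_obj F) \<Phi> @ smap (on_obj F) \<Psi>)
         (Cmp Q (smap (on_obj F) \<Phi>) (apfst (on_obj F) K) (smap (on_obj F) \<Psi>)
         (on_hom F (flip K # \<Psi>) g) (on_hom F (\<Phi> @ [K]) f))"
      using P.Cmp_in[OF f g] functor_Cmp[OF F f g] by (simp add: hom)
    also have "\<dots> = Cmp R (smap (on_obj G) (smap (on_obj F) \<Phi>)) (apfst (on_obj G) (apfst (on_obj F) K))
         (smap (on_obj G) (smap (on_obj F) \<Psi>)) (on_hom ?H (flip K # \<Psi>) g) (on_hom ?H (\<Phi> @ [K]) f)"
      using functor_hom[OF F f] functor_hom[OF F g]
      by (subst functor_Cmp[OF G]) (simp_all add: hom f g flip_apfst)
    also have "\<dots> = Cmp R (smap (on_obj ?H) \<Phi>) (apfst (on_obj ?H) K) (smap (on_obj ?H) \<Psi>)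
         (on_hom ?H (flip K # \<Psi>) g) (on_hom ?H (\<Phi> @ [K]) f)"
    proof -
      have "fst ` set (\<Phi> @ [K]) \<subseteq> Obj P" "fst ` set (flip K # \<Psi>) \<subseteq> Obj P"
        using objs f g by blast+
      then have "fst ` set \<Phi> \<subseteq> Obj P" "fst ` set [K] \<subseteq> Obj P" "fst ` set \<Psi> \<subseteq> Obj P"
        by auto
      then have "apfst (on_obj ?H) K = apfst (on_obj G) (apfst (on_obj F) K)"
          "smap (on_obj ?H) \<Phi> = smap (on_obj G) (smap (on_obj F) \<Phi>)"
          "smap (on_obj ?H) \<Psi> = smap (on_obj G) (smap (on_obj F) \<Psi>)"
        using smap[of "[K]"] smap[of \<Phi>] smap[of \<Psi>] by simp_all
      then show ?thesis by (simp only:)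
    qed
    finally show "on_hom ?H (\<Phi> @ \<Psi>) (Cmp P \<Phi> K \<Psi> g f)
      = Cmp R (smap (on_obj ?H) \<Phi>) (apfst (on_obj ?H) K) (smap (on_obj ?H) \<Psi>)
         (on_hom ?H (flip K # \<Psi>) g) (on_hom ?H (\<Phi> @ [K]) f)" .
  qed
qed

text \<open>
  The hom-sets of \<open>P\<close> may be smaller than those of \<open>Q\<close>, as in a pre-expansion, which has all
  objects of the expansion but lacks \<open>\<chi>\<close>.
\<close>

lemma functor_inclusion:
  assumes "Obj P \<subseteq> Obj Q" "cls_of P = cls_of Q" "\<And>\<Phi>. Hom P \<Phi> \<subseteq> Hom Q \<Phi>"
    and "Act P = Act Q" "Idn P = Idn Q" "Cmp P = Cmp Q"
    and "lnl_polycategory P"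
  shows "is_functor P Q (id_fun P)"
proof -
  interpret lnl_polycategory P by fact
  have smap: "smap (on_obj (id_fun P)) \<Phi> = \<Phi>" if "fst ` set \<Phi> \<subseteq> Obj P" for \<Phi>
    using that by (intro map_idI) (auto simp: id_fun_def)
  have objs: "fst ` set \<Phi> \<subseteq> Obj P" if "f \<in> Hom P \<Phi>" for f \<Phi>
    using Hom_adm[OF that] by (rule adm_list_objs)
  have hom: "on_hom (id_fun P) \<Phi> f = f" if "f \<in> Hom P \<Phi>" for \<Phi> f
    using that by (simp add: id_fun_def)
  show ?thesis unfolding is_functor_def
  proof (intro conjI allI ballI impI)
    show "on_obj (id_fun P) \<in> Obj P \<rightarrow>\<^sub>E Obj Q"
      using assms by (auto simp: id_fun_def)
    show "on_hom (id_fun P) \<Phi> \<in> Hom P \<Phi> \<rightarrow>\<^sub>E Hom Q (smap (on_obj (id_fun P)) \<Phi>)" for \<Phi>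
    proof (rule PiE_I)
      fix f assume f: "f \<in> Hom P \<Phi>"
      then show "on_hom (id_fun P) \<Phi> f \<in> Hom Q (smap (on_obj (id_fun P)) \<Phi>)"
        using assms(3) hom[OF f] smap[OF objs[OF f]] by auto
    qed (simp add: id_fun_def)
  next
    fix \<Phi> \<sigma> f
    assume f: "f \<in> Hom P (pull \<Phi> \<sigma>)" and a: "adm_list P \<Phi>" and s: "structural (cls_of P) \<Phi> \<sigma>"
    show "on_hom (id_fun P) \<Phi> (Act P \<Phi> \<sigma> f) = Act Q (smap (on_obj (id_fun P)) \<Phi>) \<sigma>
             (on_hom (id_fun P) (pull \<Phi> \<sigma>) f)"
      using hom[OF Act_in[OF a s f]] hom[OF f] smap[OF adm_list_objs[OF a]] assms(4) by simp
  next
    fix \<Phi> K \<Psi> f g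
    assume f: "f \<in> Hom P (\<Phi> @ [K])" and g: "g \<in> Hom P (flip K # \<Psi>)"
    have "fst ` set (\<Phi> @ [K]) \<subseteq> Obj P" "fst ` set (flip K # \<Psi>) \<subseteq> Obj P"
      using objs f g by blast+
    then have "fst ` set \<Phi> \<subseteq> Obj P" "fst ` set [K] \<subseteq> Obj P" "fst ` set \<Psi> \<subseteq> Obj P"
      by auto
    from this[THEN smap]
    show "on_hom (id_fun P) (\<Phi> @ \<Psi>) (Cmp P \<Phi> K \<Psi> g f)
      = Cmp Q (smap (on_obj (id_fun P)) \<Phi>) (apfst (on_obj (id_fun P)) K)
          (smap (on_obj (id_fun P)) \<Psi>)
          (on_hom (id_fun P) (flip K # \<Psi>) g) (on_hom (id_fun P) (\<Phi> @ [K]) f)"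
      using hom[OF Cmp_in[OF f g]] hom[OF f] hom[OF g] assms(6) by simp
  next
    fix A assume A: "A \<in> Obj P"
    show "on_hom (id_fun P) [(A, Neg), (A, Pos)] (Idn P A) = Idn Q (on_obj (id_fun P) A)"
      using hom[OF Idn_in[OF A]] A assms(5) by (simp add: id_fun_def)
  qed (use assms in \<open>auto simp: id_fun_def\<close>)
qed

section \<open>Pulling back along a map of objects\<close>

text \<open>
  The hom-sets over \<open>A\<close> are copies of those of \<open>P\<close>, so that elements of \<open>A\<close> with the same
  image are isomorphic objects. A cone with doubled vertex is of this form, and so is the sketch
  on which universal properties are tested below.
\<close>

definition pullback :: "('o, 'm) lnl \<Rightarrow> ('a \<Rightarrow> 'o) \<Rightarrow> 'a set \<Rightarrow> ('a, 'm) lnl" where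
  "pullback P p A = \<lparr>
     Obj = A,
     cls_of = (\<lambda>x. cls_of P (p x)),
     Hom = (\<lambda>\<Phi>. if fst ` set \<Phi> \<subseteq> A then Hom P (smap p \<Phi>) else {}),
     Act = (\<lambda>\<Phi>. Act P (smap p \<Phi>)),
     Idn = (\<lambda>x. Idn P (p x)),
     Cmp = (\<lambda>\<Phi> M \<Psi>. Cmp P (smap p \<Phi>) (apfst p M) (smap p \<Psi>)) \<rparr>"

lemma pullback_simps [simp]:
  "Obj (pullback P p A) = A"
  "cls_of (pullback P p A) x = cls_of P (p x)"
  "Act (pullback P p A) \<Phi> = Act P (smap p \<Phi>)"
  "Idn (pullback P p A) x = Idn P (p x)"
  "Cmp (pullback P p A) \<Phi> K \<Psi> = Cmp P (smap p \<Phi>) (apfst p K) (smap p \<Psi>)"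
  by (simp_all add: pullback_def)

lemma pullback_Hom:
  "f \<in> Hom (pullback P p A) \<Phi> \<longleftrightarrow> fst ` set \<Phi> \<subseteq> A \<and> f \<in> Hom P (smap p \<Phi>)"
  by (simp add: pullback_def)

lemma pullback_structural:
  "structural (cls_of (pullback P p A)) \<Phi> \<sigma> = structural (cls_of P) (smap p \<Phi>) \<sigma>"
  by (rule structural_smap[symmetric]) simp

lemma pullback_adm_list:
  assumes "p ` A \<subseteq> Obj P"
  shows "adm_list (pullback P p A) \<Phi> \<longleftrightarrow> fst ` set \<Phi> \<subseteq> A \<and> adm_list P (smap p \<Phi>)"
proof -
  have "admissible (cls_of P) (smap p \<Phi>) = admissible (cls_of (pullback P p A)) \<Phi>"
    by (rule admissible_smap) simp
  then show ?thesis
    using assms unfolding adm_list_def fst_set_smap pullback_simps by blast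
qed

lemma pullback_unit_at [simp]: "unit_at (pullback P p A) K = unit_at P (apfst p K)"
  by (simp add: unit_at_def flip_apfst)

lemma lnl_polycategory_pullback:
  assumes "lnl_polycategory P" and sub: "p ` A \<subseteq> Obj P"
  shows "lnl_polycategory (pullback P p A)"
proof -
  interpret lnl_polycategory P by fact
  have pull: "pull (smap p \<Phi>) \<sigma> = smap p (pull \<Phi> \<sigma>)"
    if "structural (cls_of P) (smap p \<Phi>) \<sigma>" for \<Phi> :: "'c signed list" and p :: "'c \<Rightarrow> 'a" and \<sigma>
    using structural_bounds[OF that] by (intro pull_map) simp
  note simps = pullback_structural pullback_adm_list[OF sub] pullback_Hom pullback_simps
    pullback_unit_at map_append list.map length_map flip_apfst[symmetric]
  show ?thesis
  proof (unfold_locales, unfold simps)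
    fix \<Phi> \<sigma> f
    assume "fst ` set \<Phi> \<subseteq> A \<and> adm_list P (smap p \<Phi>)" "structural (cls_of P) (smap p \<Phi>) \<sigma>"
      "fst ` set (pull \<Phi> \<sigma>) \<subseteq> A \<and> f \<in> Hom P (smap p (pull \<Phi> \<sigma>))"
    then show "fst ` set \<Phi> \<subseteq> A \<and> Act P (smap p \<Phi>) \<sigma> f \<in> Hom P (smap p \<Phi>)"
      using Act_in pull by metis
  next
    fix \<Phi> \<sigma> \<tau> f
    assume a: "fst ` set \<Phi> \<subseteq> A \<and> adm_list P (smap p \<Phi>)" "structural (cls_of P) (smap p \<Phi>) \<sigma>"
      "structural (cls_of P) (smap p (pull \<Phi> \<sigma>)) \<tau>"
      "fst ` set (pull (pull \<Phi> \<sigma>) \<tau>) \<subseteq> A \<and> f \<in> Hom P (smap p (pull (pull \<Phi> \<sigma>) \<tau>))"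
    then show "Act P (smap p \<Phi>) \<sigma> (Act P (smap p (pull \<Phi> \<sigma>)) \<tau> f) = Act P (smap p \<Phi>) (pull \<sigma> \<tau>) f"
      using Act_comp[of "smap p \<Phi>" \<sigma> \<tau> f] by (simp add: pull)
  next
    fix f \<Phi> assume "fst ` set \<Phi> \<subseteq> A \<and> f \<in> Hom P (smap p \<Phi>)"
    then show "Act P (smap p \<Phi>) [0..<length \<Phi>] f = f"
      using Act_id[of f "smap p \<Phi>"] by simp
  next
    fix \<Phi> K f \<Psi> g n m
    assume "fst ` set (\<Phi> @ [K]) \<subseteq> A \<and> f \<in> Hom P (smap p \<Phi> @ [apfst p K])"
      "fst ` set (flip K # \<Psi>) \<subseteq> A \<and> g \<in> Hom P (flip (apfst p K) # smap p \<Psi>)"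
      "n = length \<Phi>" "m = length \<Psi>"
    then show "Cmp P (smap p \<Phi>) (apfst p K) (smap p \<Psi>) g f =
       Act P (smap p \<Phi> @ smap p \<Psi>) ([n..<n + m] @ [0..<n])
        (Cmp P (smap p \<Psi>) (flip (apfst p K)) (smap p \<Phi>)
          (Act P (apfst p K # smap p \<Phi>) ([1..<Suc n] @ [0]) f)
          (Act P (smap p \<Psi> @ [flip (apfst p K)]) (m # [0..<m]) g))"
      using swap[of f "smap p \<Phi>" "apfst p K" g "smap p \<Psi>" n m] by simp
  next
    fix \<Phi> \<Psi> K \<sigma> \<tau> f g
    assume a: "fst ` set (\<Phi> @ [K]) \<subseteq> A \<and> adm_list P (smap p \<Phi> @ [apfst p K])"
       "fst ` set (flip K # \<Psi>) \<subseteq> A \<and> adm_list P (flip (apfst p K) # smap p \<Psi>)"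
       "structural (cls_of P) (smap p \<Phi>) \<sigma>" "structural (cls_of P) (smap p \<Psi>) \<tau>"
       "fst ` set (pull \<Phi> \<sigma> @ [K]) \<subseteq> A \<and> f \<in> Hom P (smap p (pull \<Phi> \<sigma>) @ [apfst p K])"
       "fst ` set (flip K # pull \<Psi> \<tau>) \<subseteq> A \<and> g \<in> Hom P (flip (apfst p K) # smap p (pull \<Psi> \<tau>))"
    then show "Cmp P (smap p \<Phi>) (apfst p K) (smap p \<Psi>)
        (Act P (flip (apfst p K) # smap p \<Psi>) (0 # map Suc \<tau>) g)
        (Act P (smap p \<Phi> @ [apfst p K]) (\<sigma> @ [length \<Phi>]) f) =
       Act P (smap p \<Phi> @ smap p \<Psi>) (\<sigma> @ map ((+) (length \<Phi>)) \<tau>)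
        (Cmp P (smap p (pull \<Phi> \<sigma>)) (apfst p K) (smap p (pull \<Psi> \<tau>)) g f)"
      using equivariant[of "smap p \<Phi>" "apfst p K" "smap p \<Psi>" \<sigma> \<tau> f g] by (simp add: pull)
  next
    fix K R \<Phi> f \<Psi> g n m
    assume "K = (R, Pos)" "cls_of P (p R) = NonLin"
       "fst ` set (\<Phi> @ [K]) \<subseteq> A \<and> f \<in> Hom P (smap p \<Phi> @ [apfst p K])"
       "fst ` set \<Psi> \<subseteq> A \<and> g \<in> Hom P (smap p \<Psi>)" "n = length \<Phi>" "m = length \<Psi>"
    then show "Cmp P (smap p \<Phi>) (apfst p K) (smap p \<Psi>)
        (Act P (flip (apfst p K) # smap p \<Psi>) [1..<Suc m] g) f =
       Act P (smap p \<Phi> @ smap p \<Psi>) [n..<n + m] g"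
      using weakening[of "apfst p K" "p R" f "smap p \<Phi>" g "smap p \<Psi>" n m] by simp
  next
    fix K R \<Phi> f \<Psi> g n m
    assume "K = (R, Pos)" "cls_of P (p R) = NonLin"
       "fst ` set (\<Phi> @ [K]) \<subseteq> A \<and> f \<in> Hom P (smap p \<Phi> @ [apfst p K])"
       "fst ` set (flip K # flip K # \<Psi>) \<subseteq> A \<and>
          g \<in> Hom P (flip (apfst p K) # flip (apfst p K) # smap p \<Psi>)"
       "n = length \<Phi>" "m = length \<Psi>"
    then show "Cmp P (smap p \<Phi>) (apfst p K) (smap p \<Psi>)
        (Act P (flip (apfst p K) # smap p \<Psi>) (0 # [0..<Suc m]) g) f =
       Act P (smap p \<Phi> @ smap p \<Psi>) ([0..<n] @ [0..<n + m])
        (Cmp P (smap p \<Phi>) (apfst p K) (smap p \<Phi> @ smap p \<Psi>)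
          (Act P (flip (apfst p K) # smap p \<Phi> @ smap p \<Psi>)
            ([1..<Suc n] @ 0 # [Suc n..<Suc (n + m)])
            (Cmp P (smap p \<Phi>) (apfst p K) (flip (apfst p K) # smap p \<Psi>) g f)) f)"
      using contraction[of "apfst p K" "p R" f "smap p \<Phi>" g "smap p \<Psi>" n m] by simp
  qed (use sub in \<open>auto intro: Hom_adm Idn_in Cmp_in unit_left unit_right assoc\<close>)
qed

text \<open>
  Since the hom-sets of a pullback are copies of hom-sets of \<open>P\<close>, only the object function
  of a functor into \<open>P\<close> has to be lifted.
\<close>

lemma functor_pullback_lift:
  assumes F: "is_functor R P F" and R: "lnl_polycategory R"
    and g: "g \<in> Obj R \<rightarrow>\<^sub>E A" and pg: "\<And>x. x \<in> Obj R \<Longrightarrow> p (g x) = on_obj F x"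
  shows "is_functor R (pullback P p A) \<lparr>on_obj = g, on_hom = on_hom F\<rparr>"
proof -
  interpret lnl_polycategory R by fact
  have objs: "fst ` set \<Phi> \<subseteq> Obj R" if "f \<in> Hom R \<Phi>" for f \<Phi>
    using Hom_adm[OF that] by (rule adm_list_objs)
  have smap: "smap p (smap g \<Phi>) = smap (on_obj F) \<Phi>" if "fst ` set \<Phi> \<subseteq> Obj R" for \<Phi>
    using that pg by auto
  have gA: "fst ` set (smap g \<Phi>) \<subseteq> A" if "fst ` set \<Phi> \<subseteq> Obj R" for \<Phi>
    using that g unfolding fst_set_smap by auto
  show ?thesis unfolding is_functor_def lnl_fun.simps
  proof (intro conjI allI ballI impI)
    fix \<Phi>
    show "on_hom F \<Phi> \<in> Hom R \<Phi> \<rightarrow>\<^sub>E Hom (pullback P p A) (smap g \<Phi>)"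
    proof (rule PiE_I)
      fix f assume f: "f \<in> Hom R \<Phi>"
      show "on_hom F \<Phi> f \<in> Hom (pullback P p A) (smap g \<Phi>)"
        unfolding pullback_Hom smap[OF objs[OF f]] using gA[OF objs[OF f]] functor_hom[OF F f] by blast
    qed (rule functor_hom_undef[OF F])
  next
    fix \<Phi> \<sigma> f
    assume f: "f \<in> Hom R (pull \<Phi> \<sigma>)" and a: "adm_list R \<Phi>" and s: "structural (cls_of R) \<Phi> \<sigma>"
    show "on_hom F \<Phi> (Act R \<Phi> \<sigma> f) = Act (pullback P p A) (smap g \<Phi>) \<sigma> (on_hom F (pull \<Phi> \<sigma>) f)"
      unfolding pullback_simps smap[OF adm_list_objs[OF a]] by (rule functor_Act[OF F f a s])
  next
    fix \<Phi> K \<Psi> f h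
    assume f: "f \<in> Hom R (\<Phi> @ [K])" and h: "h \<in> Hom R (flip K # \<Psi>)"
    have "fst ` set (\<Phi> @ [K]) \<subseteq> Obj R" "fst ` set (flip K # \<Psi>) \<subseteq> Obj R"
      using objs f h by blast+
    then have "smap p (smap g \<Phi>) = smap (on_obj F) \<Phi>" "smap p (smap g \<Psi>) = smap (on_obj F) \<Psi>"
      "apfst p (apfst g K) = apfst (on_obj F) K"
      using smap[of \<Phi>] smap[of \<Psi>] smap[of "[K]"] by simp_all
    then show "on_hom F (\<Phi> @ \<Psi>) (Cmp R \<Phi> K \<Psi> h f) =
       Cmp (pullback P p A) (smap g \<Phi>) (apfst g K) (smap g \<Psi>)
         (on_hom F (flip K # \<Psi>) h) (on_hom F (\<Phi> @ [K]) f)"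
      unfolding pullback_simps by (simp only: functor_Cmp[OF F f h])
  qed (use g pg functor_cls[OF F] functor_Idn[OF F] in \<open>auto simp: PiE_iff\<close>)
qed

definition pullback_proj :: "('o, 'm) lnl \<Rightarrow> ('a \<Rightarrow> 'o) \<Rightarrow> 'a set \<Rightarrow> ('a, 'm, 'o, 'm) lnl_fun" where
  "pullback_proj P p A = \<lparr>
     on_obj = (\<lambda>x \<in> A. p x),
     on_hom = (\<lambda>\<Phi>. \<lambda>f \<in> Hom (pullback P p A) \<Phi>. f) \<rparr>"

lemma functor_pullback_proj:
  assumes "lnl_polycategory P" and sub: "p ` A \<subseteq> Obj P"
  shows "is_functor (pullback P p A) P (pullback_proj P p A)"
proof -
  interpret lnl_polycategory "pullback P p A"
    using assms by (rule lnl_polycategory_pullback)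
  let ?F = "pullback_proj P p A"
  have objs: "fst ` set \<Phi> \<subseteq> A" if "f \<in> Hom (pullback P p A) \<Phi>" for f \<Phi>
    using that by (simp add: pullback_Hom)
  have smap: "smap (on_obj ?F) \<Phi> = smap p \<Phi>" if "fst ` set \<Phi> \<subseteq> A" for \<Phi>
    using that by (intro map_cong) (auto simp: pullback_proj_def)
  have hom: "on_hom ?F \<Phi> f = f" if "f \<in> Hom (pullback P p A) \<Phi>" for \<Phi> f
    using that by (simp add: pullback_proj_def)
  show ?thesis unfolding is_functor_def
  proof (intro conjI allI ballI impI)
    fix \<Phi>
    show "on_hom ?F \<Phi> \<in> Hom (pullback P p A) \<Phi> \<rightarrow>\<^sub>E Hom P (smap (on_obj ?F) \<Phi>)"
    proof (rule PiE_I)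
      fix f assume f: "f \<in> Hom (pullback P p A) \<Phi>"
      show "on_hom ?F \<Phi> f \<in> Hom P (smap (on_obj ?F) \<Phi>)"
        unfolding hom[OF f] smap[OF objs[OF f]] using f by (simp add: pullback_Hom)
    qed (simp add: pullback_proj_def)
  next
    fix \<Phi> \<sigma> f
    assume f: "f \<in> Hom (pullback P p A) (pull \<Phi> \<sigma>)" and a: "adm_list (pullback P p A) \<Phi>"
      and s: "structural (cls_of (pullback P p A)) \<Phi> \<sigma>"
    then have "fst ` set \<Phi> \<subseteq> A"
      using adm_list_objs by fastforce
    then show "on_hom ?F \<Phi> (Act (pullback P p A) \<Phi> \<sigma> f)
        = Act P (smap (on_obj ?F) \<Phi>) \<sigma> (on_hom ?F (pull \<Phi> \<sigma>) f)"
      unfolding hom[OF Act_in[OF a s f]] hom[OF f] by (simp only: smap pullback_simps)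
  next
    fix \<Phi> K \<Psi> f g
    assume f: "f \<in> Hom (pullback P p A) (\<Phi> @ [K])" and g: "g \<in> Hom (pullback P p A) (flip K # \<Psi>)"
    have "fst ` set (\<Phi> @ [K]) \<subseteq> A" "fst ` set (flip K # \<Psi>) \<subseteq> A"
      using objs f g by blast+
    then have "smap (on_obj ?F) \<Phi> = smap p \<Phi>" "smap (on_obj ?F) \<Psi> = smap p \<Psi>"
      "apfst (on_obj ?F) K = apfst p K"
      using smap[of \<Phi>] smap[of \<Psi>] smap[of "[K]"] by simp_all
    then show "on_hom ?F (\<Phi> @ \<Psi>) (Cmp (pullback P p A) \<Phi> K \<Psi> g f)
      = Cmp P (smap (on_obj ?F) \<Phi>) (apfst (on_obj ?F) K) (smap (on_obj ?F) \<Psi>)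
          (on_hom ?F (flip K # \<Psi>) g) (on_hom ?F (\<Phi> @ [K]) f)"
      unfolding hom[OF Cmp_in[OF f g]] hom[OF f] hom[OF g] by (simp only: pullback_simps)
  next
    fix x assume x: "x \<in> Obj (pullback P p A)"
    then show "on_hom ?F [(x, Neg), (x, Pos)] (Idn (pullback P p A) x) = Idn P (on_obj ?F x)"
      unfolding hom[OF Idn_in[OF x]] by (simp add: pullback_proj_def)
  qed (use sub in \<open>auto simp: pullback_proj_def\<close>)
qed

text \<open>
  The laws of the cone with doubled vertex and the functoriality of its collapse and of its two
  sections thereby become instances of general facts.
\<close>

lemma iso_cone_pullback:
  "iso_cone C K = pullback C (collapse K) (insert None (Some ` Obj C))"
  by (simp add: iso_cone_def pullback_def Let_def)

lemma collapse_Obj: "fst K \<in> Obj C \<Longrightarrow> collapse K ` insert None (Some ` Obj C) \<subseteq> Obj C"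
  by (auto simp: collapse_def)

lemma lnl_polycategory_iso_cone:
  "lnl_polycategory C \<Longrightarrow> fst K \<in> Obj C \<Longrightarrow> lnl_polycategory (iso_cone C K)"
  unfolding iso_cone_pullback by (intro lnl_polycategory_pullback collapse_Obj)

lemma functor_collapse:
  assumes "lnl_polycategory C" "fst K \<in> Obj C"
  shows "is_functor (iso_cone C K) C (collapse_fun C K)"
proof -
  have eq: "collapse_fun C K = pullback_proj C (collapse K) (insert None (Some ` Obj C))"
    unfolding collapse_fun_def pullback_proj_def iso_cone_pullback by simp
  show ?thesis
    unfolding eq iso_cone_pullback by (intro functor_pullback_proj collapse_Obj assms)
qed

lemma functor_iso_section:
  assumes "lnl_polycategory C" "fst K \<in> Obj C"
  shows "is_functor C (iso_cone C K) (iso_section1 C)"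
    and "is_functor C (iso_cone C K) (iso_section2 C K)"
proof -
  have id: "is_functor C C (id_fun C)"
    using assms(1) by (intro functor_inclusion) auto
  have "is_functor C (iso_cone C K) \<lparr>on_obj = \<lambda>A \<in> Obj C. Some A, on_hom = on_hom (id_fun C)\<rparr>"
    "is_functor C (iso_cone C K)
       \<lparr>on_obj = \<lambda>A \<in> Obj C. if A = fst K then None else Some A, on_hom = on_hom (id_fun C)\<rparr>"
    unfolding iso_cone_pullback
    by (intro functor_pullback_lift id assms; auto simp: id_fun_def collapse_def)+
  then show "is_functor C (iso_cone C K) (iso_section1 C)"
    "is_functor C (iso_cone C K) (iso_section2 C K)"
    by (simp_all add: iso_section1_def iso_section2_def id_fun_def)
qed

section \<open>Reducts of discrete cones\<close>

lemma lnl_polycategory_sub: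
  assumes "lnl_polycategory P"
    and ops: "Obj Q \<subseteq> Obj P" "cls_of Q = cls_of P" "Act Q = Act P" "Idn Q = Idn P" "Cmp Q = Cmp P"
    and sub: "\<And>\<Phi> f. f \<in> Hom Q \<Phi> \<Longrightarrow> f \<in> Hom P \<Phi>"
    and objs: "\<And>\<Phi> f. f \<in> Hom Q \<Phi> \<Longrightarrow> fst ` set \<Phi> \<subseteq> Obj Q"
    and Act: "\<And>\<Phi> \<sigma> f. \<lbrakk>adm_list Q \<Phi>; structural (cls_of P) \<Phi> \<sigma>; f \<in> Hom Q (pull \<Phi> \<sigma>)\<rbrakk>
      \<Longrightarrow> Act P \<Phi> \<sigma> f \<in> Hom Q \<Phi>"
    and Idn: "\<And>R. R \<in> Obj Q \<Longrightarrow> Idn P R \<in> Hom Q [(R, Neg), (R, Pos)]"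
    and Cmp: "\<And>\<Phi> K \<Psi> f g. \<lbrakk>f \<in> Hom Q (\<Phi> @ [K]); g \<in> Hom Q (flip K # \<Psi>)\<rbrakk>
      \<Longrightarrow> Cmp P \<Phi> K \<Psi> g f \<in> Hom Q (\<Phi> @ \<Psi>)"
  shows "lnl_polycategory Q"
proof -
  interpret lnl_polycategory P by fact
  have unit: "unit_at Q = unit_at P"
    using ops by (auto simp: unit_at_def)
  have adm: "adm_list P \<Phi>" if "adm_list Q \<Phi>" for \<Phi>
    using that ops unfolding adm_list_def by auto
  show ?thesis
  proof (unfold_locales, unfold ops unit)
    fix f \<Phi> assume "f \<in> Hom Q \<Phi>"
    then show "adm_list Q \<Phi>"
      using Hom_adm[OF sub] objs ops unfolding adm_list_def by auto
  next
    fix \<Phi> L \<Psi> \<sigma> \<tau> f g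
    assume "adm_list Q (\<Phi> @ [L])" "adm_list Q (flip L # \<Psi>)"
      "structural (cls_of P) \<Phi> \<sigma>" "structural (cls_of P) \<Psi> \<tau>"
      "f \<in> Hom Q (pull \<Phi> \<sigma> @ [L])" "g \<in> Hom Q (flip L # pull \<Psi> \<tau>)"
    then show "Cmp P \<Phi> L \<Psi> (Act P (flip L # \<Psi>) (0 # map Suc \<tau>) g)
        (Act P (\<Phi> @ [L]) (\<sigma> @ [length \<Phi>]) f) =
       Act P (\<Phi> @ \<Psi>) (\<sigma> @ map ((+) (length \<Phi>)) \<tau>) (Cmp P (pull \<Phi> \<sigma>) L (pull \<Psi> \<tau>) g f)"
      by (intro equivariant adm sub)
  qed (auto simp del: upt_Suc flip.simps One_nat_def
      intro: adm sub Act Idn Cmp Act_id Act_comp unit_left unit_right assoc swap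
        weakening[OF refl] contraction[OF refl])
qed

lemma lnl_polycategory_reduct:
  assumes "lnl_polycategory C"
  shows "lnl_polycategory (reduct C K)"
proof (rule lnl_polycategory_sub[OF assms])
  interpret lnl_polycategory C by fact
  have Hom: "f \<in> Hom (reduct C K) \<Phi> \<longleftrightarrow> f \<in> Hom C \<Phi> \<and> fst K \<notin> fst ` set \<Phi>" for f \<Phi>
    by (auto simp: reduct_def)
  have Obj: "Obj (reduct C K) = Obj C - {fst K}"
    by (simp add: reduct_def)
  show "f \<in> Hom C \<Phi>" and "fst ` set \<Phi> \<subseteq> Obj (reduct C K)" if "f \<in> Hom (reduct C K) \<Phi>" for f \<Phi>
    using that adm_list_objs[OF Hom_adm] unfolding Hom Obj by blast+
  show "Act C \<Phi> \<sigma> f \<in> Hom (reduct C K) \<Phi>"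
    if "adm_list (reduct C K) \<Phi>" "structural (cls_of C) \<Phi> \<sigma>" "f \<in> Hom (reduct C K) (pull \<Phi> \<sigma>)"
    for \<Phi> \<sigma> f
  proof -
    have "fst K \<notin> fst ` set \<Phi>" "adm_list C \<Phi>"
      using that(1) unfolding adm_list_def Obj by (auto simp: reduct_def)
    then show ?thesis
      using that Act_in unfolding Hom by blast
  qed
  show "Idn C R \<in> Hom (reduct C K) [(R, Neg), (R, Pos)]" if "R \<in> Obj (reduct C K)" for R
    using that Idn_in unfolding Hom Obj by auto
  show "Cmp C \<Phi> M \<Psi> g f \<in> Hom (reduct C K) (\<Phi> @ \<Psi>)"
    if "f \<in> Hom (reduct C K) (\<Phi> @ [M])" "g \<in> Hom (reduct C K) (flip M # \<Psi>)" for \<Phi> M \<Psi> f g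
    using that Cmp_in unfolding Hom by auto
qed (auto simp: reduct_def)

lemma count_list_distinct: "distinct xs \<Longrightarrow> count_list xs x = (if x \<in> set xs then 1 else 0)"
  by (induction xs) auto

lemma structural_distinct:
  assumes "distinct \<sigma>" "set \<sigma> \<subseteq> {..<length \<Phi>}"
    and "\<And>j. j < length \<Phi> \<Longrightarrow> j \<notin> set \<sigma> \<Longrightarrow> snd (\<Phi> ! j) = Neg \<and> c (fst (\<Phi> ! j)) = NonLin"
  shows "structural c \<Phi> \<sigma>"
  using assms by (auto simp: structural_def count_list_distinct)

lemma structural_not_in:
  "structural c \<Phi> \<sigma> \<Longrightarrow> j < length \<Phi> \<Longrightarrow> j \<notin> set \<sigma>
   \<Longrightarrow> snd (\<Phi> ! j) = Neg \<and> c (fst (\<Phi> ! j)) = NonLin"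
  by (auto simp: structural_def count_list_0_iff)

lemma pull_pull: "set \<tau> \<subseteq> {..<length \<sigma>} \<Longrightarrow> pull (pull \<Phi> \<sigma>) \<tau> = pull \<Phi> (pull \<sigma> \<tau>)"
  by (auto simp: pull_def)

lemma count_list_map: "count_list (map f xs) y = length (filter (\<lambda>x. f x = y) xs)"
  by (induction xs) auto

text \<open>
  A position of \<open>\<Phi>\<close> that has to be hit exactly once by \<open>\<sigma>\<close> is hit at a single index, and
  this index has to be hit exactly once by \<open>\<tau>\<close>.
\<close>

lemma structural_pull:
  assumes \<sigma>: "structural c \<Phi> \<sigma>" and \<tau>: "structural c (pull \<Phi> \<sigma>) \<tau>"
  shows "structural c \<Phi> (pull \<sigma> \<tau>)"
proof -
  have b\<sigma>: "set \<sigma> \<subseteq> {..<length \<Phi>}" and b\<tau>: "set \<tau> \<subseteq> {..<length \<sigma>}"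
    using structural_bounds[OF \<sigma>] structural_bounds[OF \<tau>] by auto
  have "count_list (pull \<sigma> \<tau>) j = 1"
    if j: "j < length \<Phi>" and n: "\<not> (snd (\<Phi> ! j) = Neg \<and> c (fst (\<Phi> ! j)) = NonLin)" for j
  proof -
    have "count_list \<sigma> j = 1"
      using \<sigma> j n by (auto simp: structural_def)
    moreover have "count_list \<sigma> j = card {k. k < length \<sigma> \<and> \<sigma> ! k = j}"
      by (simp add: count_list_eq_length_filter length_filter_conv_card eq_commute)
    ultimately obtain k where k: "{k. k < length \<sigma> \<and> \<sigma> ! k = j} = {k}"
      by (auto simp: card_1_singleton_iff)
    then have kl: "k < length \<sigma>" "\<sigma> ! k = j"
      by auto
    have "count_list (pull \<sigma> \<tau>) j = length (filter (\<lambda>x. \<sigma> ! x = j) \<tau>)"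
      by (simp add: pull_def count_list_map)
    also have "filter (\<lambda>x. \<sigma> ! x = j) \<tau> = filter (\<lambda>x. k = x) \<tau>"
      using k b\<tau> by (intro filter_cong) auto
    also have "length \<dots> = count_list \<tau> k"
      by (simp add: count_list_eq_length_filter)
    also have "\<dots> = 1"
      using \<tau> kl n by (auto simp: structural_def pull_def)
    finally show ?thesis .
  qed
  moreover have "set (pull \<sigma> \<tau>) \<subseteq> {..<length \<Phi>}"
    using set_pull[OF b\<tau>] b\<sigma> by blast
  ultimately show ?thesis
    unfolding structural_def by blast
qed

lemma identity_image_Act:
  assumes P: "lnl_polycategory P" and f: "identity_image P R (pull \<Phi> \<sigma>) \<tau> f"
    and a: "adm_list P \<Phi>" and s: "structural (cls_of P) \<Phi> \<sigma>"
  shows "identity_image P R \<Phi> (pull \<sigma> \<tau>) (Act P \<Phi> \<sigma> f)"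
proof -
  interpret lnl_polycategory P by fact
  have R: "R \<in> Obj P" and \<tau>: "structural (cls_of P) (pull \<Phi> \<sigma>) \<tau>"
    and p: "pull (pull \<Phi> \<sigma>) \<tau> = [(R, Neg), (R, Pos)]"
    and feq: "f = Act P (pull \<Phi> \<sigma>) \<tau> (Idn P R)"
    using f by (auto simp: identity_image_def)
  have "Act P \<Phi> \<sigma> f = Act P \<Phi> (pull \<sigma> \<tau>) (Idn P R)"
    unfolding feq by (rule Act_comp[OF a s \<tau>]) (simp add: p Idn_in R)
  moreover have "pull (pull \<Phi> \<sigma>) \<tau> = pull \<Phi> (pull \<sigma> \<tau>)"
    using structural_bounds[OF \<tau>] by (simp add: pull_pull)
  ultimately show ?thesis
    using R a p structural_pull[OF s \<tau>] by (simp add: identity_image_def)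
qed

lemma identity_image_unique:
  "identity_image P R \<Phi> \<sigma> f \<Longrightarrow> identity_image P R \<Phi> \<sigma> g \<Longrightarrow> f = g"
  by (simp add: identity_image_def)

lemma identity_image_in:
  "lnl_polycategory P \<Longrightarrow> identity_image P R \<Phi> \<sigma> f \<Longrightarrow> f \<in> Hom P \<Phi>"
  using lnl_polycategory.Act_in lnl_polycategory.Idn_in unfolding identity_image_def by metis

text \<open>
  The two ends of an identity have opposite signs, so they occupy different positions; this makes
  \<open>\<sigma>\<close> injective and the structural condition on it easy to check.
\<close>

lemma identity_image_positions:
  assumes "identity_image P R \<Phi> \<sigma> f"
  obtains a b where "\<sigma> = [a, b]" "a < length \<Phi>" "b < length \<Phi>" "a \<noteq> b"
    "\<Phi> ! a = (R, Neg)" "\<Phi> ! b = (R, Pos)"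
proof -
  have "pull \<Phi> \<sigma> = [(R, Neg), (R, Pos)]" and s: "structural (cls_of P) \<Phi> \<sigma>"
    using assms by (auto simp: identity_image_def)
  then obtain a b where "\<sigma> = [a, b]" "\<Phi> ! a = (R, Neg)" "\<Phi> ! b = (R, Pos)"
    by (auto simp: pull_def)
  moreover from this structural_bounds[OF s] have "a < length \<Phi>" "b < length \<Phi>" "a \<noteq> b"
    by auto
  ultimately show ?thesis using that by blast
qed

lemma identity_image_Idn:
  assumes P: "lnl_polycategory P" and R: "R \<in> Obj P"
  shows "identity_image P R [(R, Neg), (R, Pos)] [0, 1] (Idn P R)"
proof -
  interpret lnl_polycategory P by fact
  have "Act P [(R, Neg), (R, Pos)] [0..<length [(R, Neg), (R, Pos)]] (Idn P R) = Idn P R"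
    by (intro Act_id Idn_in R)
  then show ?thesis
    using R Hom_adm[OF Idn_in[OF R]]
    by (auto simp: identity_image_def pull_def upt_rec structural_def less_Suc_eq)
qed

lemma identity_imageI:
  assumes "lnl_polycategory P" "adm_list P \<Phi>" "structural (cls_of P) \<Phi> \<sigma>"
    "pull \<Phi> \<sigma> = [(R, Neg), (R, Pos)]"
  shows "identity_image P R \<Phi> \<sigma> (Act P \<Phi> \<sigma> (Idn P R))"
proof -
  have "(R, Neg) \<in> set (pull \<Phi> \<sigma>)"
    using assms(4) by simp
  then have "(R, Neg) \<in> set \<Phi>"
    using set_pull[OF structural_bounds[OF assms(3)]] by blast
  then have "R \<in> Obj P"
    using adm_list_objs[OF assms(2)] by force
  then show ?thesis
    using assms by (simp add: identity_image_def)
qed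

lemma adm_list_mono: "adm_list P \<Phi> \<Longrightarrow> \<Phi> = \<Phi>1 @ \<Phi>2 @ \<Phi>3 \<Longrightarrow> adm_list P \<Phi>2"
  by (auto simp: adm_list_def admissible_def)

lemma adm_list_commute: "adm_list P (\<Phi>1 @ \<Phi>2) \<Longrightarrow> adm_list P (\<Phi>2 @ \<Phi>1)"
  by (auto simp: adm_list_def admissible_def add.commute)

text \<open>
  Discarding a morphism leaves the rest of its list to be introduced by weakening. Admissibility
  provides what is needed: the discarded morphism is composed along a positive nonlinear entry,
  next to which only negative nonlinear entries can stand.
\<close>

lemma adm_list_NonLin_Pos:
  assumes "adm_list P \<Phi>" "\<Phi> = \<Phi>1 @ (X, Pos) # \<Phi>2" "cls_of P X = NonLin" "K \<in> set (\<Phi>1 @ \<Phi>2)"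
  shows "snd K = Neg \<and> cls_of P (fst K) = NonLin"
proof -
  let ?Q = "\<lambda>(R, s). cls_of P R = NonLin \<and> s = Pos"
  have "\<forall>(R, s) \<in> set \<Phi>. cls_of P R = NonLin"
    using assms(1-3) by (auto simp: adm_list_def admissible_def)
  then have NL: "cls_of P (fst K) = NonLin"
    using assms(2,4) by (cases K) auto
  have "length (filter ?Q \<Phi>) \<le> 1"
    using assms(1) by (auto simp: adm_list_def admissible_def)
  then have "filter ?Q (\<Phi>1 @ \<Phi>2) = []"
    using assms(2,3) by auto
  then have "\<not> ?Q K"
    using assms(4) by (auto simp: filter_empty_conv)
  then show ?thesis
    using NL by (cases K; cases "snd K") auto
qed

text \<open>
  The positions of the two ends of the identity of which the composite of two structural images
  of identities is an image; the first image has its \<open>K\<close> at position \<open>n\<close>, the second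
  has \<open>flip K\<close> at position \<open>0\<close>. If \<open>K\<close> or \<open>flip K\<close> comes from a weakening,
  the other image is discarded; otherwise the two identities are joined along \<open>K\<close>.
\<close>

definition join :: "nat \<Rightarrow> nat list \<Rightarrow> nat list \<Rightarrow> nat list" where
  "join n \<sigma> \<tau> =
     (if n \<notin> set \<sigma> then \<sigma>
      else if 0 \<notin> set \<tau> then map (\<lambda>k. n + k - 1) \<tau>
      else if \<sigma> ! 1 = n then [\<sigma> ! 0, n + \<tau> ! 1 - 1]
      else [n + \<tau> ! 0 - 1, \<sigma> ! 1])"

text \<open>
  If an entry composed along comes from a weakening, the weakening law discards the other morphism;
  as this law is stated for a weakened \<open>flip K\<close>, the inputs are swapped first when it is \<open>K\<close> that
  is weakened. Otherwise both morphisms are images of \<open>unit_at P K\<close>, and the composite is computed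
  by equivariance and the unit law. The result is expressed by positions alone, so any functor-like
  assignment that respects structural images of identities also respects their composites.
\<close>

lemma Cmp_identity_images:
  assumes P: "lnl_polycategory P"
    and f: "identity_image P R (\<Phi> @ [K]) \<sigma> f" and g: "identity_image P R' (flip K # \<Psi>) \<tau> g"
  shows "identity_image P (if length \<Phi> \<in> set \<sigma> then R' else R) (\<Phi> @ \<Psi>)
           (join (length \<Phi>) \<sigma> \<tau>) (Cmp P \<Phi> K \<Psi> g f)"
proof -
  interpret lnl_polycategory P by fact
  define n m where "n = length \<Phi>" and "m = length \<Psi>"
  have fin: "f \<in> Hom P (\<Phi> @ [K])" and gin: "g \<in> Hom P (flip K # \<Psi>)"
    using identity_image_in[OF P] f g by blast+
  have af: "adm_list P (\<Phi> @ [K])" and ag: "adm_list P (flip K # \<Psi>)"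
    and sf: "structural (cls_of P) (\<Phi> @ [K]) \<sigma>" and sg: "structural (cls_of P) (flip K # \<Psi>) \<tau>"
    and feq: "f = Act P (\<Phi> @ [K]) \<sigma> (Idn P R)" and geq: "g = Act P (flip K # \<Psi>) \<tau> (Idn P R')"
    and RO: "R \<in> Obj P" and RO': "R' \<in> Obj P"
    using f g by (auto simp: identity_image_def)
  have ac: "adm_list P (\<Phi> @ \<Psi>)"
    using Hom_adm[OF Cmp_in[OF fin gin]] .
  have a\<Phi>: "adm_list P \<Phi>" and a\<Psi>: "adm_list P \<Psi>"
    using adm_list_mono[OF ac, of "[]" \<Phi>] adm_list_mono[OF ac, of \<Phi> \<Psi> "[]"] by auto
  obtain a b where ab: "\<sigma> = [a, b]" "a < Suc n" "b < Suc n" "a \<noteq> b"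
    "(\<Phi> @ [K]) ! a = (R, Neg)" "(\<Phi> @ [K]) ! b = (R, Pos)"
    using identity_image_positions[OF f] unfolding n_def by (metis length_append_singleton)
  obtain a' b' where ab': "\<tau> = [a', b']" "a' < Suc m" "b' < Suc m" "a' \<noteq> b'"
    "(flip K # \<Psi>) ! a' = (R', Neg)" "(flip K # \<Psi>) ! b' = (R', Pos)"
    using identity_image_positions[OF g] unfolding m_def by (metis length_Cons)
  show ?thesis
  proof (cases "n \<in> set \<sigma>")
    case False
    \<comment> \<open>\<open>f\<close> is weakened by \<open>K\<close>, so \<open>g\<close> is discarded\<close>
    obtain X where X: "K = (X, Neg)" "cls_of P X = NonLin"
      using structural_not_in[OF sf, of n] False by (cases K) (auto simp: n_def)
    have \<Psi>NL: "snd M = Neg \<and> cls_of P (fst M) = NonLin" if "M \<in> set \<Psi>" for M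
      using adm_list_NonLin_Pos[OF ag, of "[]" X \<Psi> M] that X by simp
    have s\<Phi>: "structural (cls_of P) \<Phi> \<sigma>"
    proof (rule structural_distinct)
      show "snd (\<Phi> ! j) = Neg \<and> cls_of P (fst (\<Phi> ! j)) = NonLin"
        if "j < length \<Phi>" "j \<notin> set \<sigma>" for j
        using structural_not_in[OF sf, of j] that by (auto simp: nth_append)
    qed (use ab False in \<open>auto simp: n_def\<close>)
    have "pull \<Phi> \<sigma> = [(R, Neg), (R, Pos)]"
      using ab False by (auto simp: pull_def n_def nth_append)
    define f0 where "f0 = Act P \<Phi> \<sigma> (Idn P R)"
    have f0: "identity_image P R \<Phi> \<sigma> f0"
      unfolding f0_def by (rule identity_imageI) fact+
    have aK: "adm_list P (K # \<Phi>)"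
      using adm_list_commute[OF af] by simp
    have pK: "pull (K # \<Phi>) [1..<Suc n] = \<Phi>"
      by (intro nth_equalityI) (auto simp: pull_def n_def simp del: upt_Suc)
    have pK': "pull (K # \<Phi>) ([1..<Suc n] @ [0]) = \<Phi> @ [K]"
      using pK by (simp add: pull_def)
    have "structural (cls_of P) (K # \<Phi>) [1..<Suc n]"
      using X by (intro structural_distinct)
        (auto simp: nth_Cons' n_def simp del: upt_Suc One_nat_def)
    then have "identity_image P R (K # \<Phi>) (pull [1..<Suc n] \<sigma>) (Act P (K # \<Phi>) [1..<Suc n] f0)"
      using f0 by (intro identity_image_Act P aK) (simp only: pK)
    moreover have "structural (cls_of P) (K # \<Phi>) ([1..<Suc n] @ [0])"
      by (rule structural_distinct) (auto simp: n_def)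
    then have "identity_image P R (K # \<Phi>) (pull ([1..<Suc n] @ [0]) \<sigma>)
        (Act P (K # \<Phi>) ([1..<Suc n] @ [0]) f)"
      using f by (intro identity_image_Act P aK) (simp only: pK')
    moreover have "pull ([1..<Suc n] @ [0]) \<sigma> = pull [1..<Suc n] \<sigma>"
      using ab False by (auto simp: pull_def nth_append)
    ultimately have rot: "Act P (K # \<Phi>) ([1..<Suc n] @ [0]) f = Act P (K # \<Phi>) [1..<Suc n] f0"
      using identity_image_unique by metis
    define g1 where "g1 = Act P (\<Psi> @ [flip K]) (m # [0..<m]) g"
    have pg: "pull (\<Psi> @ [flip K]) (m # [0..<m]) = flip K # \<Psi>"
      by (auto simp: pull_def m_def nth_append intro: nth_equalityI)
    have g1: "g1 \<in> Hom P (\<Psi> @ [flip K])"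
      unfolding g1_def
    proof (rule Act_in)
      show "adm_list P (\<Psi> @ [flip K])"
        using adm_list_commute[of P "[flip K]" \<Psi>] ag by simp
    qed (use gin pg in \<open>auto intro!: structural_distinct simp: m_def\<close>)
    have "Cmp P \<Phi> K \<Psi> g f = Act P (\<Phi> @ \<Psi>) ([n..<n + m] @ [0..<n])
        (Cmp P \<Psi> (flip K) \<Phi> (Act P (K # \<Phi>) [1..<Suc n] f0) g1)"
      unfolding swap[OF fin gin n_def m_def] rot g1_def ..
    also have "Cmp P \<Psi> (flip K) \<Phi> (Act P (K # \<Phi>) [1..<Suc n] f0) g1
        = Act P (\<Psi> @ \<Phi>) [m..<m + n] f0"
      using weakening[OF _ X(2) g1 identity_image_in[OF P f0] m_def n_def] X(1) by simp
    finally have eq: "Cmp P \<Phi> K \<Psi> g f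
        = Act P (\<Phi> @ \<Psi>) ([n..<n + m] @ [0..<n]) (Act P (\<Psi> @ \<Phi>) [m..<m + n] f0)" .
    have ac': "adm_list P (\<Psi> @ \<Phi>)"
      by (rule adm_list_commute[OF ac])
    have p1: "pull (\<Psi> @ \<Phi>) [m..<m + n] = \<Phi>"
      by (auto simp: pull_def m_def n_def nth_append intro: nth_equalityI)
    have p2: "pull (\<Phi> @ \<Psi>) ([n..<n + m] @ [0..<n]) = \<Psi> @ \<Phi>"
      by (auto simp: pull_def m_def n_def nth_append intro!: nth_equalityI)
    have "structural (cls_of P) (\<Psi> @ \<Phi>) [m..<m + n]"
      using \<Psi>NL by (intro structural_distinct) (auto simp: nth_append m_def n_def)
    then have i1: "identity_image P R (\<Psi> @ \<Phi>) (pull [m..<m + n] \<sigma>)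
        (Act P (\<Psi> @ \<Phi>) [m..<m + n] f0)"
      using f0 by (intro identity_image_Act P ac') (simp only: p1)
    have "structural (cls_of P) (\<Phi> @ \<Psi>) ([n..<n + m] @ [0..<n])"
      by (rule structural_distinct) (auto simp: m_def n_def)
    then have "identity_image P R (\<Phi> @ \<Psi>)
        (pull ([n..<n + m] @ [0..<n]) (pull [m..<m + n] \<sigma>)) (Cmp P \<Phi> K \<Psi> g f)"
      unfolding eq using i1 by (intro identity_image_Act P ac) (simp only: p2)
    moreover have "pull ([n..<n + m] @ [0..<n]) (pull [m..<m + n] \<sigma>) = \<sigma>"
      using ab False by (auto simp: pull_def nth_append)
    ultimately show ?thesis
      using False by (simp add: join_def n_def)
  next
    case n: True
    show ?thesis
    proof (cases "0 \<in> set \<tau>")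
      case False
      \<comment> \<open>\<open>g\<close> is weakened by \<open>flip K\<close>, so \<open>f\<close> is discarded\<close>
      obtain X where X: "K = (X, Pos)" "cls_of P X = NonLin"
        using structural_not_in[OF sg, of 0] False by (cases K; cases "snd K") auto
      have \<Phi>NL: "snd M = Neg \<and> cls_of P (fst M) = NonLin" if "M \<in> set \<Phi>" for M
        using adm_list_NonLin_Pos[OF af, of \<Phi> X "[]" M] that X by simp
      define \<tau>' where "\<tau>' = [a' - 1, b' - 1]"
      have pos: "a' > 0" "b' > 0"
        using False ab' by auto
      have s\<Psi>: "structural (cls_of P) \<Psi> \<tau>'"
      proof (rule structural_distinct)
        show "snd (\<Psi> ! j) = Neg \<and> cls_of P (fst (\<Psi> ! j)) = NonLin"
          if "j < length \<Psi>" "j \<notin> set \<tau>'" for j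
        proof -
          have "Suc j \<notin> set \<tau>"
            using that ab' by (auto simp: \<tau>'_def)
          then show ?thesis
            using structural_not_in[OF sg, of "Suc j"] that by simp
        qed
      qed (use ab' pos in \<open>auto simp: m_def \<tau>'_def\<close>)
      have "pull \<Psi> \<tau>' = [(R', Neg), (R', Pos)]"
        using ab' pos by (auto simp: pull_def \<tau>'_def nth_Cons')
      define g0 where "g0 = Act P \<Psi> \<tau>' (Idn P R')"
      have g0: "identity_image P R' \<Psi> \<tau>' g0"
        unfolding g0_def by (rule identity_imageI) fact+
      have pK: "pull (flip K # \<Psi>) [1..<Suc m] = \<Psi>"
        by (intro nth_equalityI) (auto simp: pull_def m_def simp del: upt_Suc)
      have "structural (cls_of P) (flip K # \<Psi>) [1..<Suc m]"
        using X by (intro structural_distinct)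
          (auto simp: nth_Cons' m_def simp del: upt_Suc One_nat_def)
      then have "identity_image P R' (flip K # \<Psi>) (pull [1..<Suc m] \<tau>')
          (Act P (flip K # \<Psi>) [1..<Suc m] g0)"
        using g0 by (intro identity_image_Act P ag) (simp only: pK)
      moreover have "pull [1..<Suc m] \<tau>' = \<tau>"
        using ab' pos by (auto simp: pull_def \<tau>'_def nth_append)
      ultimately have geq: "g = Act P (flip K # \<Psi>) [1..<Suc m] g0"
        using identity_image_unique g by metis
      have eq: "Cmp P \<Phi> K \<Psi> g f = Act P (\<Phi> @ \<Psi>) [n..<n + m] g0"
        unfolding geq by (rule weakening[OF X fin identity_image_in[OF P g0] n_def m_def])
      have p1: "pull (\<Phi> @ \<Psi>) [n..<n + m] = \<Psi>"
        by (auto simp: pull_def m_def n_def nth_append intro: nth_equalityI)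
      have "structural (cls_of P) (\<Phi> @ \<Psi>) [n..<n + m]"
        using \<Phi>NL by (intro structural_distinct) (auto simp: nth_append m_def n_def)
      then have "identity_image P R' (\<Phi> @ \<Psi>) (pull [n..<n + m] \<tau>') (Cmp P \<Phi> K \<Psi> g f)"
        unfolding eq using g0 by (intro identity_image_Act P ac) (simp only: p1)
      moreover have "pull [n..<n + m] \<tau>' = join n \<sigma> \<tau>"
        using n False ab' pos by (auto simp: join_def pull_def \<tau>'_def)
      ultimately show ?thesis
        using n by (simp add: n_def)
    next
      case True
      \<comment> \<open>both are images of the identity of the object under \<open>K\<close>\<close>
      define e where "e = unit_at P K"
      define c where "c = (if a = n then b else a)"
      define d where "d = (if a' = 0 then b' - 1 else a' - 1)"
      define \<rho> :: "nat list" where "\<rho> = (if snd K = Pos then [0, 1] else [1, 0])"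
      have cn: "c < n" and dm: "d < m"
        using ab ab' n by (auto simp: c_def d_def)
      have K: "K = (R, if b = n then Pos else Neg)"
        using ab n by (auto simp: n_def)
      have RR: "R' = R" and flK: "flip K = (R, if a' = 0 then Neg else Pos)"
        using ab' True K by (auto split: if_splits)
      have sgn: "b = n \<longleftrightarrow> a' = 0"
        using K flK by (auto split: if_splits)
      have \<Phi>c: "\<Phi> ! c = flip K" and \<Psi>d: "\<Psi> ! d = K"
        using ab ab' n True K RR sgn cn dm
        by (auto simp: c_def d_def nth_append nth_Cons' n_def split: if_splits)
      have e: "identity_image P R [flip K, K] \<rho> e"
      proof (cases "snd K")
        case Pos
        then show ?thesis
          using identity_image_Idn[OF P RO] K by (auto simp: e_def unit_at_def \<rho>_def split: if_splits)
      next
        case Neg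
        have "adm_list P [(R, Pos), (R, Neg)]"
          using adm_list_commute[of P "[(R, Neg)]" "[(R, Pos)]"] Hom_adm[OF Idn_in[OF RO]] by simp
        then have "identity_image P R [(R, Pos), (R, Neg)] [1, 0]
            (Act P [(R, Pos), (R, Neg)] [1, 0] (Idn P R))"
          by (intro identity_imageI P structural_distinct) (auto simp: pull_def)
        then show ?thesis
          using K Neg by (auto simp: e_def unit_at_def \<rho>_def split: if_splits)
      qed
      have ein: "e \<in> Hom P [flip K, K]"
        by (rule identity_image_in[OF P e])
      have s\<Phi>: "structural (cls_of P) \<Phi> [c]"
      proof (rule structural_distinct)
        show "snd (\<Phi> ! j) = Neg \<and> cls_of P (fst (\<Phi> ! j)) = NonLin"
          if "j < length \<Phi>" "j \<notin> set [c]" for j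
          using structural_not_in[OF sf, of j] that ab n
          by (auto simp: nth_append c_def n_def split: if_splits)
      qed (use cn in \<open>auto simp: n_def\<close>)
      have s\<Psi>: "structural (cls_of P) \<Psi> [d]"
      proof (rule structural_distinct)
        show "snd (\<Psi> ! j) = Neg \<and> cls_of P (fst (\<Psi> ! j)) = NonLin"
          if "j < length \<Psi>" "j \<notin> set [d]" for j
          using structural_not_in[OF sg, of "Suc j"] that ab' True
          by (auto simp: d_def m_def split: if_splits)
      qed (use dm in \<open>auto simp: m_def\<close>)
      have p\<Phi>: "pull (\<Phi> @ [K]) [c, n] = [flip K, K]"
        using cn \<Phi>c by (auto simp: pull_def nth_append n_def)
      have "structural (cls_of P) (\<Phi> @ [K]) [c, n]"
        using cn structural_not_in[OF s\<Phi>]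
        by (intro structural_distinct) (auto simp: n_def nth_append less_Suc_eq)
      then have "identity_image P R (\<Phi> @ [K]) (pull [c, n] \<rho>) (Act P (\<Phi> @ [K]) [c, n] e)"
        using e p\<Phi> by (intro identity_image_Act P af) auto
      moreover have "pull [c, n] \<rho> = \<sigma>"
        using ab n K by (auto simp: pull_def \<rho>_def c_def)
      ultimately have feq: "f = Act P (\<Phi> @ [K]) ([c] @ [length \<Phi>]) e"
        using identity_image_unique f by (metis append_Cons append_Nil n_def)
      have p\<Psi>: "pull (flip K # \<Psi>) [0, Suc d] = [flip K, K]"
        using dm \<Psi>d by (auto simp: pull_def m_def)
      have "structural (cls_of P) (flip K # \<Psi>) [0, Suc d]"
        using dm structural_not_in[OF s\<Psi>]
        by (intro structural_distinct) (auto simp: m_def nth_Cons')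
      then have "identity_image P R (flip K # \<Psi>) (pull [0, Suc d] \<rho>)
          (Act P (flip K # \<Psi>) [0, Suc d] e)"
        using e p\<Psi> by (intro identity_image_Act P ag) auto
      moreover have "pull [0, Suc d] \<rho> = \<tau>"
        using ab' True sgn K by (auto simp: pull_def \<rho>_def d_def)
      ultimately have geq: "g = Act P (flip K # \<Psi>) (0 # map Suc [d]) e"
        using identity_image_unique g RR by (metis list.map)
      have pc: "pull \<Phi> [c] = [flip K]" and pd: "pull \<Psi> [d] = [K]"
        using \<Phi>c \<Psi>d by (auto simp: pull_def)
      have "Cmp P \<Phi> K \<Psi> g f = Act P (\<Phi> @ \<Psi>) ([c] @ map (\<lambda>k. length \<Phi> + k) [d])
          (Cmp P [flip K] K [K] e e)"
        unfolding feq geq using equivariant[OF af ag s\<Phi> s\<Psi>, of e e] ein by (simp add: pc pd)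
      also have "Cmp P [flip K] K [K] e e = e"
        using unit_left[of e "[flip K]" K] ein by (simp add: e_def)
      finally have eq: "Cmp P \<Phi> K \<Psi> g f = Act P (\<Phi> @ \<Psi>) [c, n + d] e"
        by (simp add: n_def)
      have pcd: "pull (\<Phi> @ \<Psi>) [c, n + d] = [flip K, K]"
        using cn \<Phi>c \<Psi>d by (auto simp: pull_def nth_append n_def)
      have "structural (cls_of P) (\<Phi> @ \<Psi>) [c, n + d]"
        using cn dm structural_not_in[OF s\<Phi>] structural_not_in[OF s\<Psi>]
        by (intro structural_distinct) (auto simp: n_def m_def nth_append)
      then have "identity_image P R (\<Phi> @ \<Psi>) (pull [c, n + d] \<rho>) (Cmp P \<Phi> K \<Psi> g f)"
        unfolding eq using e pcd by (intro identity_image_Act P ac) auto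
      moreover have "pull [c, n + d] \<rho> = join n \<sigma> \<tau>"
        using ab ab' n True K sgn by (auto simp: join_def pull_def \<rho>_def c_def d_def)
      ultimately show ?thesis
        using n RR by (simp add: n_def)
    qed
  qed
qed

text \<open>
  The values of a functor on structural images of identities are forced, and the reduct of a
  discrete cone has no other morphisms.
\<close>

lemma functor_discrete_eq:
  assumes disc: "discrete_cone C K"
    and u: "is_functor (reduct C K) Q u" and v: "is_functor (reduct C K) Q v"
    and P: "lnl_polycategory (reduct C K)"
    and obj: "\<And>A. A \<in> Obj (reduct C K) \<Longrightarrow> on_obj u A = on_obj v A"
  shows "u = v"
proof (rule functor_eqI[OF u v obj])
  let ?E = "reduct C K"
  fix \<Phi> f assume "f \<in> Hom ?E \<Phi>"
  then obtain R \<sigma> where "identity_image ?E R \<Phi> \<sigma> f"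
    using disc unfolding discrete_cone_def by fast
  then have R: "R \<in> Obj ?E" and a: "adm_list ?E \<Phi>" and s: "structural (cls_of ?E) \<Phi> \<sigma>"
    and p: "pull \<Phi> \<sigma> = [(R, Neg), (R, Pos)]" and f: "f = Act ?E \<Phi> \<sigma> (Idn ?E R)"
    by (auto simp: identity_image_def)
  have i: "Idn ?E R \<in> Hom ?E (pull \<Phi> \<sigma>)"
    using lnl_polycategory.Idn_in[OF P R] p by simp
  have image: "on_hom w \<Phi> f = Act Q (smap (on_obj w) \<Phi>) \<sigma> (Idn Q (on_obj w R))"
    if "is_functor ?E Q w" for w
    unfolding f functor_Act[OF that i a s] unfolding p functor_Idn[OF that R] ..
  have "smap (on_obj u) \<Phi> = smap (on_obj v) \<Phi>"
    using adm_list_objs[OF a] by (auto intro!: obj simp: apfst_def map_prod_def split: prod.splits)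
  then show "on_hom u \<Phi> f = on_hom v \<Phi> f"
    unfolding image[OF u] image[OF v] by (simp only: obj[OF R])
qed

text \<open>
  The forced value at a morphism is well defined because the morphism is a structural image of an
  identity in only one way. Preservation of composition is the case of interest: in the reduct and in
  \<open>Q\<close> the composite is the image of an identity at the positions given by \<open>join\<close>.
\<close>

lemma functor_discrete_exists:
  assumes C: "lnl_polycategory C" and disc: "discrete_cone C K" and Q: "lnl_polycategory Q"
    and g: "\<And>A. A \<in> Obj (reduct C K) \<Longrightarrow> g A \<in> Obj Q \<and> cls_of Q (g A) = cls_of C A"
  obtains u where "is_functor (reduct C K) Q u" "\<And>A. A \<in> Obj (reduct C K) \<Longrightarrow> on_obj u A = g A"
proof -
  define E where "E = reduct C K"
  have clsE: "cls_of E = cls_of C"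
    by (simp add: E_def reduct_def)
  interpret E: lnl_polycategory E
    unfolding E_def by (rule lnl_polycategory_reduct[OF C])
  interpret Q: lnl_polycategory Q by (rule Q)
  define u where "u = \<lparr>on_obj = \<lambda>A \<in> Obj E. g A,
    on_hom = \<lambda>\<Phi>. \<lambda>f \<in> Hom E \<Phi>. let p = SOME p. identity_image E (fst p) \<Phi> (snd p) f
      in Act Q (smap g \<Phi>) (snd p) (Idn Q (g (fst p)))\<rparr>"
  have objs: "fst ` set \<Phi> \<subseteq> Obj E" if "f \<in> Hom E \<Phi>" for f \<Phi>
    using E.Hom_adm[OF that] by (rule adm_list_objs)
  have smap: "smap (on_obj u) \<Phi> = smap g \<Phi>" if "fst ` set \<Phi> \<subseteq> Obj E" for \<Phi>
    using that by (intro map_cong) (auto simp: u_def)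
  have ex: "\<exists>R \<sigma>. identity_image E R \<Phi> \<sigma> f" if "f \<in> Hom E \<Phi>" for \<Phi> f
    using disc that unfolding discrete_cone_def E_def by fast
  have uniq: "R = R' \<and> \<sigma> = \<sigma>'"
    if "identity_image E R \<Phi> \<sigma> f" "identity_image E R' \<Phi> \<sigma>' f" for R \<sigma> R' \<sigma>' \<Phi> f
  proof -
    have "f \<in> Hom E \<Phi>"
      using identity_image_in[OF E.lnl_polycategory_axioms that(1)] .
    then have "\<exists>!p. identity_image E (fst p) \<Phi> (snd p) f"
      using disc unfolding discrete_cone_def E_def case_prod_beta by blast
    then show ?thesis
      using that by (metis fst_conv snd_conv)
  qed
  have map_adm: "adm_list Q (smap g \<Phi>)"
    and map_structural: "structural (cls_of Q) (smap g \<Phi>) \<sigma> = structural (cls_of E) \<Phi> \<sigma>"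
    if a: "adm_list E \<Phi>" for \<Phi> \<sigma>
  proof -
    have g': "g A \<in> Obj Q \<and> cls_of Q (g A) = cls_of E A" if "A \<in> fst ` set \<Phi>" for A
      using adm_list_objs[OF a] that g clsE unfolding E_def by auto
    then have "admissible (cls_of Q) (smap g \<Phi>)"
      using a admissible_smap[of \<Phi> "cls_of Q" g "cls_of E"] by (simp add: adm_list_def)
    then show "adm_list Q (smap g \<Phi>)"
      using g' unfolding adm_list_def fst_set_smap by blast
    show "structural (cls_of Q) (smap g \<Phi>) \<sigma> = structural (cls_of E) \<Phi> \<sigma>"
      using g' by (intro structural_smap) blast
  qed
  have image: "identity_image Q (g R) (smap g \<Phi>) \<sigma> (on_hom u \<Phi> f)"
    if f: "identity_image E R \<Phi> \<sigma> f" for R \<Phi> \<sigma> f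
  proof -
    have "f \<in> Hom E \<Phi>"
      using identity_image_in[OF E.lnl_polycategory_axioms f] .
    moreover have "(SOME p. identity_image E (fst p) \<Phi> (snd p) f) = (R, \<sigma>)"
      by (rule some_equality) (use f uniq in \<open>auto intro!: prod_eqI\<close>)
    ultimately have eq: "on_hom u \<Phi> f = Act Q (smap g \<Phi>) \<sigma> (Idn Q (g R))"
      by (simp add: u_def)
    have a: "adm_list E \<Phi>" and s: "structural (cls_of E) \<Phi> \<sigma>" and R: "R \<in> Obj E"
      and p: "pull \<Phi> \<sigma> = [(R, Neg), (R, Pos)]"
      using f by (auto simp: identity_image_def)
    have "adm_list Q (smap g \<Phi>)" "structural (cls_of Q) (smap g \<Phi>) \<sigma>"
      using map_adm[OF a] map_structural[OF a] s by simp_all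
    moreover have "pull (smap g \<Phi>) \<sigma> = [(g R, Neg), (g R, Pos)]"
      using pull_map[OF structural_bounds[OF s], of "apfst g"] p by simp
    ultimately show ?thesis
      unfolding eq by (intro identity_imageI Q)
  qed
  have "is_functor E Q u" unfolding is_functor_def
  proof (intro conjI allI ballI impI)
    fix \<Phi>
    show "on_hom u \<Phi> \<in> Hom E \<Phi> \<rightarrow>\<^sub>E Hom Q (smap (on_obj u) \<Phi>)"
    proof (rule PiE_I)
      fix f assume f: "f \<in> Hom E \<Phi>"
      then show "on_hom u \<Phi> f \<in> Hom Q (smap (on_obj u) \<Phi>)"
        using ex[OF f] image identity_image_in[OF Q] unfolding smap[OF objs[OF f]] by blast
    qed (simp add: u_def)
  next
    fix \<Phi> \<sigma> f
    assume f: "f \<in> Hom E (pull \<Phi> \<sigma>)" and a: "adm_list E \<Phi>" and s: "structural (cls_of E) \<Phi> \<sigma>"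
    obtain R \<tau> where i: "identity_image E R (pull \<Phi> \<sigma>) \<tau> f"
      using ex[OF f] by blast
    have aQ: "adm_list Q (smap g \<Phi>)" and sQ: "structural (cls_of Q) (smap g \<Phi>) \<sigma>"
      using map_adm[OF a] map_structural[OF a] s by simp_all
    have "identity_image Q (g R) (smap g \<Phi>) (pull \<sigma> \<tau>) (on_hom u \<Phi> (Act E \<Phi> \<sigma> f))"
      by (rule image[OF identity_image_Act[OF E.lnl_polycategory_axioms i a s]])
    moreover have "identity_image Q (g R) (smap g \<Phi>) (pull \<sigma> \<tau>)
        (Act Q (smap g \<Phi>) \<sigma> (on_hom u (pull \<Phi> \<sigma>) f))"
      using image[OF i] pull_map[OF structural_bounds[OF s], of "apfst g"]
      by (intro identity_image_Act Q aQ sQ) simp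
    ultimately show "on_hom u \<Phi> (Act E \<Phi> \<sigma> f)
        = Act Q (smap (on_obj u) \<Phi>) \<sigma> (on_hom u (pull \<Phi> \<sigma>) f)"
      unfolding smap[OF adm_list_objs[OF a]] by (rule identity_image_unique)
  next
    fix A assume A: "A \<in> Obj E"
    have "identity_image Q (g A) [(g A, Neg), (g A, Pos)] [0, 1]
        (on_hom u [(A, Neg), (A, Pos)] (Idn E A))"
      using image[OF identity_image_Idn[OF E.lnl_polycategory_axioms A]] by simp
    moreover have "identity_image Q (g A) [(g A, Neg), (g A, Pos)] [0, 1] (Idn Q (g A))"
      using A g by (intro identity_image_Idn Q) (simp add: E_def)
    moreover have "on_obj u A = g A"
      using A by (simp add: u_def)
    ultimately show "on_hom u [(A, Neg), (A, Pos)] (Idn E A) = Idn Q (on_obj u A)"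
      using identity_image_unique by metis
  next
    fix \<Phi> M \<Psi> f h
    assume f: "f \<in> Hom E (\<Phi> @ [M])" and h: "h \<in> Hom E (flip M # \<Psi>)"
    obtain R \<sigma> R' \<tau> where i: "identity_image E R (\<Phi> @ [M]) \<sigma> f"
      and j: "identity_image E R' (flip M # \<Psi>) \<tau> h"
      using ex[OF f] ex[OF h] by blast
    let ?R = "if length \<Phi> \<in> set \<sigma> then R' else R"
    have "identity_image Q (g ?R) (smap g \<Phi> @ smap g \<Psi>) (join (length \<Phi>) \<sigma> \<tau>)
        (on_hom u (\<Phi> @ \<Psi>) (Cmp E \<Phi> M \<Psi> h f))"
      using image[OF Cmp_identity_images[OF E.lnl_polycategory_axioms i j]] by simp
    moreover have "identity_image Q (if length (smap g \<Phi>) \<in> set \<sigma> then g R' else g R)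
        (smap g \<Phi> @ smap g \<Psi>) (join (length (smap g \<Phi>)) \<sigma> \<tau>)
        (Cmp Q (smap g \<Phi>) (apfst g M) (smap g \<Psi>) (on_hom u (flip M # \<Psi>) h)
          (on_hom u (\<Phi> @ [M]) f))"
      using image[OF i] image[OF j] by (intro Cmp_identity_images Q) (simp_all add: flip_apfst)
    ultimately have eq: "on_hom u (\<Phi> @ \<Psi>) (Cmp E \<Phi> M \<Psi> h f)
        = Cmp Q (smap g \<Phi>) (apfst g M) (smap g \<Psi>) (on_hom u (flip M # \<Psi>) h)
          (on_hom u (\<Phi> @ [M]) f)"
      unfolding length_map if_distrib[of g, symmetric] by (rule identity_image_unique)
    have "fst ` set (\<Phi> @ [M]) \<subseteq> Obj E" "fst ` set (flip M # \<Psi>) \<subseteq> Obj E"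
      using objs f h by blast+
    then have "smap (on_obj u) \<Phi> = smap g \<Phi>" "smap (on_obj u) \<Psi> = smap g \<Psi>"
      "apfst (on_obj u) M = apfst g M"
      using smap[of \<Phi>] smap[of \<Psi>] smap[of "[M]"] by simp_all
    then show "on_hom u (\<Phi> @ \<Psi>) (Cmp E \<Phi> M \<Psi> h f)
        = Cmp Q (smap (on_obj u) \<Phi>) (apfst (on_obj u) M) (smap (on_obj u) \<Psi>)
          (on_hom u (flip M # \<Psi>) h) (on_hom u (\<Phi> @ [M]) f)"
      by (simp only: eq)
  qed (use g clsE in \<open>auto simp: u_def E_def\<close>)
  then show ?thesis
    using that[of u] unfolding E_def[symmetric] by (simp add: u_def)
qed

section \<open>Objects of colimits of sketches\<close>

locale subterminal_doctrine =
  fixes D :: "('o, 'm, 'i) doctrine"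
  assumes doctrine: "lnl_doctrine D" and subterminal_base: "subterminal (base D)"
begin

lemma base_polycategory: "lnl_polycategory (base D)"
  using doctrine by (simp add: lnl_doctrine_def)

lemma cone_polycategory: "i \<in> cones D \<Longrightarrow> lnl_polycategory (cone D i)"
  using doctrine by (simp add: lnl_doctrine_def abstract_cone_def)

lemma cone_vertex: "i \<in> cones D \<Longrightarrow> fst (vertex D i) \<in> Obj (cone D i)"
  using doctrine by (simp add: lnl_doctrine_def abstract_cone_def)

lemma cone_functor: "i \<in> cones D \<Longrightarrow> is_functor (cone D i) (base D) (cone_fun D i)"
  using doctrine by (simp add: lnl_doctrine_def)

text \<open>
  Over a subterminal base, compatibility with the projections is automatic.
\<close>

lemma is_sketchI:
  assumes "lnl_polycategory (sk_cat T)" "is_functor (sk_cat T) (base D) (sk_proj T)"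
    and "\<And>i F. i \<in> cones D \<Longrightarrow> F \<in> sk_ext T i \<Longrightarrow> is_functor (cone D i) (sk_cat T) F"
  shows "is_sketch D T"
  unfolding is_sketch_def
proof (intro conjI ballI)
  fix i F assume i: "i \<in> cones D" "F \<in> sk_ext T i"
  show "comp_fun (cone D i) (sk_proj T) F = cone_fun D i"
    using functor_comp[OF assms(3)[OF i] assms(2)] cone_polycategory[OF i(1)] cone_functor[OF i(1)]
      subterminal_base by (blast intro: functor_eq_subterminal)
qed (use assms in auto)

lemma is_sketchD:
  assumes "is_sketch D T"
  shows "lnl_polycategory (sk_cat T)" "is_functor (sk_cat T) (base D) (sk_proj T)"
    "\<And>i F. i \<in> cones D \<Longrightarrow> F \<in> sk_ext T i \<Longrightarrow> is_functor (cone D i) (sk_cat T) F"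
  using assms by (auto simp: is_sketch_def)

lemma sketch_morI:
  assumes "is_sketch D T" "is_sketch D U" "is_functor (sk_cat T) (sk_cat U) H"
    and "\<And>i F. i \<in> cones D \<Longrightarrow> F \<in> sk_ext T i \<Longrightarrow> comp_fun (cone D i) H F \<in> sk_ext U i"
  shows "sketch_mor D T U H"
  unfolding sketch_mor_def
  using assms functor_comp[OF assms(3) is_sketchD(2)[OF assms(2)]] is_sketchD[OF assms(1)] subterminal_base
  by (blast intro: functor_eq_subterminal)

lemma sketch_mor_functor: "sketch_mor D T U H \<Longrightarrow> is_functor (sk_cat T) (sk_cat U) H"
  by (simp add: sketch_mor_def)

text \<open>
  Only meaningful for classes that occur in the base.
\<close>

definition base_obj :: "cls \<Rightarrow> 'o" where
  "base_obj c = (SOME R. R \<in> Obj (base D) \<and> cls_of (base D) R = c)"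

lemma base_obj:
  assumes "R \<in> Obj (base D)"
  shows "base_obj (cls_of (base D) R) = R"
proof -
  have "base_obj (cls_of (base D) R) \<in> Obj (base D)
      \<and> cls_of (base D) (base_obj (cls_of (base D) R)) = cls_of (base D) R"
    unfolding base_obj_def by (rule someI) (use assms in auto)
  then show ?thesis
    using assms subterminal_base unfolding subterminal_def by blast
qed

definition test_objs :: "(cls \<times> bool \<Rightarrow> 'a) \<Rightarrow> 'a set" where
  "test_objs e = e ` ((cls_of (base D) ` Obj (base D)) \<times> UNIV)"

text \<open>
  With the hom-sets of the base and all lifts of cones proto-extremal, nothing but the object function
  of a sketch morphism into this sketch can vary; and this only by the Boolean component, since
  classes are preserved. The injection \<open>e\<close> embeds the four codes into whatever type the objects of the
  colimit under consideration are taken from.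
\<close>

definition test_sketch :: "(cls \<times> bool \<Rightarrow> 'a) \<Rightarrow> ('a, 'm, 'o, 'm, 'i) sketch" where
  "test_sketch e = (let p = (\<lambda>x. base_obj (fst (inv e x))); Q = pullback (base D) p (test_objs e) in
     \<lparr> sk_cat = Q, sk_proj = pullback_proj (base D) p (test_objs e),
       sk_ext = (\<lambda>i. {F. is_functor (cone D i) Q F}) \<rparr>)"

lemma test_objs_base: "inj e \<Longrightarrow> (\<lambda>x. base_obj (fst (inv e x))) ` test_objs e \<subseteq> Obj (base D)"
  by (auto simp: test_objs_def base_obj)

lemma is_sketch_test:
  assumes "inj e"
  shows "is_sketch D (test_sketch e)"
  using lnl_polycategory_pullback[OF base_polycategory test_objs_base[OF assms]]
    functor_pullback_proj[OF base_polycategory test_objs_base[OF assms]]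
  by (intro is_sketchI) (simp_all add: test_sketch_def Let_def)

lemma test_functor_eqI:
  assumes "is_functor P (sk_cat (test_sketch e)) F" "is_functor P (sk_cat (test_sketch e)) G"
    "lnl_polycategory P" "\<And>A. A \<in> Obj P \<Longrightarrow> on_obj F A = on_obj G A"
  shows "F = G"
  using assms(1-3) _ assms(4)
proof (rule functor_eq_thin)
  fix \<Phi> f g
  assume "f \<in> Hom (sk_cat (test_sketch e)) \<Phi>" "g \<in> Hom (sk_cat (test_sketch e)) \<Phi>"
  then show "f = g"
    using subterminal_base
    by (auto simp: test_sketch_def Let_def pullback_Hom subterminal_def)
qed

text \<open>
  The sketch morphism into the test sketch that corresponds to a predicate on objects.
\<close>

definition classify ::
  "(cls \<times> bool \<Rightarrow> 'e) \<Rightarrow> ('a, 'b, 'o, 'm, 'i) sketch \<Rightarrow> ('a \<Rightarrow> bool) \<Rightarrow> ('a, 'b, 'e, 'm) lnl_fun"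
  where "classify e T P = \<lparr>
     on_obj = (\<lambda>x \<in> Obj (sk_cat T). e (cls_of (sk_cat T) x, P x)),
     on_hom = on_hom (sk_proj T) \<rparr>"

lemma classify_obj:
  "x \<in> Obj (sk_cat T) \<Longrightarrow> on_obj (classify e T P) x = e (cls_of (sk_cat T) x, P x)"
  by (simp add: classify_def)

lemma classify_mor:
  assumes T: "is_sketch D T" and e: "inj e"
  shows "sketch_mor D T (test_sketch e) (classify e T P)"
proof -
  note T' = is_sketchD[OF T]
  have "cls_of (sk_cat T) x \<in> cls_of (base D) ` Obj (base D)
      \<and> base_obj (cls_of (sk_cat T) x) = on_obj (sk_proj T) x" if "x \<in> Obj (sk_cat T)" for x
    using functor_obj[OF T'(2) that] functor_cls[OF T'(2) that] base_obj by (metis imageI)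
  then have F: "is_functor (sk_cat T) (sk_cat (test_sketch e)) (classify e T P)"
    unfolding classify_def test_sketch_def Let_def sketch.simps
    by (intro functor_pullback_lift T') (auto simp: test_objs_def e)
  show ?thesis
  proof (rule sketch_morI[OF T is_sketch_test[OF e] F])
    fix i G assume "i \<in> cones D" "G \<in> sk_ext T i"
    then have "is_functor (cone D i) (sk_cat (test_sketch e)) (comp_fun (cone D i) (classify e T P) G)"
      by (intro functor_comp[OF T'(3) F] cone_polycategory)
    then show "comp_fun (cone D i) (classify e T P) G \<in> sk_ext (test_sketch e) i"
      by (simp add: test_sketch_def Let_def)
  qed
qed

lemma classify_comp_eq:
  assumes "lnl_polycategory A" "is_sketch D T" "is_sketch D U" "inj e"
    and F: "is_functor A (sk_cat T) F" and G: "is_functor A (sk_cat U) G"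
    and eq: "\<And>x. x \<in> Obj A \<Longrightarrow> P (on_obj F x) = Q (on_obj G x)"
  shows "comp_fun A (classify e T P) F = comp_fun A (classify e U Q) G"
proof (rule test_functor_eqI)
  show "is_functor A (sk_cat (test_sketch e)) (comp_fun A (classify e T P) F)"
    "is_functor A (sk_cat (test_sketch e)) (comp_fun A (classify e U Q) G)"
    using assms by (blast intro: functor_comp sketch_mor_functor classify_mor)+
  show "on_obj (comp_fun A (classify e T P) F) x = on_obj (comp_fun A (classify e U Q) G) x"
    if "x \<in> Obj A" for x
    using that eq by (simp add: comp_fun_def classify_obj functor_obj[OF F] functor_obj[OF G]
        functor_cls[OF F] functor_cls[OF G])
qed fact

lemma comp_classify:
  assumes "is_sketch D T" "is_sketch D U" "inj e" and F: "is_functor (sk_cat T) (sk_cat U) F"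
    and eq: "\<And>x. x \<in> Obj (sk_cat T) \<Longrightarrow> Q (on_obj F x) = P x"
  shows "sk_comp T (classify e U Q) F = classify e T P"
proof (rule test_functor_eqI)
  show "is_functor (sk_cat T) (sk_cat (test_sketch e)) (classify e T P)"
    "is_functor (sk_cat T) (sk_cat (test_sketch e)) (sk_comp T (classify e U Q) F)"
    using assms by (blast intro: functor_comp sketch_mor_functor classify_mor is_sketchD)+
  show "on_obj (sk_comp T (classify e U Q) F) x = on_obj (classify e T P) x"
    if "x \<in> Obj (sk_cat T)" for x
    using that eq by (simp add: comp_fun_def classify_obj functor_obj[OF F] functor_cls[OF F])
qed (use assms in \<open>blast intro: is_sketchD\<close>)

end

lemma test_objects_exist:
  assumes "infinite (UNIV :: 'a set)"
  obtains e :: "cls \<times> bool \<Rightarrow> 'a" where "inj e"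
proof -
  obtain f :: "nat \<Rightarrow> 'a" where f: "inj f"
    using infinite_countable_subset[OF assms] by blast
  define g :: "cls \<times> bool \<Rightarrow> nat" where "g = (\<lambda>(c, b). case c of Lin \<Rightarrow> of_bool b | NonLin \<Rightarrow> 2 + of_bool b)"
  have "inj g"
    by (auto simp: inj_on_def g_def of_bool_def split: if_splits cls.splits)
  then show ?thesis
    using that[of "f \<circ> g"] inj_compose[OF f] by blast
qed

locale sketch_pushout = subterminal_doctrine D
  for D :: "('o, 'm, 'i) doctrine" +
  fixes X :: "'x set"
    and A :: "'x \<Rightarrow> ('a, 'b, 'o, 'm, 'i) sketch" and B :: "'x \<Rightarrow> ('c, 'd, 'o, 'm, 'i) sketch"
    and a :: "'x \<Rightarrow> ('a, 'b, 'c, 'd) lnl_fun" and u :: "'x \<Rightarrow> ('a, 'b, 'e, 'm) lnl_fun"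
    and T T' :: "('e, 'm, 'o, 'm, 'i) sketch"
    and j :: "('e, 'm, 'e, 'm) lnl_fun" and k :: "'x \<Rightarrow> ('c, 'd, 'e, 'm) lnl_fun"
  assumes inf: "infinite (UNIV :: 'e set)"
    and pushout: "is_pushout D X A B a u T T' j k"
    and T: "is_sketch D T"
    and A: "x \<in> X \<Longrightarrow> lnl_polycategory (sk_cat (A x))"
    and B: "x \<in> X \<Longrightarrow> is_sketch D (B x)"
    and a: "x \<in> X \<Longrightarrow> is_functor (sk_cat (A x)) (sk_cat (B x)) (a x)"
    and u: "x \<in> X \<Longrightarrow> is_functor (sk_cat (A x)) (sk_cat T) (u x)"
begin

lemma T': "is_sketch D T'" and j: "is_functor (sk_cat T) (sk_cat T') j"
  and k: "x \<in> X \<Longrightarrow> is_functor (sk_cat (B x)) (sk_cat T') (k x)"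
  using pushout by (auto simp: is_pushout_def intro: sketch_mor_functor)

lemma square:
  assumes "x \<in> X" "y \<in> Obj (sk_cat (A x))"
  shows "on_obj (k x) (on_obj (a x) y) = on_obj j (on_obj (u x) y)"
proof -
  have "sk_comp (A x) (k x) (a x) = sk_comp (A x) j (u x)"
    using pushout assms by (simp add: is_pushout_def)
  then have "on_obj (sk_comp (A x) (k x) (a x)) y = on_obj (sk_comp (A x) j (u x)) y"
    by simp
  then show ?thesis
    using assms by (simp add: comp_fun_def)
qed

lemma predicate_universal:
  fixes e :: "cls \<times> bool \<Rightarrow> 'e"
  assumes "inj e"
    and comp: "\<And>x y. x \<in> X \<Longrightarrow> y \<in> Obj (sk_cat (A x)) \<Longrightarrow> R x (on_obj (a x) y) = P (on_obj (u x) y)"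
  shows "\<exists>!h. sketch_mor D T' (test_sketch e) h \<and> sk_comp T h j = classify e T P \<and>
    (\<forall>x \<in> X. sk_comp (B x) h (k x) = classify e (B x) (R x))"
proof -
  have "sketch_mor D (B x) (test_sketch e) (classify e (B x) (R x)) \<and>
      sk_comp (A x) (classify e (B x) (R x)) (a x) = sk_comp (A x) (classify e T P) (u x)"
    if "x \<in> X" for x
    using that assms T A B a u
    by (intro conjI classify_mor classify_comp_eq) auto
  then have c: "\<forall>x \<in> X. sketch_mor D (B x) (test_sketch e) (classify e (B x) (R x)) \<and>
      sk_comp (A x) (classify e (B x) (R x)) (a x) = sk_comp (A x) (classify e T P) (u x)"
    by blast
  show ?thesis
    by (rule pushout[unfolded is_pushout_def, THEN conjunct2, THEN conjunct2, THEN conjunct2,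
          THEN spec[of _ "test_sketch e"], THEN spec[of _ "classify e T P"],
          THEN spec[of _ "\<lambda>x. classify e (B x) (R x)"], THEN mp, THEN mp, THEN mp,
          OF is_sketch_test[OF assms(1)] classify_mor[OF T assms(1)] c])
qed

text \<open>
  The universal property of a pushout of sets, for maps into the two-element set.
\<close>

lemma predicate_extends:
  fixes P :: "'e \<Rightarrow> bool" and R :: "'x \<Rightarrow> 'c \<Rightarrow> bool"
  assumes "\<And>x y. x \<in> X \<Longrightarrow> y \<in> Obj (sk_cat (A x)) \<Longrightarrow> R x (on_obj (a x) y) = P (on_obj (u x) y)"
  obtains H where "\<And>z. z \<in> Obj (sk_cat T) \<Longrightarrow> H (on_obj j z) = P z"
    "\<And>x z. x \<in> X \<Longrightarrow> z \<in> Obj (sk_cat (B x)) \<Longrightarrow> H (on_obj (k x) z) = R x z"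
proof -
  obtain e :: "cls \<times> bool \<Rightarrow> 'e" where e: "inj e"
    using test_objects_exist[OF inf] .
  obtain h where h: "sk_comp T h j = classify e T P"
      "\<forall>x \<in> X. sk_comp (B x) h (k x) = classify e (B x) (R x)"
    using predicate_universal[where R = R and P = P, OF e assms] by blast
  show ?thesis
  proof (rule that[of "\<lambda>z. snd (inv e (on_obj h z))"])
    fix z assume z: "z \<in> Obj (sk_cat T)"
    then have "on_obj h (on_obj j z) = on_obj (sk_comp T h j) z"
      by (simp add: comp_fun_def)
    then show "snd (inv e (on_obj h (on_obj j z))) = P z"
      using z e by (simp add: h(1) classify_obj)
  next
    fix x z assume x: "x \<in> X" and z: "z \<in> Obj (sk_cat (B x))"
    then have "on_obj h (on_obj (k x) z) = on_obj (sk_comp (B x) h (k x)) z"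
      by (simp add: comp_fun_def)
    then show "snd (inv e (on_obj h (on_obj (k x) z))) = R x z"
      using x z e h(2) by (simp add: classify_obj)
  qed
qed

text \<open>
  Otherwise membership in the right-hand side and the constantly true predicate would be two
  different morphisms to the test sketch that agree on \<open>T\<close> and on every \<open>B x\<close>.
\<close>

lemma objects_cover:
  "Obj (sk_cat T') = on_obj j ` Obj (sk_cat T) \<union> (\<Union>x \<in> X. on_obj (k x) ` Obj (sk_cat (B x)))"
    (is "_ = ?U")
proof
  show "?U \<subseteq> Obj (sk_cat T')"
    using functor_obj[OF j] functor_obj[OF k] by auto
  obtain e :: "cls \<times> bool \<Rightarrow> 'e" where e: "inj e"
    using test_objects_exist[OF inf] .
  have "sketch_mor D T' (test_sketch e) (classify e T' Q) \<and>
      sk_comp T (classify e T' Q) j = classify e T (\<lambda>_. True) \<and>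
      (\<forall>x \<in> X. sk_comp (B x) (classify e T' Q) (k x) = classify e (B x) (\<lambda>_. True))"
    if "\<And>z. z \<in> ?U \<Longrightarrow> Q z" for Q
    using that T B T' j k e by (intro conjI ballI classify_mor comp_classify) auto
  from this[of "\<lambda>z. z \<in> ?U"] this[of "\<lambda>_. True"]
  have eq: "classify e T' (\<lambda>z. z \<in> ?U) = classify e T' (\<lambda>_. True)"
    using predicate_universal[OF e, of "\<lambda>_ _. True" "\<lambda>_. True"] by blast
  show "Obj (sk_cat T') \<subseteq> ?U"
  proof
    fix z assume z: "z \<in> Obj (sk_cat T')"
    have "e (cls_of (sk_cat T') z, z \<in> ?U) = e (cls_of (sk_cat T') z, True)"
      using arg_cong[OF eq, of "\<lambda>F. on_obj F z"] unfolding classify_obj[OF z] .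
    then show "z \<in> ?U"
      using e by (simp add: inj_eq)
  qed
qed

text \<open>
  The objects in \<open>V x\<close> are those that \<open>B x\<close> has in addition to \<open>A x\<close>; the pushout adds a
  new copy of them for every \<open>x\<close>. Any two objects that should be different are separated by a
  predicate, which can be prescribed on \<open>T\<close> and on all \<open>V x\<close> independently.
\<close>

lemma objects_pushout:
  assumes inj: "\<And>x. x \<in> X \<Longrightarrow> inj_on (on_obj (a x)) (Obj (sk_cat (A x)))"
    and compl: "\<And>x. x \<in> X \<Longrightarrow> Obj (sk_cat (B x)) - V x = on_obj (a x) ` Obj (sk_cat (A x))"
    and V: "\<And>x. x \<in> X \<Longrightarrow> V x \<subseteq> Obj (sk_cat (B x))"
  shows "inj_on (on_obj j) (Obj (sk_cat T))"
    and "x \<in> X \<Longrightarrow> v \<in> V x \<Longrightarrow> on_obj (k x) v \<notin> on_obj j ` Obj (sk_cat T)"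
    and "x \<in> X \<Longrightarrow> x' \<in> X \<Longrightarrow> v \<in> V x \<Longrightarrow> v' \<in> V x' \<Longrightarrow> on_obj (k x) v = on_obj (k x') v'
      \<Longrightarrow> x = x' \<and> v = v'"
    and "Obj (sk_cat T') = on_obj j ` Obj (sk_cat T) \<union> (\<Union>x \<in> X. on_obj (k x) ` V x)"
proof -
  have ext: "\<exists>H. (\<forall>z \<in> Obj (sk_cat T). H (on_obj j z) = P z) \<and>
      (\<forall>x \<in> X. \<forall>v \<in> V x. H (on_obj (k x) v) = R x v)"
    for P :: "'e \<Rightarrow> bool" and R :: "'x \<Rightarrow> 'c \<Rightarrow> bool"
  proof -
    \<comment> \<open>on the image of \<open>A x\<close> the predicate is dictated by \<open>P\<close>\<close>
    define R' where "R' x z = (if z \<in> V x then R x z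
      else P (on_obj (u x) (inv_into (Obj (sk_cat (A x))) (on_obj (a x)) z)))" for x z
    have "R' x (on_obj (a x) y) = P (on_obj (u x) y)" if "x \<in> X" "y \<in> Obj (sk_cat (A x))" for x y
      using that compl[of x] inj[of x] by (auto simp: R'_def)
    then obtain H where H: "\<And>z. z \<in> Obj (sk_cat T) \<Longrightarrow> H (on_obj j z) = P z"
      and H': "\<And>x z. x \<in> X \<Longrightarrow> z \<in> Obj (sk_cat (B x)) \<Longrightarrow> H (on_obj (k x) z) = R' x z"
      using predicate_extends[of R' P] by blast
    have "H (on_obj (k x) v) = R x v" if "x \<in> X" "v \<in> V x" for x v
      using H'[of x v] that V by (auto simp: R'_def subset_iff)
    then show ?thesis
      using H by (intro exI[of _ H]) simp
  qed
  show "inj_on (on_obj j) (Obj (sk_cat T))"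
  proof (rule inj_onI)
    fix x y assume "x \<in> Obj (sk_cat T)" "y \<in> Obj (sk_cat T)" "on_obj j x = on_obj j y"
    then show "x = y"
      using ext[of "\<lambda>z. z = x" "\<lambda>_ _. True"] by metis
  qed
  show "on_obj (k x) v \<notin> on_obj j ` Obj (sk_cat T)" if "x \<in> X" "v \<in> V x"
    using ext[of "\<lambda>_. False" "\<lambda>_ _. True"] that by (metis imageE)
  show "x = x' \<and> v = v'"
    if "x \<in> X" "x' \<in> X" "v \<in> V x" "v' \<in> V x'" "on_obj (k x) v = on_obj (k x') v'"
    using ext[of "\<lambda>_. True" "\<lambda>y w. y = x \<and> w = v"] that by metis
  have B': "on_obj (k x) ` Obj (sk_cat (B x)) \<subseteq> on_obj j ` Obj (sk_cat T) \<union> on_obj (k x) ` V x"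
    if x: "x \<in> X" for x
  proof (rule image_subsetI)
    fix z assume z: "z \<in> Obj (sk_cat (B x))"
    show "on_obj (k x) z \<in> on_obj j ` Obj (sk_cat T) \<union> on_obj (k x) ` V x"
    proof (cases "z \<in> V x")
      case False
      then obtain y where y: "y \<in> Obj (sk_cat (A x))" "z = on_obj (a x) y"
        using z compl[OF x] by blast
      show ?thesis
        using square[OF x y(1)] functor_obj[OF u[OF x] y(1)] y(2) by simp
    qed simp
  qed
  show "Obj (sk_cat T') = on_obj j ` Obj (sk_cat T) \<union> (\<Union>x \<in> X. on_obj (k x) ` V x)"
    unfolding objects_cover
  proof (intro subset_antisym Un_least UN_least)
    fix x assume x: "x \<in> X"
    show "on_obj (k x) ` Obj (sk_cat (B x)) \<subseteq> on_obj j ` Obj (sk_cat T) \<union> (\<Union>x \<in> X. on_obj (k x) ` V x)"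
      using B'[OF x] x by auto
    show "on_obj (k x) ` V x \<subseteq> on_obj j ` Obj (sk_cat T) \<union> (\<Union>x \<in> X. on_obj (k x) ` Obj (sk_cat (B x)))"
      using V[OF x] x by auto
  qed auto
qed

lemma objects_pushout_bij:
  assumes "\<And>x. x \<in> X \<Longrightarrow> bij_betw (on_obj (a x)) (Obj (sk_cat (A x))) (Obj (sk_cat (B x)))"
  shows "bij_betw (on_obj j) (Obj (sk_cat T)) (Obj (sk_cat T'))"
  using objects_pushout(1,4)[of "\<lambda>_. {}"] assms by (simp add: bij_betw_def)

end

locale sketch_sequence = subterminal_doctrine D
  for D :: "('o, 'm, 'i) doctrine" +
  fixes T :: "nat \<Rightarrow> ('e, 'm, 'o, 'm, 'i) sketch" and t :: "nat \<Rightarrow> ('e, 'm, 'e, 'm) lnl_fun"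
    and L :: "('e, 'm, 'o, 'm, 'i) sketch" and l :: "nat \<Rightarrow> ('e, 'm, 'e, 'm) lnl_fun"
  assumes inf: "infinite (UNIV :: 'e set)"
    and colimit: "is_seq_colimit D T t L l"
    and T: "is_sketch D (T n)"
    and t: "is_functor (sk_cat (T n)) (sk_cat (T (Suc n))) (t n)"
    and inj_t: "inj_on (on_obj (t n)) (Obj (sk_cat (T n)))"
begin

lemma L: "is_sketch D L" and l: "is_functor (sk_cat (T n)) (sk_cat L) (l n)"
  using colimit by (auto simp: is_seq_colimit_def intro: sketch_mor_functor)

lemma l_t: "x \<in> Obj (sk_cat (T n)) \<Longrightarrow> on_obj (l (Suc n)) (on_obj (t n) x) = on_obj (l n) x"
proof -
  assume "x \<in> Obj (sk_cat (T n))"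
  then have "on_obj (l (Suc n)) (on_obj (t n) x) = on_obj (sk_comp (T n) (l (Suc n)) (t n)) x"
    by (simp add: comp_fun_def)
  also have "sk_comp (T n) (l (Suc n)) (t n) = l n"
    using colimit by (simp add: is_seq_colimit_def)
  finally show ?thesis .
qed

lemma predicate_universal:
  fixes e :: "cls \<times> bool \<Rightarrow> 'e"
  assumes "inj e"
    and "\<And>n x. x \<in> Obj (sk_cat (T n)) \<Longrightarrow> P (Suc n) (on_obj (t n) x) = P n x"
  shows "\<exists>!h. sketch_mor D L (test_sketch e) h \<and>
    (\<forall>n. sk_comp (T n) h (l n) = classify e (T n) (P n))"
proof -
  have "sketch_mor D (T n) (test_sketch e) (classify e (T n) (P n)) \<and>
      sk_comp (T n) (classify e (T (Suc n)) (P (Suc n))) (t n) = classify e (T n) (P n)" for n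
    using assms T t by (intro conjI classify_mor comp_classify) auto
  then have c: "\<forall>n. sketch_mor D (T n) (test_sketch e) (classify e (T n) (P n)) \<and>
      sk_comp (T n) (classify e (T (Suc n)) (P (Suc n))) (t n) = classify e (T n) (P n)"
    by blast
  show ?thesis
    by (rule colimit[unfolded is_seq_colimit_def, THEN conjunct2, THEN conjunct2,
          THEN spec[of _ "test_sketch e"], THEN spec[of _ "\<lambda>n. classify e (T n) (P n)"],
          THEN mp, THEN mp, OF is_sketch_test[OF assms(1)] c])
qed

lemma objects_cover: "Obj (sk_cat L) = (\<Union>n. on_obj (l n) ` Obj (sk_cat (T n)))" (is "_ = ?U")
proof
  show "?U \<subseteq> Obj (sk_cat L)"
    using functor_obj[OF l] by auto
  obtain e :: "cls \<times> bool \<Rightarrow> 'e" where e: "inj e"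
    using test_objects_exist[OF inf] .
  have "sketch_mor D L (test_sketch e) (classify e L Q) \<and>
      (\<forall>n. sk_comp (T n) (classify e L Q) (l n) = classify e (T n) (\<lambda>_. True))"
    if "\<And>z. z \<in> ?U \<Longrightarrow> Q z" for Q
    using that T L l e by (intro conjI allI classify_mor comp_classify) auto
  from this[of "\<lambda>z. z \<in> ?U"] this[of "\<lambda>_. True"]
  have eq: "classify e L (\<lambda>z. z \<in> ?U) = classify e L (\<lambda>_. True)"
    using predicate_universal[OF e, of "\<lambda>_ _. True"] by blast
  show "Obj (sk_cat L) \<subseteq> ?U"
  proof
    fix z assume z: "z \<in> Obj (sk_cat L)"
    have "e (cls_of (sk_cat L) z, z \<in> ?U) = e (cls_of (sk_cat L) z, True)"
      using arg_cong[OF eq, of "\<lambda>F. on_obj F z"] unfolding classify_obj[OF z] .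
    then show "z \<in> ?U"
      using e by (simp add: inj_eq)
  qed
qed

fun transport :: "nat \<Rightarrow> nat \<Rightarrow> 'e \<Rightarrow> 'e" where
  "transport n 0 x = x"
| "transport n (Suc d) x = on_obj (t (n + d)) (transport n d x)"

lemma transport_Obj: "x \<in> Obj (sk_cat (T n)) \<Longrightarrow> transport n d x \<in> Obj (sk_cat (T (n + d)))"
  by (induction d) (auto intro: functor_obj[OF t])

lemma transport_Suc: "transport (Suc n) d (on_obj (t n) x) = transport n (Suc d) x"
  by (induction d) auto

lemma transport_inj: "inj_on (transport n d) (Obj (sk_cat (T n)))"
proof (induction d)
  case (Suc d)
  show ?case
  proof (rule inj_onI)
    fix x y assume "x \<in> Obj (sk_cat (T n))" "y \<in> Obj (sk_cat (T n))" "transport n (Suc d) x = transport n (Suc d) y"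
    then show "x = y"
      using Suc inj_t transport_Obj unfolding inj_on_def by (metis transport.simps(2))
  qed
qed (simp add: inj_on_def)

text \<open>
  An object \<open>x\<close> of stage \<open>n\<close> is separated from the others by the predicate that an object of any
  stage eventually becomes equal to \<open>x\<close>. It is compatible with the transition functors, and since these
  are injective on objects, \<open>x\<close> is the only object of stage \<open>n\<close> that satisfies it.
\<close>

lemma objects_inj: "inj_on (on_obj (l n)) (Obj (sk_cat (T n)))"
proof (rule inj_onI)
  fix x y
  assume x: "x \<in> Obj (sk_cat (T n))" and y: "y \<in> Obj (sk_cat (T n))"
    and eq: "on_obj (l n) x = on_obj (l n) y"
  obtain e :: "cls \<times> bool \<Rightarrow> 'e" where e: "inj e"
    using test_objects_exist[OF inf] .
  \<comment> \<open>\<open>z\<close> and \<open>x\<close>, transported to a common stage, become equal\<close>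
  define P where "P m z \<longleftrightarrow> (\<exists>d d'. m + d = n + d' \<and> transport m d z = transport n d' x)" for m z
  have "P (Suc m) (on_obj (t m) z) = P m z" for m z
  proof
    assume "P (Suc m) (on_obj (t m) z)"
    then obtain d d' where "Suc m + d = n + d'" "transport (Suc m) d (on_obj (t m) z) = transport n d' x"
      by (auto simp: P_def)
    then show "P m z"
      unfolding P_def by (intro exI[of _ "Suc d"] exI[of _ d']) (simp add: transport_Suc del: transport.simps)
  next
    assume "P m z"
    then obtain d d' where d: "m + d = n + d'" "transport m d z = transport n d' x"
      by (auto simp: P_def)
    then have "transport (Suc m) d (on_obj (t m) z) = transport n (Suc d') x"
      unfolding transport_Suc by simp
    then show "P (Suc m) (on_obj (t m) z)"
      unfolding P_def using d(1) by (intro exI[of _ d] exI[of _ "Suc d'"]) simp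
  qed
  then obtain h where h: "\<And>n. sk_comp (T n) h (l n) = classify e (T n) (P n)"
    using predicate_universal[OF e, of P] by blast
  have "on_obj h (on_obj (l n) z) = e (cls_of (sk_cat (T n)) z, P n z)"
    if "z \<in> Obj (sk_cat (T n))" for z
    using arg_cong[OF h[of n], of "\<lambda>F. on_obj F z"] that
    by (simp add: classify_obj) (simp add: comp_fun_def)
  from this[OF x] this[OF y] have "P n x = P n y"
    using e eq by (simp add: inj_eq)
  moreover have "P n x"
    unfolding P_def by blast
  ultimately obtain d where "transport n d y = transport n d x"
    by (auto simp: P_def)
  then show "x = y"
    using transport_inj[of n d] x y by (auto simp: inj_on_def)
qed

lemma objects_bij:
  assumes "\<And>n. on_obj (t n) ` Obj (sk_cat (T n)) = Obj (sk_cat (T (Suc n)))"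
  shows "bij_betw (on_obj (l 0)) (Obj (sk_cat (T 0))) (Obj (sk_cat L))"
proof -
  have "on_obj (l n) ` Obj (sk_cat (T n)) = on_obj (l 0) ` Obj (sk_cat (T 0))" for n
  proof (induction n)
    case (Suc n)
    have "on_obj (l (Suc n)) ` Obj (sk_cat (T (Suc n))) = on_obj (l n) ` Obj (sk_cat (T n))"
      unfolding assms[symmetric] image_image by (auto simp: l_t)
    then show ?case using Suc by simp
  qed simp
  then show ?thesis
    using objects_inj unfolding bij_betw_def objects_cover by auto
qed

end

section \<open>The phases that are bijective on objects\<close>

lemma id_fun_bij: "bij_betw (on_obj (id_fun P)) (Obj P) (Obj P)"
  by (auto simp: id_fun_def intro!: bij_betwI')

lemma functor_id: "lnl_polycategory P \<Longrightarrow> is_functor P P (id_fun P)"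
  by (intro functor_inclusion) auto

lemma pre_hom_Hom:
  assumes C: "lnl_polycategory C" and X: "is_expansion C K ps X"
    and f: "pre_hom C K ps X \<Phi> f"
  shows "f \<in> Hom (ex_cat X) \<Phi>"
proof -
  interpret X: lnl_polycategory "ex_cat X"
    using X by (simp add: is_expansion_def)
  have F: "is_functor C (ex_cat X) (ex_incl X)" and obj: "on_obj (ex_incl X) = (\<lambda>A \<in> Obj C. Inl A)"
    and \<chi>: "ex_chi X \<in> Hom (ex_cat X) (apfst Inl (flip K) # new_list ps)"
    using X by (simp_all add: is_expansion_def)
  have incl: "on_hom (ex_incl X) \<Phi> f \<in> Hom (ex_cat X) (smap Inl \<Phi>)" if f: "f \<in> Hom C \<Phi>" for \<Phi> f
  proof -
    have "smap (on_obj (ex_incl X)) \<Phi> = smap Inl \<Phi>"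
      using adm_list_objs[OF lnl_polycategory.Hom_adm[OF C f]]
      by (intro map_cong) (auto simp: obj)
    then show ?thesis
      using functor_hom[OF F f] by (simp only:)
  qed
  show ?thesis
    using f
  proof induction
    case (tilde \<Phi> f)
    then have "f \<in> Hom C (\<Phi> @ [K])"
      by (simp add: abstract_projection_def)
    then show ?case
      using incl[of f "\<Phi> @ [K]"] \<chi> unfolding ex_tilde_def
      by (intro X.Cmp_in) (simp_all add: flip_apfst)
  qed (auto intro: incl X.Idn_in X.Act_in X.Cmp_in)
qed

lemma lnl_polycategory_pre_expansion:
  assumes C: "lnl_polycategory C" and X: "is_expansion C K ps X"
  shows "lnl_polycategory (pre_expansion C K ps X)"
proof (rule lnl_polycategory_sub)
  show X': "lnl_polycategory (ex_cat X)"
    using X by (simp add: is_expansion_def)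
  interpret X: lnl_polycategory "ex_cat X" by (rule X')
  show "fst ` set \<Phi> \<subseteq> Obj (pre_expansion C K ps X)" if "f \<in> Hom (pre_expansion C K ps X) \<Phi>" for f \<Phi>
    using that adm_list_objs[OF X.Hom_adm] pre_hom_Hom[OF C X] by (fastforce simp: pre_expansion_def)
qed (use pre_hom_Hom[OF C X] in
  \<open>auto simp: pre_expansion_def adm_list_def intro: pre_hom.idn pre_hom.act pre_hom.cmp\<close>)

context subterminal_doctrine
begin

lemma is_sketch_expansion:
  assumes X: "is_expansion (cone D i) K ps X" and G: "is_functor (ex_cat X) (base D) G"
  shows "is_sketch D (exp_sketch i X G)"
  using X G by (intro is_sketchI) (auto simp: exp_sketch_def is_expansion_def split: if_splits)

lemma is_sketch_iso:
  assumes "i \<in> cones D"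
  shows "is_sketch D (iso_sketch D i)"
proof (rule is_sketchI)
  note C = cone_polycategory[OF assms] cone_vertex[OF assms]
  show "lnl_polycategory (sk_cat (iso_sketch D i))"
    using lnl_polycategory_iso_cone[OF C] by (simp add: iso_sketch_def Let_def)
  show "is_functor (sk_cat (iso_sketch D i)) (base D) (sk_proj (iso_sketch D i))"
    using functor_comp[OF functor_collapse[OF C] cone_functor[OF assms] lnl_polycategory_iso_cone[OF C]]
    by (simp add: iso_sketch_def Let_def)
  show "is_functor (cone D i') (sk_cat (iso_sketch D i)) F"
    if "i' \<in> cones D" "F \<in> sk_ext (iso_sketch D i) i'" for i' F
    using that functor_iso_section[OF C] by (auto simp: iso_sketch_def Let_def split: if_splits)
qed

text \<open>
  The third phase changes proto-extremal lifts only: both sketches on the cone with doubled vertex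
  have the same underlying polycategory.
\<close>

lemma phase3_objects:
  fixes S L :: "('o, 'm, 'o, 'm, 'i) sketch"
  assumes inf: "infinite (UNIV :: 'o set)" and S: "is_sketch D S" and "phase3 D S L"
  obtains j where "is_functor (sk_cat S) (sk_cat L) j"
    "bij_betw (on_obj j) (Obj (sk_cat S)) (Obj (sk_cat L))"
proof -
  let ?X = "{(i, u). i \<in> cones D \<and> sketch_mor D (iso_sketch' D i) S u}"
  obtain j k where po: "is_pushout D ?X (\<lambda>(i, u). iso_sketch' D i) (\<lambda>(i, u). iso_sketch D i)
      (\<lambda>(i, u). id_fun (iso_cone (cone D i) (vertex D i))) (\<lambda>(i, u). u) S L j k"
    using assms(3) unfolding phase3_def by blast
  have cat: "sk_cat (iso_sketch' D i) = iso_cone (cone D i) (vertex D i)"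
    "sk_cat (iso_sketch D i) = iso_cone (cone D i) (vertex D i)" for i
    by (simp_all add: iso_sketch'_def iso_sketch_def Let_def)
  interpret sketch_pushout D ?X "\<lambda>(i, u). iso_sketch' D i" "\<lambda>(i, u). iso_sketch D i"
    "\<lambda>(i, u). id_fun (iso_cone (cone D i) (vertex D i))" "\<lambda>(i, u). u" S L j k
  proof (rule sketch_pushout.intro[OF subterminal_doctrine_axioms], rule sketch_pushout_axioms.intro)
    show "infinite (UNIV :: 'o set)" "is_sketch D S" by fact+
    show "is_pushout D ?X (\<lambda>(i, u). iso_sketch' D i) (\<lambda>(i, u). iso_sketch D i)
      (\<lambda>(i, u). id_fun (iso_cone (cone D i) (vertex D i))) (\<lambda>(i, u). u) S L j k"
      by (rule po)
  next
    fix x assume "x \<in> ?X"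
    then obtain i u where x: "x = (i, u)" and i: "i \<in> cones D" and u: "sketch_mor D (iso_sketch' D i) S u"
      by auto
    note P = lnl_polycategory_iso_cone[OF cone_polycategory[OF i] cone_vertex[OF i]]
    show "lnl_polycategory (sk_cat (case x of (i, u) \<Rightarrow> iso_sketch' D i))"
      "is_sketch D (case x of (i, u) \<Rightarrow> iso_sketch D i)"
      "is_functor (sk_cat (case x of (i, u) \<Rightarrow> iso_sketch' D i))
        (sk_cat (case x of (i, u) \<Rightarrow> iso_sketch D i))
        (case x of (i, u) \<Rightarrow> id_fun (iso_cone (cone D i) (vertex D i)))"
      "is_functor (sk_cat (case x of (i, u) \<Rightarrow> iso_sketch' D i)) (sk_cat S) (case x of (i, u) \<Rightarrow> u)"
      using P functor_id[OF P] sketch_mor_functor[OF u] is_sketch_iso[OF i] by (simp_all add: x cat)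
  qed
  show ?thesis
    by (rule that[OF j objects_pushout_bij]) (auto simp: cat id_fun_bij)
qed

text \<open>
  The first coprojection of the pushout \<open>W\<close> is bijective on objects, because a pre-expansion has the same
  objects as its expansion; the codiagonal is a retraction of it.
\<close>

lemma codiagonal_objects:
  fixes W :: "('o + nat, 'm, 'o, 'm, 'i) sketch"
  assumes i: "i \<in> cones D" and X: "is_expansion (cone D i) (vertex D i) ps X"
    and G: "is_functor (ex_cat X) (base D) G" and cod: "is_codiagonal D i ps X G W c"
  shows "is_sketch D W" and "is_functor (sk_cat W) (ex_cat X) c"
    and "bij_betw (on_obj c) (Obj (sk_cat W)) (Obj (ex_cat X))"
proof -
  define A where "A = pre_exp_sketch D i ps X G"
  define B where "B = exp_sketch i X G"
  have catA: "sk_cat A = pre_expansion (cone D i) (vertex D i) ps X" and catB: "sk_cat B = ex_cat X"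
    by (simp_all add: A_def B_def pre_exp_sketch_def exp_sketch_def Let_def)
  obtain j k where po: "is_pushout D {()} (\<lambda>_. A) (\<lambda>_. B) (\<lambda>_. id_fun (sk_cat A))
      (\<lambda>_. id_fun (sk_cat A)) B W j (\<lambda>_. k)" and c: "sketch_mor D W B c"
    and cj: "sk_comp B c j = id_fun (sk_cat B)"
    using cod unfolding is_codiagonal_def Let_def A_def B_def by blast
  have PA: "lnl_polycategory (sk_cat A)"
    unfolding catA by (rule lnl_polycategory_pre_expansion[OF cone_polycategory[OF i] X])
  have a: "is_functor (sk_cat A) (sk_cat B) (id_fun (sk_cat A))"
    using pre_hom_Hom[OF cone_polycategory[OF i] X]
    by (intro functor_inclusion PA) (auto simp: catA catB pre_expansion_def)
  have "infinite (UNIV :: ('o + nat) set)"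
    by simp
  then interpret sketch_pushout D "{()}" "\<lambda>_. A" "\<lambda>_. B" "\<lambda>_. id_fun (sk_cat A)"
    "\<lambda>_. id_fun (sk_cat A)" B W j "\<lambda>_. k"
    using po PA a is_sketch_expansion[OF X G]
    by (intro sketch_pushout.intro[OF subterminal_doctrine_axioms] sketch_pushout_axioms.intro)
      (simp_all add: B_def)
  have ObjA: "Obj (sk_cat A) = Obj (sk_cat B)"
    by (simp add: catA catB pre_expansion_def)
  have j_bij: "bij_betw (on_obj j) (Obj (sk_cat B)) (Obj (sk_cat W))"
    using id_fun_bij[of "sk_cat A"] by (intro objects_pushout_bij) (simp add: ObjA)
  have "on_obj c (on_obj j x) = x" if "x \<in> Obj (sk_cat B)" for x
    using arg_cong[OF cj, of "\<lambda>F. on_obj F x"] that by (simp add: comp_fun_def id_fun_def)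
  then have "bij_betw (on_obj c \<circ> on_obj j) (Obj (sk_cat B)) (Obj (sk_cat B))"
    by (auto intro!: bij_betwI')
  then show "bij_betw (on_obj c) (Obj (sk_cat W)) (Obj (ex_cat X))"
    using j_bij bij_betw_comp_iff catB by metis
  show "is_sketch D W"
    by (rule T')
  show "is_functor (sk_cat W) (ex_cat X) c"
    using sketch_mor_functor[OF c] by (simp add: catB)
qed

text \<open>
  Every pushout of the second phase is along functors that are bijective on objects, namely
  inclusions of pre-expansions and codiagonals.
\<close>

lemma phase2_objects:
  fixes S L :: "('o, 'm, 'o, 'm, 'i) sketch"
  assumes inf: "infinite (UNIV :: 'o set)" and S: "is_sketch D S" and "phase2 D S L"
  obtains j where "is_sketch D L" "is_functor (sk_cat S) (sk_cat L) j"
    "bij_betw (on_obj j) (Obj (sk_cat S)) (Obj (sk_cat L))"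
proof -
  obtain X W c T t l where
    X: "\<forall>i \<in> cones D. \<forall>ps. shape_ok (cone D i) (vertex D i) ps \<longrightarrow>
           is_expansion (cone D i) (vertex D i) ps (X i ps)" and
    cod: "\<forall>(i, ps, G) \<in> exp_indices D X.
           is_codiagonal D i ps (X i ps) G (W (i, ps, G)) (c (i, ps, G))" and
    T0: "T 0 = S" and
    po: "\<forall>n. \<exists>k. is_pushout D (exp_maps D X W (T n))
                   (\<lambda>(b, (i, ps, G), u).
                      if b then pre_exp_sketch D i ps (X i ps) G else W (i, ps, G))
                   (\<lambda>(b, (i, ps, G), u). exp_sketch i (X i ps) G)
                   (\<lambda>(b, (i, ps, G), u).
                      if b then id_fun (pre_expansion (cone D i) (vertex D i) ps (X i ps))
                      else c (i, ps, G))
                   (\<lambda>(b, e, u). u)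
                   (T n) (T (Suc n)) (t n) k" and
    col: "is_seq_colimit D T t L l"
    using assms(3) unfolding phase2_def by (elim exE conjE) (rule that)
  have T: "is_sketch D (T n)" for n
    using spec[OF po, of "n - 1"] S T0 by (cases n) (auto simp: is_pushout_def)
  have step: "is_functor (sk_cat (T n)) (sk_cat (T (Suc n))) (t n) \<and>
      bij_betw (on_obj (t n)) (Obj (sk_cat (T n))) (Obj (sk_cat (T (Suc n))))" for n
  proof -
    define A where "A = (\<lambda>(b, (i, ps, G), u :: ('o + nat, 'm, 'o, 'm) lnl_fun).
      if b then pre_exp_sketch D i ps (X i ps) G else W (i, ps, G))"
    define B where "B = (\<lambda>(b :: bool, (i, ps :: shape, G), u :: ('o + nat, 'm, 'o, 'm) lnl_fun).
      exp_sketch i (X i ps) G :: ('o + nat, 'm, 'o, 'm, 'i) sketch)"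
    define a where "a = (\<lambda>(b, (i, ps, G), u :: ('o + nat, 'm, 'o, 'm) lnl_fun).
      if b then id_fun (pre_expansion (cone D i) (vertex D i) ps (X i ps)) else c (i, ps, G))"
    define up where "up = (\<lambda>(b :: bool, e :: 'i \<times> shape \<times> ('o + nat, 'm, 'o, 'm) lnl_fun,
      u :: ('o + nat, 'm, 'o, 'm) lnl_fun). u)"
    obtain k where k: "is_pushout D (exp_maps D X W (T n)) A B a up (T n) (T (Suc n)) (t n) k"
      using spec[OF po, of n] unfolding A_def B_def a_def up_def by blast
    have all: "lnl_polycategory (sk_cat (A x)) \<and> is_sketch D (B x) \<and>
        is_functor (sk_cat (A x)) (sk_cat (B x)) (a x) \<and>
        bij_betw (on_obj (a x)) (Obj (sk_cat (A x))) (Obj (sk_cat (B x))) \<and>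
        is_functor (sk_cat (A x)) (sk_cat (T n)) (up x)" if "x \<in> exp_maps D X W (T n)" for x
    proof -
      obtain b i ps G u where x: "x = (b, (i, ps, G), u)"
        by (metis prod.exhaust)
      have idx: "(i, ps, G) \<in> exp_indices D X"
        using that by (auto simp: exp_maps_def x)
      have i: "i \<in> cones D" and G: "is_functor (ex_cat (X i ps)) (base D) G"
        and Xi: "is_expansion (cone D i) (vertex D i) ps (X i ps)"
        using idx X by (auto simp: exp_indices_def)
      have catB: "sk_cat (B x) = ex_cat (X i ps)"
        by (simp add: B_def x exp_sketch_def)
      have B: "is_sketch D (B x)"
        using is_sketch_expansion[OF Xi G] by (simp add: B_def x)
      show ?thesis
      proof (cases b)
        case True
        define E where "E = pre_expansion (cone D i) (vertex D i) ps (X i ps)"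
        have catA: "sk_cat (A x) = E"
          by (simp add: A_def x True pre_exp_sketch_def Let_def E_def)
        have PE: "lnl_polycategory E"
          unfolding E_def by (rule lnl_polycategory_pre_expansion[OF cone_polycategory[OF i] Xi])
        have "is_functor E (ex_cat (X i ps)) (id_fun E)"
          using pre_hom_Hom[OF cone_polycategory[OF i] Xi]
          by (intro functor_inclusion PE) (auto simp: E_def pre_expansion_def)
        moreover have "Obj E = Obj (ex_cat (X i ps))"
          by (simp add: E_def pre_expansion_def)
        moreover have "sketch_mor D (A x) (T n) (up x)"
          using that by (auto simp: exp_maps_def x True A_def up_def)
        moreover have "a x = id_fun E"
          by (simp add: a_def x True E_def)
        ultimately show ?thesis
          using B PE id_fun_bij[of E] sketch_mor_functor[of "A x" "T n" "up x"]
          by (simp add: catA catB)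
      next
        case False
        have "A x = W (i, ps, G)" "a x = c (i, ps, G)"
          by (simp_all add: A_def a_def x False)
        moreover have "sketch_mor D (W (i, ps, G)) (T n) (up x)"
          using that by (auto simp: exp_maps_def x False up_def)
        ultimately show ?thesis
          using B codiagonal_objects[OF i Xi G bspec[OF cod idx, simplified]] sketch_mor_functor[of _ _ "up x"]
            is_sketchD(1)[of "W (i, ps, G)"]
          by (simp add: catB)
      qed
    qed
    interpret sketch_pushout D "exp_maps D X W (T n)" A B a up "T n" "T (Suc n)" "t n" k
      using inf k T all
      by (intro sketch_pushout.intro[OF subterminal_doctrine_axioms] sketch_pushout_axioms.intro) auto
    show ?thesis
      using j objects_pushout_bij all by blast
  qed
  interpret sketch_sequence D T t L l
    using inf col T step
    by (intro sketch_sequence.intro[OF subterminal_doctrine_axioms] sketch_sequence_axioms.intro)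
      (auto simp: bij_betw_def)
  show ?thesis
    using that[OF L, of "l 0"] l[of 0] objects_bij step by (simp add: T0 bij_betw_def)
qed

end

section \<open>The phase that adds objects\<close>

lemma incseq_finite_subset:
  assumes "mono (\<Lambda> :: nat \<Rightarrow> 'a set)" "finite X" "X \<subseteq> (\<Union>n. \<Lambda> n)"
  shows "\<exists>n. X \<subseteq> \<Lambda> n"
  using assms(2,3)
proof (induction X)
  case (insert x X)
  then obtain m n where "x \<in> \<Lambda> m" "X \<subseteq> \<Lambda> n"
    by auto
  then have "insert x X \<subseteq> \<Lambda> (max m n)"
    using monoD[OF assms(1), of m "max m n"] monoD[OF assms(1), of n "max m n"] by auto
  then show ?case ..
qed simp

definition valid_args ::
  "('o, 'm, 'i) doctrine \<Rightarrow> ('i \<Rightarrow> 'o list) \<Rightarrow> ('e, 'n) lnl \<Rightarrow> 'i \<Rightarrow> 'e list \<Rightarrow> bool" where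
  "valid_args D ord Q i xs \<longleftrightarrow> i \<in> cones D \<and> length xs = length (ord i) \<and>
     (\<forall>j < length (ord i). xs ! j \<in> Obj Q \<and> cls_of Q (xs ! j) = cls_of (cone D i) (ord i ! j))"

text \<open>
  The stages \<open>T n\<close> of the first phase, with transition functors \<open>t n\<close>, the copies \<open>k n (i, u)\<close> of the
  cones attached at stage \<open>n\<close>, and the colimit \<open>L\<close>.
\<close>

locale cone_tower = subterminal_doctrine D
  for D :: "('o, 'm, 'i) doctrine" +
  fixes T :: "nat \<Rightarrow> ('o, 'm, 'o, 'm, 'i) sketch" and t :: "nat \<Rightarrow> ('o, 'm, 'o, 'm) lnl_fun"
    and k :: "nat \<Rightarrow> 'i \<times> ('o, 'm, 'o, 'm) lnl_fun \<Rightarrow> ('o, 'm, 'o, 'm) lnl_fun"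
    and L :: "('o, 'm, 'o, 'm, 'i) sketch" and l :: "nat \<Rightarrow> ('o, 'm, 'o, 'm) lnl_fun"
    and ord :: "'i \<Rightarrow> 'o list"
  assumes inf: "infinite (UNIV :: 'o set)"
    and discrete: "i \<in> cones D \<Longrightarrow> discrete_cone (cone D i) (vertex D i)"
    and ord: "orders_reducts D ord"
    and T0: "is_sketch D (T 0)"
    and po: "is_pushout D (cone_maps D T t n)
      (\<lambda>(i, u). reduct_sketch D i) (\<lambda>(i, u). cone_sketch D i)
      (\<lambda>(i, u). id_fun (reduct (cone D i) (vertex D i))) (\<lambda>(i, u). u)
      (T n) (T (Suc n)) (t n) (k n)"
    and colimit: "is_seq_colimit D T t L l"
begin

abbreviation Objs :: "nat \<Rightarrow> 'o set" where
  "Objs n \<equiv> Obj (sk_cat (T n))"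

abbreviation red :: "'i \<Rightarrow> ('o, 'm) lnl" where
  "red i \<equiv> reduct (cone D i) (vertex D i)"

lemma T: "is_sketch D (T n)"
  using T0 po[of "n - 1"] by (cases n) (auto simp: is_pushout_def)

lemma red_cat: "sk_cat (reduct_sketch D i) = red i"
  by (simp add: reduct_sketch_def plain_sketch_def Let_def)

lemma red_polycategory: "i \<in> cones D \<Longrightarrow> lnl_polycategory (red i)"
  by (intro lnl_polycategory_reduct cone_polycategory)

lemma red_functor: "i \<in> cones D \<Longrightarrow> is_functor (red i) (cone D i) (id_fun (red i))"
  by (intro functor_inclusion red_polycategory) (auto simp: reduct_def)

lemma red_Obj: "i \<in> cones D \<Longrightarrow> Obj (red i) = set (ord i)"
  using ord by (simp add: orders_reducts_def)

lemma red_cls: "cls_of (red i) = cls_of (cone D i)"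
  by (simp add: reduct_def)

lemma red_sketch: "i \<in> cones D \<Longrightarrow> is_sketch D (reduct_sketch D i)"
  using red_polycategory functor_comp[OF red_functor cone_functor red_polycategory]
  by (intro is_sketchI) (simp_all add: reduct_sketch_def plain_sketch_def Let_def)

lemma cone_maps_functor:
  assumes "(i, u) \<in> cone_maps D T t n"
  shows "i \<in> cones D" "is_functor (red i) (sk_cat (T n)) u"
  using assms by (auto simp: cone_maps_def red_cat[symmetric] intro: sketch_mor_functor)

lemma pushout_step: "sketch_pushout D (cone_maps D T t n)
    (\<lambda>(i, u). reduct_sketch D i) (\<lambda>(i, u). cone_sketch D i)
    (\<lambda>(i, u). id_fun (red i)) (\<lambda>(i, u). u) (T n) (T (Suc n)) (t n) (k n)"
proof (rule sketch_pushout.intro[OF subterminal_doctrine_axioms], rule sketch_pushout_axioms.intro)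
  fix x assume "x \<in> cone_maps D T t n"
  then obtain i u where x: "x = (i, u)" "(i, u) \<in> cone_maps D T t n"
    by (cases x) auto
  note i = cone_maps_functor[OF x(2)]
  have "is_sketch D (cone_sketch D i)"
    using cone_polycategory[OF i(1)] cone_functor[OF i(1)] functor_id
    by (intro is_sketchI) (auto simp: cone_sketch_def split: if_splits)
  then show "lnl_polycategory (sk_cat (case x of (i, u) \<Rightarrow> reduct_sketch D i))"
    "is_sketch D (case x of (i, u) \<Rightarrow> cone_sketch D i)"
    "is_functor (sk_cat (case x of (i, u) \<Rightarrow> reduct_sketch D i))
      (sk_cat (case x of (i, u) \<Rightarrow> cone_sketch D i)) (case x of (i, u) \<Rightarrow> id_fun (red i))"
    "is_functor (sk_cat (case x of (i, u) \<Rightarrow> reduct_sketch D i)) (sk_cat (T n)) (case x of (i, u) \<Rightarrow> u)"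
    using i red_polycategory[OF i(1)] red_functor[OF i(1)]
    by (simp_all add: x red_cat) (simp add: cone_sketch_def)
qed (fact inf po T)+

definition new_obj :: "nat \<Rightarrow> 'i \<Rightarrow> ('o, 'm, 'o, 'm) lnl_fun \<Rightarrow> 'o" where
  "new_obj n i u = on_obj (k n (i, u)) (fst (vertex D i))"

lemma stage_functor: "is_functor (sk_cat (T n)) (sk_cat (T (Suc n))) (t n)"
  by (rule sketch_pushout.j[OF pushout_step])

text \<open>
  A cone has just one object outside its reduct, the vertex, so each diagram contributes one new
  object.
\<close>

lemma stage_objects:
  shows stage_inj: "inj_on (on_obj (t n)) (Objs n)"
    and new_obj_fresh: "(i, u) \<in> cone_maps D T t n \<Longrightarrow> new_obj n i u \<notin> on_obj (t n) ` Objs n"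
    and new_obj_inj: "\<lbrakk>(i, u) \<in> cone_maps D T t n; (i', u') \<in> cone_maps D T t n;
      new_obj n i u = new_obj n i' u'\<rbrakk> \<Longrightarrow> i = i' \<and> u = u'"
    and stage_cover: "Objs (Suc n)
      = on_obj (t n) ` Objs n \<union> {new_obj n i u | i u. (i, u) \<in> cone_maps D T t n}"
proof -
  let ?V = "\<lambda>(i, u :: ('o, 'm, 'o, 'm) lnl_fun). {fst (vertex D i)}"
  have inj: "inj_on (on_obj (case x of (i, u) \<Rightarrow> id_fun (red i)))
      (Obj (sk_cat (case x of (i, u) \<Rightarrow> reduct_sketch D i)))"
    and B: "Obj (sk_cat (case x of (i, u) \<Rightarrow> cone_sketch D i)) - ?V x
      = on_obj (case x of (i, u) \<Rightarrow> id_fun (red i)) ` Obj (sk_cat (case x of (i, u) \<Rightarrow> reduct_sketch D i))"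
    and V: "?V x \<subseteq> Obj (sk_cat (case x of (i, u) \<Rightarrow> cone_sketch D i))"
    if "x \<in> cone_maps D T t n" for x
  proof -
    obtain i u where iu: "x = (i, u)"
      by (cases x)
    then have x: "x = (i, u)" "i \<in> cones D"
      using that cone_maps_functor(1) by blast+
    have "bij_betw (on_obj (id_fun (red i))) (Obj (red i)) (Obj (red i))"
      by (rule id_fun_bij)
    then show "inj_on (on_obj (case x of (i, u) \<Rightarrow> id_fun (red i)))
        (Obj (sk_cat (case x of (i, u) \<Rightarrow> reduct_sketch D i)))"
      "Obj (sk_cat (case x of (i, u) \<Rightarrow> cone_sketch D i)) - ?V x
      = on_obj (case x of (i, u) \<Rightarrow> id_fun (red i)) ` Obj (sk_cat (case x of (i, u) \<Rightarrow> reduct_sketch D i))"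
      "?V x \<subseteq> Obj (sk_cat (case x of (i, u) \<Rightarrow> cone_sketch D i))"
      using cone_vertex[OF x(2)]
      by (simp_all add: x red_cat bij_betw_def) (simp_all add: cone_sketch_def reduct_def)
  qed
  note o = sketch_pushout.objects_pushout[OF pushout_step, of n ?V, OF inj B V]
  show "inj_on (on_obj (t n)) (Objs n)"
    by (rule o(1))
  show "new_obj n i u \<notin> on_obj (t n) ` Objs n" if "(i, u) \<in> cone_maps D T t n"
    unfolding new_obj_def by (rule o(2)[OF _ _ _ that]) auto
  show "i = i' \<and> u = u'" if "(i, u) \<in> cone_maps D T t n" "(i', u') \<in> cone_maps D T t n"
      "new_obj n i u = new_obj n i' u'"
    using o(3)[OF _ _ _ that(1,2) _ _ that(3)[unfolded new_obj_def]] by auto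
  show "Objs (Suc n) = on_obj (t n) ` Objs n \<union> {new_obj n i u | i u. (i, u) \<in> cone_maps D T t n}"
  proof -
    have "Objs (Suc n) = on_obj (t n) ` Objs n
        \<union> (\<Union>x \<in> cone_maps D T t n. on_obj (k n x) ` ?V x)"
      by (rule o(4))
    then show ?thesis
      by (auto simp: new_obj_def)
  qed
qed

end

sublocale cone_tower \<subseteq> seq: sketch_sequence D T t L l
  using inf colimit T stage_functor stage_inj
  by (intro sketch_sequence.intro[OF subterminal_doctrine_axioms] sketch_sequence_axioms.intro)

context cone_tower
begin

text \<open>
  The objects of all stages are compared inside the colimit, where stages become subsets.
\<close>

definition level :: "nat \<Rightarrow> 'o set" where
  "level n = on_obj (l n) ` Objs n"

lemma level_mono: "mono level"
  unfolding mono_iff_le_Suc level_def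
proof (intro allI image_subsetI)
  fix n x assume x: "x \<in> Objs n"
  show "on_obj (l n) x \<in> on_obj (l (Suc n)) ` Objs (Suc n)"
    using seq.l_t[OF x] functor_obj[OF stage_functor x] by (metis imageI)
qed

lemma level_cover: "Obj (sk_cat L) = (\<Union>n. level n)"
  unfolding level_def by (rule seq.objects_cover)

text \<open>
  By discreteness a diagram is the same as the list of its values on the objects of the reduct.
\<close>

definition args :: "nat \<Rightarrow> 'i \<Rightarrow> ('o, 'm, 'o, 'm) lnl_fun \<Rightarrow> 'o list" where
  "args n i u = map (\<lambda>r. on_obj (l n) (on_obj u r)) (ord i)"

lemma args_eq_iff:
  assumes "i \<in> cones D"
    and "is_functor (red i) (sk_cat (T n)) u" "is_functor (red i) (sk_cat (T n)) v"
  shows "args n i u = args n i v \<longleftrightarrow> u = v"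
proof
  assume eq: "args n i u = args n i v"
  show "u = v"
  proof (rule functor_discrete_eq[OF discrete[OF assms(1)] assms(2,3) red_polycategory[OF assms(1)]])
    fix r assume r: "r \<in> Obj (red i)"
    then have "on_obj (l n) (on_obj u r) = on_obj (l n) (on_obj v r)"
      using eq red_Obj[OF assms(1)] by (simp add: args_def)
    then show "on_obj u r = on_obj v r"
      using inj_onD[OF seq.objects_inj] functor_obj[OF assms(2) r] functor_obj[OF assms(3) r] by blast
  qed
qed simp

lemma args_level:
  assumes "i \<in> cones D" "is_functor (red i) (sk_cat (T n)) u"
  shows "set (args n i u) \<subseteq> level n"
  using functor_obj[OF assms(2)] red_Obj[OF assms(1)] by (auto simp: args_def level_def)

lemma args_valid:
  assumes "i \<in> cones D" and u: "is_functor (red i) (sk_cat (T n)) u"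
  shows "valid_args D ord (sk_cat L) i (args n i u)"
  using assms functor_obj[OF u] functor_cls[OF u] red_Obj[OF assms(1)]
  by (auto simp: valid_args_def args_def red_cls functor_obj[OF seq.l] functor_cls[OF seq.l])

text \<open>
  The arguments are lifted to stage \<open>n\<close> one by one; discreteness turns the resulting object function
  into a functor.
\<close>

lemma args_exist:
  assumes xs: "valid_args D ord (sk_cat L) i xs" and sub: "set xs \<subseteq> level n"
  obtains u where "sketch_mor D (reduct_sketch D i) (T n) u" "args n i u = xs"
proof -
  have i: "i \<in> cones D" and len: "length xs = length (ord i)" and dist: "distinct (ord i)"
    using xs ord by (auto simp: valid_args_def orders_reducts_def)
  define g where "g r = inv_into (Objs n) (on_obj (l n)) (the (map_of (zip (ord i) xs) r))" for r
  have g: "g (ord i ! j) \<in> Objs n \<and> on_obj (l n) (g (ord i ! j)) = xs ! j"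
    if "j < length (ord i)" for j
  proof -
    have "map_of (zip (ord i) xs) (ord i ! j) = Some (xs ! j)"
      using that len dist by (intro map_of_zip_nth) auto
    moreover have "xs ! j \<in> on_obj (l n) ` Objs n"
      using that len sub by (auto simp: level_def[symmetric])
    ultimately show ?thesis
      by (simp add: g_def inv_into_into f_inv_into_f)
  qed
  have "g r \<in> Objs n \<and> cls_of (sk_cat (T n)) (g r) = cls_of (cone D i) r" if "r \<in> Obj (red i)" for r
  proof -
    obtain j where j: "j < length (ord i)" "r = ord i ! j"
      using \<open>r \<in> Obj (red i)\<close> red_Obj[OF i] by (auto simp: in_set_conv_nth)
    then have "cls_of (sk_cat (T n)) (g r) = cls_of (sk_cat L) (xs ! j)"
      using g functor_cls[OF seq.l, of "g r" n] by simp
    then show ?thesis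
      using g j xs by (simp add: valid_args_def)
  qed
  then obtain u where u: "is_functor (red i) (sk_cat (T n)) u"
    and ug: "\<And>r. r \<in> Obj (red i) \<Longrightarrow> on_obj u r = g r"
    using functor_discrete_exists[OF cone_polycategory[OF i] discrete[OF i] is_sketchD(1)[OF T]]
    by metis
  have "sketch_mor D (reduct_sketch D i) (T n) u"
    using u by (intro sketch_morI red_sketch i T)
      (auto simp: red_cat, auto simp: reduct_sketch_def plain_sketch_def Let_def)
  moreover have "args n i u = xs"
    using ug g len red_Obj[OF i] by (intro nth_equalityI) (auto simp: args_def)
  ultimately show ?thesis
    using that by blast
qed

text \<open>
  This is what the exclusion of diagrams that factor through the previous stage achieves: if all
  arguments were present at an earlier stage, they would form a diagram at stage \<open>n - 1\<close>, which
  exists by discreteness and through which \<open>u\<close> would factor.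
\<close>

lemma cone_maps_least:
  assumes "(i, u) \<in> cone_maps D T t n" "m < n"
  shows "\<not> set (args n i u) \<subseteq> level m"
proof
  assume "set (args n i u) \<subseteq> level m"
  moreover have "level m \<subseteq> level (n - 1)"
    using assms(2) by (intro monoD[OF level_mono]) simp
  ultimately have sub: "set (args n i u) \<subseteq> level (n - 1)"
    by blast
  note i = cone_maps_functor[OF assms(1)]
  obtain v where v: "sketch_mor D (reduct_sketch D i) (T (n - 1)) v" and eq: "args (n - 1) i v = args n i u"
    using args_exist[OF args_valid[OF i] sub] .
  have n: "Suc (n - 1) = n"
    using assms(2) by simp
  have v': "is_functor (red i) (sk_cat (T (n - 1))) v"
    using sketch_mor_functor[OF v] by (simp add: red_cat)
  have tv: "is_functor (red i) (sk_cat (T n)) (comp_fun (red i) (t (n - 1)) v)"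
    using functor_comp[OF v' stage_functor red_polycategory[OF i(1)]] unfolding n .
  have "on_obj (l n) (on_obj (comp_fun (red i) (t (n - 1)) v) r) = on_obj (l (n - 1)) (on_obj v r)"
    if "r \<in> set (ord i)" for r
    using that seq.l_t[OF functor_obj[OF v']] red_Obj[OF i(1)] unfolding n by (simp add: comp_fun_def)
  then have "args n i (comp_fun (red i) (t (n - 1)) v) = args (n - 1) i v"
    by (simp add: args_def)
  then have "u = comp_fun (red i) (t (n - 1)) v"
    using args_eq_iff[OF i(1) tv i(2)] eq by simp
  then show False
    using assms v by (auto simp: cone_maps_def red_cat)
qed

lemma cone_maps_unique:
  assumes u: "(i, u) \<in> cone_maps D T t n" and v: "(i, v) \<in> cone_maps D T t m"
    and eq: "args n i u = args m i v"
  shows "n = m \<and> u = v"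
proof -
  have "\<not> m < n" "\<not> n < m"
    using cone_maps_least[OF u, of m] cone_maps_least[OF v, of n] eq
      args_level[OF cone_maps_functor[OF u]] args_level[OF cone_maps_functor[OF v]] by auto
  then show ?thesis
    using eq args_eq_iff[OF cone_maps_functor[OF u]] cone_maps_functor[OF v] by auto
qed

text \<open>
  Finitely many arguments occur together at some stage; at the first such stage their diagram does
  not come from the previous one.
\<close>

lemma cone_maps_exist:
  assumes xs: "valid_args D ord (sk_cat L) i xs"
  obtains n u where "(i, u) \<in> cone_maps D T t n" "args n i u = xs"
proof -
  have "set xs \<subseteq> (\<Union>n. level n)"
    using xs unfolding level_cover[symmetric] by (auto simp: valid_args_def in_set_conv_nth)
  then have ex: "\<exists>n. set xs \<subseteq> level n"
    by (intro incseq_finite_subset level_mono) auto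
  define n where "n = (LEAST n. set xs \<subseteq> level n)"
  obtain u where u: "sketch_mor D (reduct_sketch D i) (T n) u" and eq: "args n i u = xs"
    using args_exist[OF xs, of n] LeastI_ex[OF ex] unfolding n_def by blast
  have "(i, u) \<in> cone_maps D T t n"
    unfolding cone_maps_def
  proof (clarsimp, intro conjI impI allI notI)
    show i: "i \<in> cones D"
      using xs by (simp add: valid_args_def)
    fix v assume n: "0 < n" and v: "sketch_mor D (reduct_sketch D i) (T (n - Suc 0)) v"
      and uv: "u = sk_comp (reduct_sketch D i) (t (n - Suc 0)) v"
    have v': "is_functor (red i) (sk_cat (T (n - 1))) v"
      using sketch_mor_functor[OF v] by (simp add: red_cat)
    have "on_obj (l n) (on_obj u r) = on_obj (l (n - 1)) (on_obj v r)" if "r \<in> set (ord i)" for r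
      using that seq.l_t[OF functor_obj[OF v']] red_Obj[OF i] n by (simp add: comp_fun_def uv red_cat)
    then have "args (n - 1) i v = xs"
      unfolding eq[symmetric] args_def by simp
    then have "set xs \<subseteq> level (n - 1)"
      using args_level[OF i v'] by simp
    then show False
      using n not_less_Least[of "n - 1" "\<lambda>n. set xs \<subseteq> level n"] by (simp add: n_def)
  qed (rule u)
  then show ?thesis
    using that eq by blast
qed

text \<open>
  There is exactly one candidate for valid arguments, by \<open>cone_maps_exist\<close> and
  \<open>cone_maps_unique\<close>.
\<close>

definition cone_op :: "'i \<Rightarrow> 'o list \<Rightarrow> 'o" where
  "cone_op i xs = (SOME z. \<exists>n u. (i, u) \<in> cone_maps D T t n \<and> args n i u = xs \<and>
     z = on_obj (l (Suc n)) (new_obj n i u))"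

lemma cone_op_args:
  assumes u: "(i, u) \<in> cone_maps D T t n"
  shows "cone_op i (args n i u) = on_obj (l (Suc n)) (new_obj n i u)"
  unfolding cone_op_def
proof (rule some_equality)
  fix z
  assume "\<exists>m v. (i, v) \<in> cone_maps D T t m \<and> args m i v = args n i u \<and>
     z = on_obj (l (Suc m)) (new_obj m i v)"
  then obtain m v where v: "(i, v) \<in> cone_maps D T t m" "args m i v = args n i u"
    and z: "z = on_obj (l (Suc m)) (new_obj m i v)"
    by blast
  then show "z = on_obj (l (Suc n)) (new_obj n i u)"
    using cone_maps_unique[OF v(1) u v(2)] by simp
qed (use u in blast)

lemma new_obj_in: "(i, u) \<in> cone_maps D T t n \<Longrightarrow> new_obj n i u \<in> Objs (Suc n)"
  unfolding stage_cover by blast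

lemma new_obj_level:
  assumes "(i, u) \<in> cone_maps D T t n"
  shows "on_obj (l (Suc n)) (new_obj n i u) \<in> level (Suc n)"
    and "on_obj (l (Suc n)) (new_obj n i u) \<notin> level n"
proof -
  show "on_obj (l (Suc n)) (new_obj n i u) \<in> level (Suc n)"
    using new_obj_in[OF assms] by (simp add: level_def)
  show "on_obj (l (Suc n)) (new_obj n i u) \<notin> level n"
  proof
    assume "on_obj (l (Suc n)) (new_obj n i u) \<in> level n"
    then obtain x where x: "x \<in> Objs n" "on_obj (l (Suc n)) (new_obj n i u) = on_obj (l n) x"
      by (auto simp: level_def)
    then have "on_obj (l (Suc n)) (new_obj n i u) = on_obj (l (Suc n)) (on_obj (t n) x)"
      by (simp add: seq.l_t)
    then have "new_obj n i u = on_obj (t n) x"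
      using seq.objects_inj[of "Suc n"] new_obj_in[OF assms] functor_obj[OF stage_functor x(1)]
      by (auto simp: inj_on_def)
    then show False
      using new_obj_fresh[OF assms] x(1) by blast
  qed
qed

lemma cone_op_in:
  assumes "valid_args D ord (sk_cat L) i xs"
  shows "cone_op i xs \<in> Obj (sk_cat L)"
    and "cls_of (sk_cat L) (cone_op i xs) = cls_of (cone D i) (fst (vertex D i))"
    and "cone_op i xs \<notin> level 0"
proof -
  obtain n u where u: "(i, u) \<in> cone_maps D T t n" and eq: "args n i u = xs"
    using cone_maps_exist[OF assms] .
  have op: "cone_op i xs = on_obj (l (Suc n)) (new_obj n i u)"
    using cone_op_args[OF u] eq by simp
  note new = new_obj_in[OF u]
  show "cone_op i xs \<in> Obj (sk_cat L)"
    unfolding op using functor_obj[OF seq.l new] .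
  have kf: "is_functor (cone D i) (sk_cat (T (Suc n))) (k n (i, u))"
    using sketch_pushout.k[OF pushout_step u] by (simp add: cone_sketch_def)
  show "cls_of (sk_cat L) (cone_op i xs) = cls_of (cone D i) (fst (vertex D i))"
    unfolding op functor_cls[OF seq.l new]
    using functor_cls[OF kf] cone_vertex cone_maps_functor(1)[OF u] by (simp add: new_obj_def)
  show "cone_op i xs \<notin> level 0"
    unfolding op using new_obj_level(2)[OF u] monoD[OF level_mono, of 0 n] by auto
qed

text \<open>
  The stage at which a vertex is attached can be read off from the vertex, which lies in one level
  and not in the level before; and within a stage different diagrams have different vertices.
\<close>

lemma cone_op_inj:
  assumes xs: "valid_args D ord (sk_cat L) i xs" and ys: "valid_args D ord (sk_cat L) i' ys"
    and eq: "cone_op i xs = cone_op i' ys"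
  shows "i = i' \<and> xs = ys"
proof -
  obtain n u where u: "(i, u) \<in> cone_maps D T t n" and xs': "args n i u = xs"
    using cone_maps_exist[OF xs] .
  obtain m v where v: "(i', v) \<in> cone_maps D T t m" and ys': "args m i' v = ys"
    using cone_maps_exist[OF ys] .
  have eq': "on_obj (l (Suc n)) (new_obj n i u) = on_obj (l (Suc m)) (new_obj m i' v)"
    using eq cone_op_args[OF u] cone_op_args[OF v] xs' ys' by simp
  have "\<not> n < m" "\<not> m < n"
    using new_obj_level[OF u] new_obj_level[OF v] eq'
      monoD[OF level_mono, of "Suc n" m] monoD[OF level_mono, of "Suc m" n] by auto
  then have nm: "m = n"
    by simp
  then have "new_obj n i u = new_obj n i' v"
    using eq' seq.objects_inj[of "Suc n"] new_obj_in[OF u] new_obj_in[OF v] by (auto simp: inj_on_def)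
  then show ?thesis
    using new_obj_inj[OF u] v xs' ys' nm by blast
qed

lemma cone_op_generates:
  assumes "level 0 \<subseteq> Z"
    and "\<And>i xs. valid_args D ord (sk_cat L) i xs \<Longrightarrow> set xs \<subseteq> Z \<Longrightarrow> cone_op i xs \<in> Z"
  shows "Obj (sk_cat L) \<subseteq> Z"
proof -
  have "level n \<subseteq> Z" for n
  proof (induction n)
    case (Suc n)
    have "on_obj (l (Suc n)) z \<in> Z" if "z \<in> Objs (Suc n)" for z
      using that unfolding stage_cover
    proof (elim UnE)
      assume "z \<in> on_obj (t n) ` Objs n"
      then show ?thesis
        using Suc seq.l_t by (auto simp: level_def)
    next
      assume "z \<in> {new_obj n i u | i u. (i, u) \<in> cone_maps D T t n}"
      then obtain i u where u: "(i, u) \<in> cone_maps D T t n" and z: "z = new_obj n i u"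
        by blast
      note i = cone_maps_functor[OF u]
      show ?thesis
        using assms(2)[OF args_valid[OF i]] args_level[OF i] Suc cone_op_args[OF u] z by auto
    qed
    then show ?case
      by (auto simp: level_def)
  qed (rule assms(1))
  then show ?thesis
    unfolding level_cover by blast
qed

end

section \<open>Type expressions\<close>

primrec interp :: "('o \<Rightarrow> 'e) \<Rightarrow> ('i \<Rightarrow> 'e list \<Rightarrow> 'e) \<Rightarrow> ('o, 'i) ty_expr \<Rightarrow> 'e" where
  "interp \<iota> op (Base A) = \<iota> A"
| "interp \<iota> op (ConeOp i Rs) = op i (map (interp \<iota> op) Rs)"

text \<open>
  The hypotheses say that the objects of \<open>Q\<close> form a free algebra on those of \<open>S\<close>: generators and
  values of the operations are pairwise distinct, and they generate. The valid type expressions are the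
  standard model of this free algebra, to which any other is isomorphic.
\<close>

lemma interp_bij:
  fixes Q :: "('e, 'n) lnl"
  assumes \<iota>: "\<And>A. A \<in> Obj S \<Longrightarrow> \<iota> A \<in> Obj Q \<and> cls_of Q (\<iota> A) = cls_of S A"
    and \<iota>_inj: "inj_on \<iota> (Obj S)"
    and op: "\<And>i xs. valid_args D ord Q i xs \<Longrightarrow>
      op i xs \<in> Obj Q \<and> cls_of Q (op i xs) = cls_of (cone D i) (fst (vertex D i)) \<and> op i xs \<notin> \<iota> ` Obj S"
    and op_inj: "\<And>i xs i' ys. \<lbrakk>valid_args D ord Q i xs; valid_args D ord Q i' ys; op i xs = op i' ys\<rbrakk>
      \<Longrightarrow> i = i' \<and> xs = ys"
    and gen: "\<And>Z. \<lbrakk>\<iota> ` Obj S \<subseteq> Z; \<And>i xs. valid_args D ord Q i xs \<Longrightarrow> set xs \<subseteq> Z \<Longrightarrow> op i xs \<in> Z\<rbrakk>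
      \<Longrightarrow> Obj Q \<subseteq> Z"
  shows "bij_betw (interp \<iota> op) {R. is_type D ord S R \<tau>} {A \<in> Obj Q. cls_of Q A = \<tau>}"
proof -
  let ?f = "interp \<iota> op"
  have typed: "?f R \<in> Obj Q \<and> cls_of Q (?f R) = \<tau>" if "is_type D ord S R \<tau>" for R \<tau>
    using that
  proof induction
    case (cone_type i Rs)
    then have "valid_args D ord Q i (map ?f Rs)"
      by (simp add: valid_args_def)
    then show ?case
      using op by simp
  qed (simp add: \<iota>)
  have valid: "valid_args D ord Q i (map ?f Rs)"
    if "i \<in> cones D" "length Rs = length (ord i)"
      "\<forall>j < length (ord i). is_type D ord S (Rs ! j) (cls_of (cone D i) (ord i ! j))" for i Rs
  proof -
    have "?f (Rs ! j) \<in> Obj Q \<and> cls_of Q (?f (Rs ! j)) = cls_of (cone D i) (ord i ! j)"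
      if "j < length (ord i)" for j
      using typed that \<open>\<forall>j < length (ord i). _ j\<close> by blast
    then show ?thesis
      using that by (simp add: valid_args_def)
  qed
  have inj: "R = R'" if "is_type D ord S R \<tau>" "is_type D ord S R' \<tau>'" "?f R = ?f R'" for R R' \<tau> \<tau>'
    using that
  proof (induction arbitrary: R' \<tau>')
    case (base_type A)
    note A = base_type.hyps and eq = base_type.prems(2)
    from base_type.prems(1) show ?case
    proof cases
      case (base_type B)
      then show ?thesis
        using eq \<iota>_inj A by (auto simp: inj_on_def)
    next
      case (cone_type i Rs)
      then have "op i (map ?f Rs) \<notin> \<iota> ` Obj S"
        using valid op by blast
      then show ?thesis
        using eq A cone_type(1) by (metis imageI interp.simps)
    qed
  next
    case (cone_type i Rs)
    have v: "valid_args D ord Q i (map ?f Rs)"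
      using cone_type by (intro valid) auto
    from cone_type.prems(1) show ?case
    proof cases
      case (base_type A)
      then show ?thesis
        using op[OF v] cone_type.prems(2) by auto
    next
      case (cone_type i' Rs')
      have "i = i' \<and> map ?f Rs = map ?f Rs'"
        using cone_type cone_type.prems(2) by (intro op_inj v valid) auto
      then have i: "i' = i" and eq: "map ?f Rs = map ?f Rs'"
        by auto
      have len: "length Rs = length Rs'"
        using eq map_eq_imp_length_eq by blast
      have "Rs ! j = Rs' ! j" if "j < length Rs" for j
      proof -
        have "?f (Rs ! j) = ?f (Rs' ! j)"
          using arg_cong[OF eq, of "\<lambda>xs. xs ! j"] that len by simp
        then show ?thesis
          using cone_type.IH cone_type(4,5) that len i by auto
      qed
      then show ?thesis
        using len i cone_type by (simp add: list_eq_iff_nth_eq)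
    qed
  qed
  have surj: "Obj Q \<subseteq> {x. \<exists>R \<tau>. is_type D ord S R \<tau> \<and> ?f R = x}" (is "_ \<subseteq> ?Z")
  proof (rule gen)
    show "\<iota> ` Obj S \<subseteq> ?Z"
      using is_type.base_type by fastforce
  next
    fix i xs assume xs: "valid_args D ord Q i xs" and "set xs \<subseteq> ?Z"
    then have "\<forall>x \<in> set xs. \<exists>R. is_type D ord S R (cls_of Q x) \<and> ?f R = x"
      using typed by blast
    then obtain R where R: "\<And>x. x \<in> set xs \<Longrightarrow> is_type D ord S (R x) (cls_of Q x) \<and> ?f (R x) = x"
      by metis
    have "is_type D ord S (ConeOp i (map R xs)) (cls_of (cone D i) (fst (vertex D i)))"
      using xs R by (intro is_type.cone_type) (auto simp: valid_args_def, metis nth_mem)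
    moreover have "?f (ConeOp i (map R xs)) = op i xs"
      using R by (simp add: map_idI)
    ultimately show "op i xs \<in> ?Z"
      by blast
  qed
  show ?thesis
    unfolding bij_betw_def
  proof (intro conjI subset_antisym)
    show "inj_on ?f {R. is_type D ord S R \<tau>}"
      using inj by (auto simp: inj_on_def)
    show "{A \<in> Obj Q. cls_of Q A = \<tau>} \<subseteq> ?f ` {R. is_type D ord S R \<tau>}"
      using surj typed by blast
  qed (use typed in auto)
qed

theorem proposition8p1:
  fixes D :: "('o, 'm, 'i) doctrine"
    and S :: "('o, 'm) lnl"
    and \<pi> :: "('o, 'm, 'o, 'm) lnl_fun"
    and S_hat :: "('o, 'm, 'o, 'm, 'i) sketch"
    and ord :: "'i \<Rightarrow> 'o list"
    and \<tau> :: cls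
  assumes universe: "infinite (UNIV :: 'o set)"
    and "lnl_doctrine D"
    and "subterminal (base D)"
    and "\<forall>i \<in> cones D. discrete_cone (cone D i) (vertex D i) \<and> finite_cone (cone D i)"
    and "lnl_polycategory S"
    and "is_functor S (base D) \<pi>"
    and "is_free_category D (plain_sketch S \<pi>) S_hat"
    and "orders_reducts D ord"
  shows "\<exists>\<phi>. bij_betw \<phi> {R. is_type D ord S R \<tau>}
               {A \<in> Obj (sk_cat S_hat). cls_of (sk_cat S_hat) A = \<tau>}"
proof -
  interpret subterminal_doctrine D
    by (rule subterminal_doctrine.intro) fact+
  obtain S1 S2 where p1: "phase1 D (plain_sketch S \<pi>) S1" and p2: "phase2 D S1 S2"
    and p3: "phase3 D S2 S_hat"
    using assms(7) unfolding is_free_category_def by blast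
  obtain T t l where start: "T 0 = plain_sketch S \<pi>"
    and po: "\<forall>n. \<exists>k. is_pushout D (cone_maps D T t n)
                   (\<lambda>(i, u). reduct_sketch D i) (\<lambda>(i, u). cone_sketch D i)
                   (\<lambda>(i, u). id_fun (reduct (cone D i) (vertex D i))) (\<lambda>(i, u). u)
                   (T n) (T (Suc n)) (t n) k"
    and col: "is_seq_colimit D T t S1 l"
    using p1 unfolding phase1_def by (elim exE conjE) (rule that)
  obtain k where k: "\<And>n. is_pushout D (cone_maps D T t n)
                   (\<lambda>(i, u). reduct_sketch D i) (\<lambda>(i, u). cone_sketch D i)
                   (\<lambda>(i, u). id_fun (reduct (cone D i) (vertex D i))) (\<lambda>(i, u). u)
                   (T n) (T (Suc n)) (t n) (k n)"
    using choice[OF po] by blast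
  have S: "is_sketch D (plain_sketch S \<pi>)"
    using assms(5,6) by (intro is_sketchI) (simp_all add: plain_sketch_def)
  interpret cone_tower D T t k S1 l ord
    using universe assms(4,8) S col k
    by (intro cone_tower.intro[OF subterminal_doctrine_axioms] cone_tower_axioms.intro) (auto simp: start)
  have Objs0: "Objs 0 = Obj S" and cls0: "cls_of (sk_cat (T 0)) = cls_of S"
    by (simp_all add: start plain_sketch_def)
  have "bij_betw (interp (on_obj (l 0)) cone_op) {R. is_type D ord S R \<tau>}
      {A \<in> Obj (sk_cat S1). cls_of (sk_cat S1) A = \<tau>}"
  proof (rule interp_bij)
    show "on_obj (l 0) A \<in> Obj (sk_cat S1) \<and> cls_of (sk_cat S1) (on_obj (l 0) A) = cls_of S A"
      if "A \<in> Obj S" for A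
      using that functor_obj[OF seq.l[of 0]] functor_cls[OF seq.l[of 0]] by (simp add: Objs0 cls0)
    show "inj_on (on_obj (l 0)) (Obj S)"
      using seq.objects_inj[of 0] by (simp add: Objs0)
  qed (use cone_op_in cone_op_inj cone_op_generates in \<open>auto simp: level_def Objs0\<close>)
  moreover obtain f where f: "is_sketch D S2" "is_functor (sk_cat S1) (sk_cat S2) f"
      "bij_betw (on_obj f) (Obj (sk_cat S1)) (Obj (sk_cat S2))"
    using phase2_objects[OF universe seq.L p2] .
  moreover obtain g where g: "is_functor (sk_cat S2) (sk_cat S_hat) g"
      "bij_betw (on_obj g) (Obj (sk_cat S2)) (Obj (sk_cat S_hat))"
    using phase3_objects[OF universe f(1) p3] .
  moreover have restrict: "bij_betw (on_obj h) {A \<in> Obj P. cls_of P A = \<tau>} {A \<in> Obj Q. cls_of Q A = \<tau>}"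
    if h: "is_functor P Q h" "bij_betw (on_obj h) (Obj P) (Obj Q)"
    for P Q :: "('o, 'm) lnl" and h
  proof (rule bij_betw_subset[OF h(2)])
    have "on_obj h ` Obj P = Obj Q"
      using h(2) by (simp add: bij_betw_def)
    then show "on_obj h ` {A \<in> Obj P. cls_of P A = \<tau>} = {A \<in> Obj Q. cls_of Q A = \<tau>}"
      using functor_cls[OF h(1)] by (auto simp: image_iff set_eq_iff) metis+
  qed auto
  ultimately show ?thesis
    using bij_betw_trans[OF bij_betw_trans[OF _ restrict[OF f(2,3)]] restrict[OF g]] by blast
qed

end
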